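(* Let $m=1$, $\gamma\in(0,\infty)$, $\alpha\in(0,1]$, and set $s(\gamma)=\tfrac12(1-\tfrac\alpha\gamma)^+$. For every admissible curve $\Gamma$ with Hölder exponent $\alpha$ and every $s>s(\gamma)$, $\lim_{t\to0^+}P^1_\gamma f(\Gamma(x,t),t)=f(x)$ for a.e. $x\in\mathbb{R}$, for all $f\in H^s(\mathbb{R})$. Conversely, there exists an admissible curve $\Gamma$ with Hölder exponent $\alpha$ such that for every $s<s(\gamma)$ there is $f\in H^s(\mathbb{R})$ for which this a.e. convergence fails.
   Context: For $m>0$, $\gamma>0$, $f\in H^s(\mathbb{R})$, $\Gamma:\mathbb{R}\times[-1,1]\to\mathbb{R}$ and $t\in[0,1]$, define $$P^m_\gamma f(\Gamma(x,t),t)=\frac1{2\pi}\int_{\mathbb{R}}e^{i(\Gamma(x,t)\xi+t|\xi|^m)}e^{-t^\gamma|\xi|^m}\hat f(\xi)\,d\xi,$$ where $\hat f(\xi)=\int e^{-ix\xi}f(x)\,dx$. An admissible curve with Hölder exponent $\alpha\in(0,1]$ is a continuous $\Gamma:\mathbb{R}\times[-1,1]\to\mathbb{R}$ with $\Gamma(x,0)=x$, bilipschitz in $x$: $C_1|x-x'|\le|\Gamma(x,t)-\Gamma(x',t)|\le C_2|x-x'|$ for all $t\in[-1,1]$, $x,x'\in\mathbb{R}$, and $\alpha$-Hölder in $t$: $|\Gamma(x,t)-\Gamma(x,t')|\le C_3|t-t'|^\alpha$ for all $x\in\mathbb{R}$, $t,t'\in[-1,1]$, with constants $C_1,C_2,C_3>0$.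 $a^+=\max\{a,0\}$.
   Formalization: The converse is stated for 0 ≤ s < s(γ) with f in L²: for s < 0 < s(γ) it follows from s = 0 since L² ⊂ H^s, and for s < 0 = s(γ) elements of H^s that are not functions have no values f(x), while for functions the convergence holds. *)

theory Defs
  imports "HOL-Analysis.Analysis"
begin

definition square_integrable :: "(real \<Rightarrow> complex) \<Rightarrow> bool" where
  "square_integrable f \<longleftrightarrow>
     f \<in> borel_measurable lborel \<and> integrable lborel (\<lambda>x. (cmod (f x))\<^sup>2)"

definition is_fourier_L2 :: "(real \<Rightarrow> complex) \<Rightarrow> (real \<Rightarrow> complex) \<Rightarrow> bool" where
  "is_fourier_L2 f F \<longleftrightarrow> square_integrable F \<and>
     ((\<lambda>R::real. LINT \<xi>|lborel.
         (cmod (F \<xi> - (LINT x:{-R..R}|lborel. exp (- \<i> * complex_of_real (x * \<xi>)) * f x)))\<^sup>2)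
       \<longlongrightarrow> 0) at_top"

definition fourier_hat :: "(real \<Rightarrow> complex) \<Rightarrow> real \<Rightarrow> complex" where
  "fourier_hat f = (SOME F. is_fourier_L2 f F)"

definition in_sobolev :: "real \<Rightarrow> (real \<Rightarrow> complex) \<Rightarrow> bool" where
  "in_sobolev s f \<longleftrightarrow> square_integrable f \<and>
     (\<exists>F. is_fourier_L2 f F \<and> integrable lborel (\<lambda>\<xi>. (1 + \<xi>\<^sup>2) powr s * (cmod (F \<xi>))\<^sup>2))"

definition P_op :: "real \<Rightarrow> real \<Rightarrow> (real \<Rightarrow> complex) \<Rightarrow> real \<Rightarrow> real \<Rightarrow> complex" where
  "P_op m \<gamma> f y t = complex_of_real (1 / (2 * pi)) *
     (LINT \<xi>|lborel. exp (\<i> * complex_of_real (y * \<xi> + t * \<bar>\<xi>\<bar> powr m))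
        * complex_of_real (exp (- (t powr \<gamma>) * \<bar>\<xi>\<bar> powr m)) * fourier_hat f \<xi>)"

definition admissible_curve :: "real \<Rightarrow> (real \<Rightarrow> real \<Rightarrow> real) \<Rightarrow> bool" where
  "admissible_curve \<alpha> \<Gamma> \<longleftrightarrow>
     continuous_on (UNIV \<times> {-1..1}) (\<lambda>(x, t). \<Gamma> x t) \<and>
     (\<forall>x. \<Gamma> x 0 = x) \<and>
     (\<exists>C1 C2 C3. C1 > 0 \<and> C2 > 0 \<and> C3 > 0 \<and>
        (\<forall>t\<in>{-1..1}. \<forall>x x'. C1 * \<bar>x - x'\<bar> \<le> \<bar>\<Gamma> x t - \<Gamma> x' t\<bar> \<and>
                                 \<bar>\<Gamma> x t - \<Gamma> x' t\<bar> \<le> C2 * \<bar>x - x'\<bar>) \<and>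
        (\<forall>x. \<forall>t\<in>{-1..1}. \<forall>t'\<in>{-1..1}. \<bar>\<Gamma> x t - \<Gamma> x t'\<bar> \<le> C3 * \<bar>t - t'\<bar> powr \<alpha>))"

definition converges_ae :: "real \<Rightarrow> real \<Rightarrow> (real \<Rightarrow> real \<Rightarrow> real) \<Rightarrow> (real \<Rightarrow> complex) \<Rightarrow> bool" where
  "converges_ae m \<gamma> \<Gamma> f \<longleftrightarrow>
     (AE x in lborel. ((\<lambda>t. P_op m \<gamma> f (\<Gamma> x t) t) \<longlongrightarrow> f x) (at_right 0))"

end

theory Submission
  imports Defs "HOL-Probability.Sinc_Integral" "HOL-Real_Asymp.Real_Asymp"
begin

text \<open>
  For \<open>m = 1\<close> the evolution of the positive frequencies is \<open>u (\<Gamma> x t + t, t powr \<gamma>)\<close>, with \<open>u\<close> the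
  Poisson extension to the upper half plane, and that of the negative ones is
  \<open>u (\<Gamma> x t - t, t powr \<gamma>)\<close>. As \<open>\<Gamma> x t \<plusminus> t\<close> has distance \<open>O (t powr \<alpha>)\<close> from \<open>x\<close>, the theorem is about
  boundary limits through the region \<open>\<bar>y - x\<bar> \<le> A * h powr \<beta>\<close>, where \<open>\<beta> = min 1 (\<alpha> / \<gamma>)\<close>.

  Vertical segments above a point of the region stay in the region, so the oscillation of \<open>u\<close> is at most
  the integral over \<open>\<eta>\<close> of the supremum of the vertical derivative at height \<open>\<eta>\<close>. A Sobolev inequality at scale
  \<open>\<eta>\<close> and Plancherel bound the square mean of this supremum by \<open>\<eta> powr (\<beta> - 1 + 2 * s - 2)\<close>,
  which makes the integral finite as soon as \<open>2 * s > 1 - \<beta>\<close>.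

  For the converse, \<open>\<Gamma> x t = x + \<bar>t\<bar> powr \<alpha> - t\<close> turns the evolution into \<open>u (x + \<tau>, \<tau> powr (\<gamma> / \<alpha>))\<close>.
  A comb of bumps \<open>h / (h - \<i> * (x - c))\<close> with spacing \<open>h powr (\<alpha> / \<gamma>)\<close> is small in \<open>H\<^sup>s\<close>, but every
  curve meets it at height at most \<open>h\<close>, where it has size one.
\<close>

text \<open>Origin of the exponents: the density at height \<eta> gets \<open>1 / \<eta>\<close>
  from the Sobolev inequality and \<open>\<eta> powr (2 * s - 2)\<close> from Plancherel, and
  averaging over \<open>x\<close> adds the width \<open>\<eta> powr \<beta>\<close> of the region.
  The derivative enters linearly while only its square mean is known, so half of the exponent
  \<open>\<beta> + 2 * s - 3\<close> has to exceed \<open>-1\<close>: this is the threshold. The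
  drift by \<open>t\<close> is absorbed by the region because \<alpha> \<le> 1, and \<beta> = 1 is
  nontangential approach, with threshold 0. The oscillation estimate yields the existence of limits
  directly, without a maximal inequality and a dense class, but not their value. The value is found
  by testing against intervals, where the Poisson kernel is explicit. Of Plancherel's theorem only
  the inequality is proved; the converse uses functions whose norms on both sides can be computed.
  Below the threshold the Sobolev norms of the combs decay geometrically with the scale, which
  leaves room for amplitudes that tend to infinity.\<close>

abbreviation damp :: "real \<Rightarrow> real \<Rightarrow> real" where
  "damp h x \<equiv> exp (- (h * \<bar>x\<bar>))"

abbreviation pker :: "real \<Rightarrow> real \<Rightarrow> real" where
  "pker h x \<equiv> 2 * h / (h\<^sup>2 + x\<^sup>2)"

abbreviation wsq :: "real \<Rightarrow> (real \<Rightarrow> complex) \<Rightarrow> real \<Rightarrow> real" where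
  "wsq s H \<xi> \<equiv> (1 + \<xi>\<^sup>2) powr s * (cmod (H \<xi>))\<^sup>2"

subsection \<open>The Poisson kernel\<close>

lemma borel_measurable_cis [measurable (raw)]:
  "f \<in> borel_measurable M \<Longrightarrow> (\<lambda>x. cis (f x)) \<in> borel_measurable M"
  by (rule borel_measurable_continuous_on[of cis]) (auto intro: continuous_intros)

text \<open>Justifies every exchange of Bochner integrals below: the kernels are dominated by a
  product of two integrable functions of one variable each.\<close>

lemma (in pair_sigma_finite) integrable_product_bound:
  fixes k :: "'a \<Rightarrow> 'b \<Rightarrow> 'c::{banach, second_countable_topology}"
  assumes [measurable]: "case_prod k \<in> borel_measurable (M1 \<Otimes>\<^sub>M M2)"
    and f: "integrable M1 f" and g: "integrable M2 g"
    and le: "\<And>x y. norm (k x y) \<le> f x * g y"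
  shows "integrable (M1 \<Otimes>\<^sub>M M2) (case_prod k)"
proof -
  note [measurable] = borel_measurable_integrable[OF f] borel_measurable_integrable[OF g]
  have "integrable (M1 \<Otimes>\<^sub>M M2) (\<lambda>(x, y). f x * g y)"
    by (rule Fubini_integrable) (auto simp: abs_mult intro!: integrable_mult_right integrable_mult_left f g)
  then show ?thesis
    by (rule Bochner_Integration.integrable_bound) (auto intro!: AE_I2 order_trans[OF le])
qed

lemma integrable_indicator_Icc: "integrable lborel (indicat_real {a..b::real})"
  by (simp add: emeasure_lborel_Icc_eq integrable_real_indicator)

lemma exp_neg_abs_integrable:
  fixes h :: real assumes "h > 0"
  shows "integrable lborel (\<lambda>x::real. damp h x)"
proof -
  have "set_integrable lborel {0<..} (\<lambda>x. exp (-(x * h)))"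
    by (rule integrable_I0i_exp_mscale[OF assms])
  then have "integrable lborel (\<lambda>x. indicator {0..} x *\<^sub>R exp (-(h * \<bar>x\<bar>)))"
    unfolding set_integrable_def
    by (rule integrable_discrete_difference[where X="{0}", THEN iffD1, rotated 4])
       (auto split: split_indicator simp: mult.commute)
  from has_bochner_integral_even_function[OF has_bochner_integral_integrable[OF this]]
  show ?thesis by (auto simp: has_bochner_integral_iff)
qed

text \<open>The fundamental theorem of calculus with antiderivative
  \<open>exp (of_real x * w) / w\<close>, where the real part of \<open>w\<close> is
  \<open>- h\<close>. The complex value is kept because it serves twice: two conjugate copies add up
  to the Poisson kernel, and a single one is the bump of the converse.\<close>

lemma has_bochner_integral_exp_half_line:
  fixes h c :: real assumes "h > 0"
  shows "has_bochner_integral lborel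
    (\<lambda>x. indicator {0<..} x *\<^sub>R (cis (c * x) * of_real (exp (- (h * x)))))
    (1 / (of_real h - \<i> * of_real c))"
proof -
  define w where "w = \<i> * of_real c - complex_of_real h"
  have w: "w \<noteq> 0" "1 / (of_real h - \<i> * of_real c) = 0 - 1 / w"
    using assms by (auto simp: w_def complex_eq_iff minus_divide_right)
  have eq: "cis (c * x) * of_real (exp (- (h * x))) = exp (of_real x * w)" for x
    by (simp add: w_def cis_conv_exp exp_of_real[symmetric] exp_add[symmetric] algebra_simps)
  have int: "set_integrable lborel (einterval 0 \<infinity>) (\<lambda>x. exp (of_real x * w))"
  proof -
    have "set_integrable lborel {0<..} (\<lambda>x. exp (-(x * h)))"
      by (rule integrable_I0i_exp_mscale[OF assms])
    then have "set_integrable lborel {0<..} (\<lambda>x. exp (of_real x * w))"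
      unfolding set_integrable_def
      by (rule Bochner_Integration.integrable_bound)
         (auto simp: norm_mult w_def mult.commute intro!: measurable_compose[OF _ borel_measurable_exp] split: split_indicator)
    moreover have "einterval 0 \<infinity> = {0<..}" by (auto simp: einterval_def)
    ultimately show ?thesis by simp
  qed
  have lim: "((\<lambda>x. exp (of_real x * w) / w) \<longlongrightarrow> 0) at_top"
  proof (rule Lim_null_comparison)
    show "\<forall>\<^sub>F x in at_top. norm (exp (of_real x * w) / w) \<le> exp (- (h * x)) / norm w"
      by (auto simp: norm_divide w_def mult.commute)
    have "((\<lambda>x. exp (- (h * x))) \<longlongrightarrow> 0) at_top"
      using assms by real_asymp
    from tendsto_divide[OF this tendsto_const[of "norm w"]]
    show "((\<lambda>x. exp (- (h * x)) / norm w) \<longlongrightarrow> 0) at_top" using w by simp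
  qed
  have "(LBINT x=0..\<infinity>. exp (of_real x * w)) = 0 - 1 / w"
  proof (rule interval_integral_FTC_integrable[where F = "\<lambda>x. exp (of_real x * w) / w"])
    fix x :: real
    have "((\<lambda>x. exp (x * w) / w) has_field_derivative exp (of_real x * w)) (at (of_real x))"
      using w by (auto intro!: derivative_eq_intros)
    from field_vector_diff_chain_at[OF has_vector_derivative_of_real[OF DERIV_ident] this]
    show "((\<lambda>x. exp (of_real x * w) / w) has_vector_derivative exp (of_real x * w)) (at x)"
      by (simp add: o_def)
    show "isCont (\<lambda>x. exp (complex_of_real x * w)) x" by (intro continuous_intros)
  next
    have "isCont (\<lambda>x. exp (complex_of_real x * w) / w) 0" using w by (intro continuous_intros)
    then have "((\<lambda>x. exp (complex_of_real x * w) / w) \<longlongrightarrow> 1 / w) (at_right 0)"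
      by (auto simp: isCont_def intro: filterlim_at_split[THEN iffD1, THEN conjunct2])
    then show "(((\<lambda>x. exp (complex_of_real x * w) / w) \<circ> real_of_ereal) \<longlongrightarrow> 1 / w) (at_right 0)"
      by (simp add: zero_ereal_def ereal_tendsto_simps)
    show "(((\<lambda>x. exp (complex_of_real x * w) / w) \<circ> real_of_ereal) \<longlongrightarrow> 0) (at_left \<infinity>)"
      using lim by (simp add: ereal_tendsto_simps)
  qed (use int in auto)
  moreover have "einterval 0 \<infinity> = {0<..}" by (auto simp: einterval_def)
  ultimately show ?thesis
    using int w unfolding has_bochner_integral_iff eq
    by (auto simp: interval_lebesgue_integral_def set_lebesgue_integral_def set_integrable_def)
qed

lemma has_bochner_integral_poisson_fourier:
  fixes h c :: real assumes "h > 0"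
  shows "has_bochner_integral lborel
    (\<lambda>x. cis (c * x) * of_real (damp h x)) (of_real (pker h c))"
proof -
  let ?f = "\<lambda>c x. indicator {0<..} x *\<^sub>R (cis (c * x) * complex_of_real (exp (- (h * x))))"
  \<comment> \<open>The negative half-line is the reflected positive one, with \<open>c\<close>
    turned into \<open>- c\<close>.\<close>
  have "has_bochner_integral lborel (\<lambda>x. ?f (-c) (0 + (-1) * x)) ((1 / (of_real h - \<i> * of_real (-c))) /\<^sub>R \<bar>-1\<bar>)"
    by (subst lborel_has_bochner_integral_real_affine_iff[symmetric, where c="-1" and t=0])
       (use has_bochner_integral_exp_half_line[OF assms, of "-c"] in auto)
  then have 2: "has_bochner_integral lborel (\<lambda>x. ?f c x + ?f (-c) (-x)) (1 / (of_real h - \<i> * of_real c) + 1 / (of_real h + \<i> * of_real c))"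
    by (intro has_bochner_integral_add has_bochner_integral_exp_half_line[OF assms]) auto
  have nz: "h\<^sup>2 + c\<^sup>2 \<noteq> 0" using assms by (simp add: add_pos_nonneg less_imp_neq)
  have "1 / (of_real h - \<i> * of_real c) + 1 / (of_real h + \<i> * of_real c) = complex_of_real (pker h c)"
    using assms nz by (simp add: complex_eq_iff Re_divide Im_divide field_simps power2_eq_square)
  with 2 have "has_bochner_integral lborel (\<lambda>x. ?f c x + ?f (-c) (-x)) (of_real (pker h c))"
    by metis
  \<comment> \<open>The two open half-lines leave out only the origin.\<close>
  then show ?thesis
    by (rule has_bochner_integral_discrete_difference[where X="{0}", THEN iffD1, rotated 4])
       (auto split: split_indicator)
qed

lemma has_bochner_integral_poisson:
  fixes h a :: real assumes "h > 0"
  shows "has_bochner_integral lborel (\<lambda>x. pker h (a - x)) (2 * pi)"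
proof -
  have "has_bochner_integral lborel (\<lambda>x. inverse (1 + x\<^sup>2)) pi"
    using integrable_inverse_1_plus_square LBINT_inverse_1_plus_square
    by (auto simp: has_bochner_integral_iff set_integrable_def interval_lebesgue_integral_def
        set_lebesgue_integral_def)
  then have "has_bochner_integral lborel (\<lambda>x. inverse (1 + (a/h + (- 1 / h) * x)\<^sup>2)) (pi /\<^sub>R \<bar>- 1/h\<bar>)"
    using assms by (subst lborel_has_bochner_integral_real_affine_iff[symmetric]) auto
  then have "has_bochner_integral lborel (\<lambda>x. (2 / h) * inverse (1 + (a/h + (- 1 / h) * x)\<^sup>2)) ((2/h) * (pi /\<^sub>R \<bar>- 1/h\<bar>))"
    by (rule has_bochner_integral_mult_right) 
  moreover have "(2 / h) * inverse (1 + (a/h + (- 1 / h) * x)\<^sup>2) = pker h (a - x)" for x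
  proof -
    have "a/h + (- 1 / h) * x = (a - x) / h" using assms by (simp add: field_simps)
    then have "1 + (a/h + (- 1 / h) * x)\<^sup>2 = (h\<^sup>2 + (a - x)\<^sup>2) / h\<^sup>2"
      using assms by (simp add: power_divide add_divide_distrib)
    then show ?thesis using assms by (simp add: power2_eq_square)
  qed
  ultimately show ?thesis using assms by simp
qed

subsection \<open>Square integrable functions\<close>

text \<open>The square of the L2 norm, so that no roots are taken; the price is a factor 2 per
  summand in the triangle inequality. The value is 0 by default when the square is not integrable,
  which is why square integrability is carried along separately.\<close>

definition norm2 :: "(real \<Rightarrow> complex) \<Rightarrow> real" where
  "norm2 f = (LINT x|lborel. (cmod (f x))\<^sup>2)"

lemma norm2_nonneg: "0 \<le> norm2 f"
  by (simp add: norm2_def)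

lemma square_integrable_measurable [measurable_dest]:
  "square_integrable f \<Longrightarrow> f \<in> borel_measurable lborel"
  by (simp add: square_integrable_def)

lemma square_integrable_bound:
  assumes [measurable]: "f \<in> borel_measurable lborel" and g: "integrable lborel g"
    and le: "\<And>x. (cmod (f x))\<^sup>2 \<le> g x"
  shows "square_integrable f"
  unfolding square_integrable_def
  using Bochner_Integration.integrable_bound[OF g, of "\<lambda>x. (cmod (f x))\<^sup>2"] le
  by (auto intro: order_trans[OF le abs_ge_self])

lemma norm2_mono:
  assumes "square_integrable g" "\<And>x. cmod (f x) \<le> cmod (g x)"
  shows "norm2 f \<le> norm2 g"
  using assms unfolding norm2_def square_integrable_def
  by (intro integral_mono_AE') (auto intro!: AE_I2 power_mono)

lemma square_integrable_dominated:
  assumes "f \<in> borel_measurable lborel" "square_integrable g" "\<And>x. cmod (f x) \<le> cmod (g x)"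
  shows "square_integrable f"
  using assms by (intro square_integrable_bound[of f "\<lambda>x. (cmod (g x))\<^sup>2"])
    (auto simp: square_integrable_def intro!: power_mono)

lemma cmod_add_square_le: "(cmod (a + b))\<^sup>2 \<le> 2 * (cmod a)\<^sup>2 + 2 * (cmod b)\<^sup>2"
proof -
  have "(cmod (a + b))\<^sup>2 \<le> (cmod a + cmod b)\<^sup>2" by (intro power_mono norm_triangle_ineq) auto
  also have "\<dots> \<le> 2 * (cmod a)\<^sup>2 + 2 * (cmod b)\<^sup>2" using sum_squares_bound[of "cmod a" "cmod b"] by (simp add: power2_sum)
  finally show ?thesis .
qed

lemma square_integrable_add:
  assumes [measurable]: "square_integrable f" "square_integrable g"
  shows "square_integrable (\<lambda>x. f x + g x)"
  using assms by (intro square_integrable_bound[of _ "\<lambda>x. 2 * (cmod (f x))\<^sup>2 + 2 * (cmod (g x))\<^sup>2"] cmod_add_square_le)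
     (auto simp: square_integrable_def)

lemma norm2_add_le:
  assumes "square_integrable f" "square_integrable g"
  shows "norm2 (\<lambda>x. f x + g x) \<le> 2 * norm2 f + 2 * norm2 g"
proof -
  have "norm2 (\<lambda>x. f x + g x) \<le> (LINT x|lborel. 2 * (cmod (f x))\<^sup>2 + 2 * (cmod (g x))\<^sup>2)"
    unfolding norm2_def using square_integrable_add[OF assms] assms
    by (intro integral_mono cmod_add_square_le) (auto simp: square_integrable_def)
  also have "\<dots> = 2 * norm2 f + 2 * norm2 g"
    using assms by (auto simp: square_integrable_def norm2_def)
  finally show ?thesis .
qed

lemma square_integrable_cmult: "square_integrable f \<Longrightarrow> square_integrable (\<lambda>x. c * f x)"
  by (auto simp: square_integrable_def norm_mult power_mult_distrib)

lemma norm2_cmult: "norm2 (\<lambda>x. c * f x) = (cmod c)\<^sup>2 * norm2 f"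
  by (auto simp: norm2_def norm_mult power_mult_distrib)

lemma square_integrable_minus: "square_integrable f \<Longrightarrow> square_integrable (\<lambda>x. - f x)"
  using square_integrable_cmult[of f "-1"] by simp

lemma norm2_minus_commute: "norm2 (\<lambda>x. f x - g x) = norm2 (\<lambda>x. g x - f x)"
  by (simp add: norm2_def norm_minus_commute)

lemma square_integrable_diff:
  "square_integrable f \<Longrightarrow> square_integrable g \<Longrightarrow> square_integrable (\<lambda>x. f x - g x)"
  using square_integrable_add[of f "\<lambda>x. - g x"] square_integrable_minus by simp

lemma norm2_triangle:
  assumes "square_integrable (\<lambda>x. f x - g x)" "square_integrable (\<lambda>x. g x - k x)"
  shows "norm2 (\<lambda>x. f x - k x) \<le> 2 * norm2 (\<lambda>x. f x - g x) + 2 * norm2 (\<lambda>x. g x - k x)"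
  using norm2_add_le[OF assms] by simp

lemma square_integrable_mult:
  assumes f: "square_integrable f" and g: "square_integrable g"
  shows "integrable lborel (\<lambda>x. f x * g x)"
proof (rule Bochner_Integration.integrable_bound)
  show "integrable lborel (\<lambda>x. (cmod (f x))\<^sup>2 + (cmod (g x))\<^sup>2)"
    using f g by (auto simp: square_integrable_def)
  have "a * b \<le> a\<^sup>2 + b\<^sup>2" if "0 \<le> a" "0 \<le> b" for a b :: real
    using sum_squares_bound[of a b] mult_nonneg_nonneg[OF that] by linarith
  then show "AE x in lborel. norm (f x * g x) \<le> norm ((cmod (f x))\<^sup>2 + (cmod (g x))\<^sup>2)"
    by (auto simp: norm_mult intro!: order_trans[OF _ abs_ge_self])
qed (use f g in measurable)

lemma
  assumes f: "square_integrable f"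
  shows square_integrable_reflect: "square_integrable (\<lambda>x. f (- x))"
    and norm2_reflect: "norm2 (\<lambda>x. f (- x)) = norm2 f"
proof -
  note [measurable] = square_integrable_measurable[OF f]
  have int: "integrable lborel (\<lambda>x. (cmod (f x))\<^sup>2)" using f by (simp add: square_integrable_def)
  have "(\<lambda>x. f (- x)) \<in> borel_measurable lborel" by measurable
  then show "square_integrable (\<lambda>x. f (- x))"
    using lborel_integrable_real_affine[OF int, of "-1" 0] by (simp add: square_integrable_def)
  show "norm2 (\<lambda>x. f (- x)) = norm2 f"
    unfolding norm2_def using lborel_integral_real_affine[of "-1" "\<lambda>x. (cmod (f x))\<^sup>2" 0] by simp
qed

text \<open>The quadratic polynomial in \<open>q\<close> is nonnegative; its value at the minimum
  gives the claim.\<close>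

lemma cauchy_schwarz_L2:
  assumes f: "square_integrable f" and g: "square_integrable g"
  shows "(cmod (LINT x|lborel. f x * g x))\<^sup>2 \<le> norm2 f * norm2 g"
proof -
  define c where "c = (LINT x|lborel. cmod (f x) * cmod (g x))"
  have int: "integrable lborel (\<lambda>x. cmod (f x) * cmod (g x))"
    using integrable_norm[OF square_integrable_mult[OF f g]] by (simp add: norm_mult)
  have le: "cmod (LINT x|lborel. f x * g x) \<le> c"
    unfolding c_def by (rule order_trans[OF integral_norm_bound]) (simp add: norm_mult)
  have q: "0 \<le> t\<^sup>2 * norm2 f + 2 * t * c + norm2 g" for t
  proof -
    have "0 \<le> (LINT x|lborel. (t * cmod (f x) + cmod (g x))\<^sup>2)" by simp
    also have "(LINT x|lborel. (t * cmod (f x) + cmod (g x))\<^sup>2) =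
      (LINT x|lborel. t\<^sup>2 * (cmod (f x))\<^sup>2 + (2 * t * (cmod (f x) * cmod (g x)) + (cmod (g x))\<^sup>2))"
      by (intro Bochner_Integration.integral_cong) (auto simp: power2_eq_square algebra_simps)
    also have "\<dots> = t\<^sup>2 * norm2 f + (2 * t * c + norm2 g)"
      using f g int by (auto simp: square_integrable_def norm2_def c_def)
    finally show ?thesis by simp
  qed
  have "c\<^sup>2 \<le> norm2 f * norm2 g"
  proof (cases "norm2 f = 0")
    case True
    have "c = 0"
    proof (rule ccontr)
      assume "c \<noteq> 0"
      \<comment> \<open>At this argument the polynomial, linear because \<open>norm2 f = 0\<close>,
        would take the value -1.\<close>
      then have "2 * (- (norm2 g + 1) / (2 * c)) * c = - (norm2 g + 1)" by simp
      then show False using q[of "- (norm2 g + 1) / (2 * c)"] True by simp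
    qed
    then show ?thesis using True by simp
  next
    case False
    then have pos: "norm2 f > 0" using norm2_nonneg[of f] by simp
    have "0 \<le> norm2 f * ((- c / norm2 f)\<^sup>2 * norm2 f + 2 * (- c / norm2 f) * c + norm2 g)"
      using q[of "- c / norm2 f"] pos by simp
    also have "\<dots> = norm2 f * norm2 g - c\<^sup>2"
      using pos by (simp add: field_simps power2_eq_square)
    finally show ?thesis by simp
  qed
  moreover have "(cmod (LINT x|lborel. f x * g x))\<^sup>2 \<le> c\<^sup>2" by (intro power_mono le) auto
  ultimately show ?thesis by linarith
qed

text \<open>For a function that is not integrable the left side is 0 by default, so estimates can
  pass at once to nonnegative integrals, where Tonelli's theorem applies freely.\<close>

lemma norm_integral_le_nn_integral:
  "ennreal (norm (integral\<^sup>L M f)) \<le> (\<integral>\<^sup>+x. ennreal (norm (f x)) \<partial>M)"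
  by (cases "integrable M f") (auto simp: integral_norm_bound_ennreal not_integrable_integral_eq)

subsection \<open>The Plancherel inequality\<close>

definition ft :: "(real \<Rightarrow> complex) \<Rightarrow> real \<Rightarrow> complex" where
  "ft G \<xi> = (LINT x|lborel. cis (- (x * \<xi>)) * G x)"

lemma borel_measurable_cnj' [measurable (raw)]:
  "f \<in> borel_measurable M \<Longrightarrow> (\<lambda>x. cnj (f x)) \<in> borel_measurable M"
  by (rule borel_measurable_continuous_on[of cnj]) (auto intro: continuous_intros)

lemma ft_measurable [measurable]:
  assumes [measurable]: "G \<in> borel_measurable lborel"
  shows "ft G \<in> borel_measurable lborel"
  unfolding ft_def by measurable

lemma integrable_cis_mult:
  assumes "integrable lborel G" and [measurable]: "u \<in> borel_measurable lborel"
  shows "integrable lborel (\<lambda>x. cis (u x) * G x)"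
  by (rule Bochner_Integration.integrable_bound[OF assms(1)])
     (use assms in \<open>auto simp: norm_mult\<close>)

lemma ft_bound:
  assumes "integrable lborel G"
  shows "cmod (ft G \<xi>) \<le> (LINT x|lborel. cmod (G x))"
  unfolding ft_def by (rule order_trans[OF integral_norm_bound]) (simp add: norm_mult)

text \<open>Damping the frequencies replaces Plancherel by a convolution with the Poisson kernel, which can be
  estimated by Schur's test.\<close>

lemma ft_square_poisson:
  assumes G: "integrable lborel G" and e: "e > 0"
  shows "(LINT \<xi>|lborel. of_real ((cmod (ft G \<xi>))\<^sup>2 * damp e \<xi>)) =
    (LINT x|lborel. G x * (LINT y|lborel. cnj (G y) * of_real (pker e (x - y))))"
proof -
  note [measurable] = borel_measurable_integrable[OF G]
  define M where "M = (LINT x|lborel. cmod (G x))"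
  have M: "cmod (ft G \<xi>) \<le> M" for \<xi> unfolding M_def by (rule ft_bound[OF G])
  have le: "cmod (ft G \<xi>) * (cmod (G x) * damp e \<xi>) \<le> M * (cmod (G x) * damp e \<xi>)" for \<xi> x
    by (intro mult_right_mono M) auto
  let ?w = "\<lambda>\<xi>. complex_of_real (damp e \<xi>)"
  \<comment> \<open>One of the two factors of the square is expanded here; the conjugate factor
    stays bounded by \<open>M\<close> during the first exchange of integrals and is expanded after
    it.\<close>
  have 1: "(LINT \<xi>|lborel. of_real ((cmod (ft G \<xi>))\<^sup>2 * damp e \<xi>)) =
     (LINT \<xi>|lborel. LINT x|lborel. cis (- (x * \<xi>)) * G x * (cnj (ft G \<xi>) * ?w \<xi>))"
  proof (intro Bochner_Integration.integral_cong refl)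
    fix \<xi>
    have "of_real ((cmod (ft G \<xi>))\<^sup>2 * damp e \<xi>) = ft G \<xi> * (cnj (ft G \<xi>) * ?w \<xi>)"
      by (simp add: complex_norm_square[symmetric] mult.assoc[symmetric] del: of_real_power)
    then show "of_real ((cmod (ft G \<xi>))\<^sup>2 * damp e \<xi>) =
      (LINT x|lborel. cis (- (x * \<xi>)) * G x * (cnj (ft G \<xi>) * ?w \<xi>))"
      by (simp add: ft_def)
  qed
  also have "\<dots> = (LINT x|lborel. LINT \<xi>|lborel. cis (- (x * \<xi>)) * G x * (cnj (ft G \<xi>) * ?w \<xi>))"
    by (rule lborel_pair.Fubini_integral[symmetric],
        rule lborel_pair.integrable_product_bound[where f="\<lambda>\<xi>. M * damp e \<xi>" and g="\<lambda>x. cmod (G x)"], measurable)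
       (use le in \<open>auto simp: norm_mult G mult_ac exp_neg_abs_integrable[OF e]\<close>)
  also have "\<dots> = (LINT x|lborel. G x * (LINT \<xi>|lborel. cis (- (x * \<xi>)) * cnj (ft G \<xi>) * ?w \<xi>))"
    by (intro Bochner_Integration.integral_cong refl, subst integral_mult_right_zero[symmetric])
       (simp add: mult_ac)
  also have "\<dots> = (LINT x|lborel. G x * (LINT y|lborel. cnj (G y) * of_real (pker e (x - y))))"
  proof (rule Bochner_Integration.integral_cong[OF refl], rule arg_cong2[where f="(*)", OF refl])
    fix x
    have "(LINT \<xi>|lborel. cis (- (x * \<xi>)) * cnj (ft G \<xi>) * ?w \<xi>) =
      (LINT \<xi>|lborel. LINT y|lborel. cnj (G y) * (cis ((y - x) * \<xi>) * ?w \<xi>))"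
    proof (intro Bochner_Integration.integral_cong refl)
      fix \<xi>
      have "cis (- (x * \<xi>)) * cnj (ft G \<xi>) * ?w \<xi> =
        (LINT y|lborel. cis (- (x * \<xi>)) * ?w \<xi> * cnj (cis (- (y * \<xi>)) * G y))"
        by (simp only: ft_def integral_mult_right_zero Bochner_Integration.integral_cnj mult_ac)
      also have "\<dots> = (LINT y|lborel. cnj (G y) * (cis ((y - x) * \<xi>) * ?w \<xi>))"
      proof (intro Bochner_Integration.integral_cong refl)
        fix y
        have "cis ((y - x) * \<xi>) = cis (- (x * \<xi>)) * cnj (cis (- (y * \<xi>)))"
          by (simp add: cis_cnj cis_mult algebra_simps)
        then show "cis (- (x * \<xi>)) * ?w \<xi> * cnj (cis (- (y * \<xi>)) * G y) = cnj (G y) * (cis ((y - x) * \<xi>) * ?w \<xi>)"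
          by simp
      qed
      finally show "cis (- (x * \<xi>)) * cnj (ft G \<xi>) * ?w \<xi> = \<dots>" .
    qed
    also have "\<dots> = (LINT y|lborel. LINT \<xi>|lborel. cnj (G y) * (cis ((y - x) * \<xi>) * ?w \<xi>))"
      by (rule lborel_pair.Fubini_integral[symmetric],
          rule lborel_pair.integrable_product_bound[where f="\<lambda>\<xi>. damp e \<xi>" and g="\<lambda>x. cmod (G x)"], measurable)
         (auto simp: norm_mult G mult_ac exp_neg_abs_integrable[OF e])
    also have "\<dots> = (LINT y|lborel. cnj (G y) * of_real (pker e (x - y)))"
      using has_bochner_integral_poisson_fourier[OF e]
      by (simp add: has_bochner_integral_iff power2_commute)
    finally show "(LINT \<xi>|lborel. cis (- (x * \<xi>)) * cnj (ft G \<xi>) * ?w \<xi>) = \<dots>" .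
  qed
  finally show ?thesis .
qed

text \<open>The bound on the damped integral does not depend on \<open>e\<close>, so Fatou's lemma
  removes the damping. The constant is the exact one, on which the cancellation in
  \<open>is_fourier_L2_inverse\<close> depends.\<close>

lemma plancherel_le:
  assumes G: "integrable lborel G" and G2: "square_integrable G"
  shows "square_integrable (ft G)" and "norm2 (ft G) \<le> 2 * pi * norm2 G"
proof -
  note [measurable] = borel_measurable_integrable[OF G]
  define M where "M = (LINT x|lborel. cmod (G x))"
  have M: "cmod (ft G \<xi>) \<le> M" for \<xi> unfolding M_def by (rule ft_bound[OF G])
  have N: "(\<integral>\<^sup>+x. ennreal ((cmod (G x))\<^sup>2) \<partial>lborel) = norm2 G"
    using G2 by (simp add: norm2_def square_integrable_def nn_integral_eq_integral)
  have bound: "(\<integral>\<^sup>+\<xi>. ennreal ((cmod (ft G \<xi>))\<^sup>2 * damp e \<xi>) \<partial>lborel) \<le> 2 * pi * norm2 G"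
    if e: "e > 0" for e
  proof -
    define K where "K = (\<lambda>x y::real. pker e (x - y))"
    have [measurable]: "case_prod K \<in> borel_measurable (lborel \<Otimes>\<^sub>M lborel)" unfolding K_def by measurable
    have K0: "0 \<le> K x y" for x y using e by (simp add: K_def)
    have K1: "(\<integral>\<^sup>+y. K x y \<partial>lborel) = ennreal (2 * pi)" for x
      using has_bochner_integral_poisson[OF e, of x] K0[of x]
      unfolding K_def by (subst nn_integral_eq_integral) (auto simp: has_bochner_integral_iff)
    have K2: "(\<integral>\<^sup>+x. K x y \<partial>lborel) = ennreal (2 * pi)" for y
      using K1[of y] by (simp add: K_def power2_commute)
    have "integrable lborel (\<lambda>\<xi>. (cmod (ft G \<xi>))\<^sup>2 * damp e \<xi>)"
    proof (rule Bochner_Integration.integrable_bound)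
      show "integrable lborel (\<lambda>\<xi>. M\<^sup>2 * damp e \<xi>)"
        by (simp add: exp_neg_abs_integrable[OF e])
      show "(\<lambda>\<xi>. (cmod (ft G \<xi>))\<^sup>2 * damp e \<xi>) \<in> borel_measurable lborel" by measurable
    qed (auto intro!: mult_right_mono power_mono M)
    then have "(\<integral>\<^sup>+\<xi>. ennreal ((cmod (ft G \<xi>))\<^sup>2 * damp e \<xi>) \<partial>lborel)
       = ennreal (norm (LINT \<xi>|lborel. complex_of_real ((cmod (ft G \<xi>))\<^sup>2 * damp e \<xi>)))"
      by (subst nn_integral_eq_integral) (auto simp del: of_real_mult)
    also have "\<dots> = ennreal (norm (LINT x|lborel. G x * (LINT y|lborel. cnj (G y) * of_real (K x y))))"
      unfolding K_def by (subst ft_square_poisson[OF G e]) simp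
    also have "\<dots> \<le> (\<integral>\<^sup>+x. ennreal (cmod (G x) * cmod (LINT y|lborel. cnj (G y) * of_real (K x y))) \<partial>lborel)"
      by (rule order_trans[OF norm_integral_le_nn_integral]) (simp add: norm_mult)
    also have "\<dots> \<le> (\<integral>\<^sup>+x. (\<integral>\<^sup>+y. ennreal (cmod (G x)) * ennreal (cmod (G y) * K x y) \<partial>lborel) \<partial>lborel)"
    proof (intro nn_integral_mono)
      fix x
      have "ennreal (cmod (LINT y|lborel. cnj (G y) * of_real (K x y))) \<le> (\<integral>\<^sup>+y. ennreal (cmod (G y) * K x y) \<partial>lborel)"
        by (rule order_trans[OF norm_integral_le_nn_integral]) (simp add: norm_mult K0)
      then show "ennreal (cmod (G x) * cmod (LINT y|lborel. cnj (G y) * of_real (K x y))) \<le>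
          (\<integral>\<^sup>+y. ennreal (cmod (G x)) * ennreal (cmod (G y) * K x y) \<partial>lborel)"
        by (subst nn_integral_cmult) (auto simp: ennreal_mult intro!: mult_left_mono)
    qed
    \<comment> \<open>Schur's test: the arithmetic-geometric mean inequality separates
      \<open>G x\<close> from \<open>G y\<close>, after which the kernel has integral
      \<open>2 * pi\<close> in either variable.\<close>
    also have "\<dots> \<le> (\<integral>\<^sup>+x. (\<integral>\<^sup>+y. ennreal (1/2 * (cmod (G x))\<^sup>2) * ennreal (K x y) + ennreal (1/2 * (cmod (G y))\<^sup>2) * ennreal (K x y) \<partial>lborel) \<partial>lborel)"
    proof (intro nn_integral_mono)
      fix x y
      have "cmod (G x) * cmod (G y) \<le> 1/2 * (cmod (G x))\<^sup>2 + 1/2 * (cmod (G y))\<^sup>2"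
        using sum_squares_bound[of "cmod (G x)" "cmod (G y)"] by simp
      from mult_right_mono[OF this K0[of x y]]
      show "ennreal (cmod (G x)) * ennreal (cmod (G y) * K x y) \<le>
        ennreal (1/2 * (cmod (G x))\<^sup>2) * ennreal (K x y) + ennreal (1/2 * (cmod (G y))\<^sup>2) * ennreal (K x y)"
        using K0[of x y] by (simp add: ennreal_mult[symmetric] ennreal_plus[symmetric] algebra_simps del: ennreal_plus)
    qed
    also have "\<dots> = (\<integral>\<^sup>+x. (\<integral>\<^sup>+y. ennreal (1/2 * (cmod (G x))\<^sup>2) * ennreal (K x y) \<partial>lborel) \<partial>lborel)
        + (\<integral>\<^sup>+x. (\<integral>\<^sup>+y. ennreal (1/2 * (cmod (G y))\<^sup>2) * ennreal (K x y) \<partial>lborel) \<partial>lborel)"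
      (is "?L = ?A + ?B")
    proof -
      have "?L = (\<integral>\<^sup>+x. (\<integral>\<^sup>+y. ennreal (1/2 * (cmod (G x))\<^sup>2) * ennreal (K x y) \<partial>lborel) +
          (\<integral>\<^sup>+y. ennreal (1/2 * (cmod (G y))\<^sup>2) * ennreal (K x y) \<partial>lborel) \<partial>lborel)"
        by (intro nn_integral_cong nn_integral_add) measurable
      also have "\<dots> = ?A + ?B"
        by (intro nn_integral_add) measurable
      finally show ?thesis .
    qed
    also have "(\<integral>\<^sup>+x. (\<integral>\<^sup>+y. ennreal (1/2 * (cmod (G y))\<^sup>2) * ennreal (K x y) \<partial>lborel) \<partial>lborel)
       = (\<integral>\<^sup>+y. (\<integral>\<^sup>+x. ennreal (1/2 * (cmod (G y))\<^sup>2) * ennreal (K x y) \<partial>lborel) \<partial>lborel)"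
      by (rule lborel_pair.Fubini') measurable
    also have "(\<integral>\<^sup>+x. (\<integral>\<^sup>+y. ennreal (1/2 * (cmod (G x))\<^sup>2) * ennreal (K x y) \<partial>lborel) \<partial>lborel) = ennreal (pi * norm2 G)"
    proof -
      have "(\<integral>\<^sup>+y. ennreal (1/2 * (cmod (G x))\<^sup>2) * ennreal (K x y) \<partial>lborel) = ennreal pi * ennreal ((cmod (G x))\<^sup>2)" for x
        by (subst nn_integral_cmult, measurable) (simp add: K1 ennreal_mult[symmetric])
      then show ?thesis
        by (simp add: nn_integral_cmult N ennreal_mult norm2_nonneg)
    qed
    also have "(\<integral>\<^sup>+y. (\<integral>\<^sup>+x. ennreal (1/2 * (cmod (G y))\<^sup>2) * ennreal (K x y) \<partial>lborel) \<partial>lborel) = ennreal (pi * norm2 G)"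
    proof -
      have "(\<integral>\<^sup>+x. ennreal (1/2 * (cmod (G y))\<^sup>2) * ennreal (K x y) \<partial>lborel) = ennreal pi * ennreal ((cmod (G y))\<^sup>2)" for y
        by (subst nn_integral_cmult, measurable) (simp add: K2 ennreal_mult[symmetric])
      then show ?thesis
        by (simp add: nn_integral_cmult N ennreal_mult norm2_nonneg)
    qed
    also have "ennreal (pi * norm2 G) + ennreal (pi * norm2 G) = ennreal (2 * pi * norm2 G)"
      by (simp add: ennreal_plus[symmetric] norm2_nonneg del: ennreal_plus)
    finally show ?thesis .
  qed
  have "(\<integral>\<^sup>+\<xi>. ennreal ((cmod (ft G \<xi>))\<^sup>2) \<partial>lborel) =
     (\<integral>\<^sup>+\<xi>. liminf (\<lambda>n. ennreal ((cmod (ft G \<xi>))\<^sup>2 * damp (1 / (real n + 1)) \<xi>)) \<partial>lborel)"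
  proof (intro nn_integral_cong)
    fix \<xi>
    have "(\<lambda>n. damp (1 / (real n + 1)) \<xi>) \<longlonglongrightarrow> damp 0 \<xi>"
      by (intro tendsto_intros) real_asymp
    then have "(\<lambda>n. (cmod (ft G \<xi>))\<^sup>2 * damp (1 / (real n + 1)) \<xi>) \<longlonglongrightarrow> (cmod (ft G \<xi>))\<^sup>2 * damp 0 \<xi>"
      by (rule tendsto_mult_left)
    then have "(\<lambda>n. (cmod (ft G \<xi>))\<^sup>2 * damp (1 / (real n + 1)) \<xi>) \<longlonglongrightarrow> (cmod (ft G \<xi>))\<^sup>2"
      by simp
    then show "ennreal ((cmod (ft G \<xi>))\<^sup>2) = liminf (\<lambda>n. ennreal ((cmod (ft G \<xi>))\<^sup>2 * damp (1 / (real n + 1)) \<xi>))"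
      by (intro lim_imp_Liminf[symmetric] tendsto_ennrealI) auto
  qed
  also have "\<dots> \<le> liminf (\<lambda>n. \<integral>\<^sup>+\<xi>. ennreal ((cmod (ft G \<xi>))\<^sup>2 * damp (1 / (real n + 1)) \<xi>) \<partial>lborel)"
    by (rule nn_integral_liminf) measurable
  also have "\<dots> \<le> ennreal (2 * pi * norm2 G)"
    by (intro Liminf_le always_eventually allI bound) (simp_all add: field_simps)
  finally have fin: "(\<integral>\<^sup>+\<xi>. ennreal ((cmod (ft G \<xi>))\<^sup>2) \<partial>lborel) \<le> ennreal (2 * pi * norm2 G)" .
  then show si: "square_integrable (ft G)"
    unfolding square_integrable_def
    by (intro conjI integrableI_bounded) (auto simp: le_less_trans[OF _ ennreal_less_top])
  show "norm2 (ft G) \<le> 2 * pi * norm2 G"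
    using fin si norm2_nonneg[of G]
    by (auto simp: norm2_def square_integrable_def nn_integral_eq_integral ennreal_le_iff)
qed

subsection \<open>The Fourier transform on square integrable functions\<close>

abbreviation trunc :: "real \<Rightarrow> (real \<Rightarrow> complex) \<Rightarrow> real \<Rightarrow> complex" where
  "trunc R f \<equiv> \<lambda>x. indicat_real {-R..R} x *\<^sub>R f x"

lemma square_integrable_trunc:
  assumes [measurable]: "square_integrable f"
  shows "square_integrable (trunc R f)"
proof (rule square_integrable_dominated[OF _ assms])
  show "trunc R f \<in> borel_measurable lborel" by measurable
qed (auto split: split_indicator)

lemma integrable_restrict_Icc:
  assumes "square_integrable f"
  shows "integrable lborel (\<lambda>x. indicat_real {a..b} x *\<^sub>R f x)"
proof -
  have "square_integrable (\<lambda>x. complex_of_real (indicat_real {a..b} x))"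
    by (rule square_integrable_bound[OF _ integrable_indicator_Icc[of a b]]) (auto split: split_indicator)
  from square_integrable_mult[OF this assms] show ?thesis
    by (simp add: scaleR_conv_of_real)
qed

lemma square_integrable_ft_trunc: "square_integrable f \<Longrightarrow> square_integrable (ft (trunc R f))"
  by (intro plancherel_le(1) integrable_restrict_Icc square_integrable_trunc)

lemma ft_trunc_eq:
  "(LINT x:{-R..R}|lborel. exp (- \<i> * complex_of_real (x * \<xi>)) * f x) = ft (trunc R f) \<xi>"
  unfolding ft_def set_lebesgue_integral_def
  by (intro Bochner_Integration.integral_cong refl) (simp add: cis_conv_exp)

lemma is_fourier_L2_iff:
  "is_fourier_L2 f F \<longleftrightarrow> square_integrable F \<and>
     ((\<lambda>R. norm2 (\<lambda>\<xi>. F \<xi> - ft (trunc R f) \<xi>)) \<longlongrightarrow> 0) at_top"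
  unfolding is_fourier_L2_def norm2_def ft_trunc_eq by (rule refl)

lemma norm2_zero_AE:
  assumes "square_integrable f" "norm2 f = 0"
  shows "AE x in lborel. f x = 0"
proof -
  have "AE x in lborel. (cmod (f x))\<^sup>2 = 0"
    using assms by (subst integral_nonneg_eq_0_iff_AE[symmetric]) (auto simp: square_integrable_def norm2_def)
  then show ?thesis by eventually_elim simp
qed

text \<open>Square integrability of \<open>f\<close> excludes that the integrals in \<open>is_fourier_L2\<close> vanish only because
  a Bochner integral that does not exist is 0.\<close>

lemma is_fourier_L2_unique:
  assumes f: "square_integrable f" and F: "is_fourier_L2 f F" and G: "is_fourier_L2 f G"
  shows "AE \<xi> in lborel. F \<xi> = G \<xi>"
proof -
  have FG: "square_integrable F" "square_integrable G"
    using F G by (auto simp: is_fourier_L2_iff)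
  let ?T = "\<lambda>R. ft (trunc R f)"
  have "((\<lambda>R. 2 * norm2 (\<lambda>\<xi>. F \<xi> - ?T R \<xi>) + 2 * norm2 (\<lambda>\<xi>. G \<xi> - ?T R \<xi>)) \<longlongrightarrow> 2 * 0 + 2 * 0) at_top"
    using F G by (intro tendsto_intros) (auto simp: is_fourier_L2_iff)
  moreover have "norm2 (\<lambda>\<xi>. F \<xi> - G \<xi>) \<le> 2 * norm2 (\<lambda>\<xi>. F \<xi> - ?T R \<xi>) + 2 * norm2 (\<lambda>\<xi>. G \<xi> - ?T R \<xi>)" for R
    using norm2_triangle[of F "?T R" G] FG square_integrable_ft_trunc[OF f, of R]
    by (auto simp: norm2_minus_commute[of "?T R" G] intro: square_integrable_diff)
  ultimately have "norm2 (\<lambda>\<xi>. F \<xi> - G \<xi>) \<le> 2 * 0 + 2 * 0"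
    by (intro tendsto_lowerbound[where F=at_top]) auto
  then have "norm2 (\<lambda>\<xi>. F \<xi> - G \<xi>) = 0" using norm2_nonneg[of "\<lambda>\<xi>. F \<xi> - G \<xi>"] by simp
  from norm2_zero_AE[OF square_integrable_diff[OF FG] this] show ?thesis by simp
qed

lemma ft_add:
  assumes "integrable lborel f" "integrable lborel g"
  shows "ft (\<lambda>x. f x + g x) \<xi> = ft f \<xi> + ft g \<xi>"
  unfolding ft_def
  by (subst Bochner_Integration.integral_add[symmetric])
     (auto intro!: integrable_cis_mult assms simp: distrib_left)

lemma ft_cmult: "ft (\<lambda>x. c * f x) \<xi> = c * ft f \<xi>"
  unfolding ft_def by (subst integral_mult_right_zero[symmetric]) (simp add: mult_ac)

lemma is_fourier_L2_add:
  assumes f: "square_integrable f" "is_fourier_L2 f F" and g: "square_integrable g" "is_fourier_L2 g G"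
  shows "is_fourier_L2 (\<lambda>x. f x + g x) (\<lambda>\<xi>. F \<xi> + G \<xi>)"
  unfolding is_fourier_L2_iff
proof
  have FG: "square_integrable F" "square_integrable G"
    using assms by (auto simp: is_fourier_L2_iff)
  then show "square_integrable (\<lambda>\<xi>. F \<xi> + G \<xi>)" by (rule square_integrable_add)
  have eq: "F \<xi> + G \<xi> - ft (trunc R (\<lambda>x. f x + g x)) \<xi>
     = (F \<xi> - ft (trunc R f) \<xi>) + (G \<xi> - ft (trunc R g) \<xi>)" for R \<xi>
    using ft_add[OF integrable_restrict_Icc[OF f(1)] integrable_restrict_Icc[OF g(1)], of "-R" R "-R" R \<xi>]
    by (simp add: scaleR_add_right)
  show "((\<lambda>R. norm2 (\<lambda>\<xi>. F \<xi> + G \<xi> - ft (trunc R (\<lambda>x. f x + g x)) \<xi>)) \<longlongrightarrow> 0) at_top"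
  proof (rule tendsto_sandwich[OF _ _ tendsto_const])
    have "((\<lambda>R. 2 * norm2 (\<lambda>\<xi>. F \<xi> - ft (trunc R f) \<xi>) + 2 * norm2 (\<lambda>\<xi>. G \<xi> - ft (trunc R g) \<xi>)) \<longlongrightarrow> 2 * 0 + 2 * 0) at_top"
      using f g by (intro tendsto_intros) (auto simp: is_fourier_L2_iff)
    then show "((\<lambda>R. 2 * norm2 (\<lambda>\<xi>. F \<xi> - ft (trunc R f) \<xi>) + 2 * norm2 (\<lambda>\<xi>. G \<xi> - ft (trunc R g) \<xi>)) \<longlongrightarrow> 0) at_top"
      by simp
    show "\<forall>\<^sub>F R in at_top. norm2 (\<lambda>\<xi>. F \<xi> + G \<xi> - ft (trunc R (\<lambda>x. f x + g x)) \<xi>)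
       \<le> 2 * norm2 (\<lambda>\<xi>. F \<xi> - ft (trunc R f) \<xi>) + 2 * norm2 (\<lambda>\<xi>. G \<xi> - ft (trunc R g) \<xi>)"
      unfolding eq
      by (intro always_eventually allI norm2_add_le square_integrable_diff FG square_integrable_ft_trunc f g)
  qed (simp add: norm2_nonneg)
qed

lemma is_fourier_L2_cmult:
  assumes f: "is_fourier_L2 f F"
  shows "is_fourier_L2 (\<lambda>x. c * f x) (\<lambda>\<xi>. c * F \<xi>)"
  unfolding is_fourier_L2_iff
proof
  show "square_integrable (\<lambda>\<xi>. c * F \<xi>)" using f by (auto simp: is_fourier_L2_iff intro: square_integrable_cmult)
  have eq: "c * F \<xi> - ft (trunc R (\<lambda>x. c * f x)) \<xi> = c * (F \<xi> - ft (trunc R f) \<xi>)" for R \<xi>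
    using ft_cmult[of c "trunc R f" \<xi>] by (simp add: algebra_simps)
  have "((\<lambda>R. (cmod c)\<^sup>2 * norm2 (\<lambda>\<xi>. F \<xi> - ft (trunc R f) \<xi>)) \<longlongrightarrow> (cmod c)\<^sup>2 * 0) at_top"
    using f by (intro tendsto_intros) (auto simp: is_fourier_L2_iff)
  then show "((\<lambda>R. norm2 (\<lambda>\<xi>. c * F \<xi> - ft (trunc R (\<lambda>x. c * f x)) \<xi>)) \<longlongrightarrow> 0) at_top"
    unfolding eq norm2_cmult by simp
qed

lemma square_integrable_zero: "square_integrable (\<lambda>x. 0)"
  by (simp add: square_integrable_def)

lemma is_fourier_L2_zero: "is_fourier_L2 (\<lambda>x. 0) (\<lambda>\<xi>. 0)"
  by (auto simp: is_fourier_L2_iff ft_def norm2_def square_integrable_zero)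

lemma square_integrable_sum:
  "(\<And>i. i \<in> I \<Longrightarrow> square_integrable (f i)) \<Longrightarrow> square_integrable (\<lambda>x. \<Sum>i\<in>I. f i x)"
  by (induction I rule: infinite_finite_induct) (auto intro: square_integrable_add square_integrable_zero)

lemma is_fourier_L2_sum:
  "(\<And>i. i \<in> I \<Longrightarrow> square_integrable (f i) \<and> is_fourier_L2 (f i) (F i)) \<Longrightarrow>
    is_fourier_L2 (\<lambda>x. \<Sum>i\<in>I. f i x) (\<lambda>\<xi>. \<Sum>i\<in>I. F i \<xi>)"
  by (induction I rule: infinite_finite_induct)
     (auto intro!: is_fourier_L2_add is_fourier_L2_zero square_integrable_sum)

text \<open>The truncated transforms are bounded on square integrable functions uniformly in
  \<open>R\<close> by \<open>plancherel_le\<close>, so the defect for \<open>f\<close> and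
  \<open>F\<close> is controlled by that for a nearby pair. This provides the transform of an
  infinite sum.\<close>

lemma is_fourier_L2_limit:
  assumes f: "square_integrable f" and F: "square_integrable F"
    and approx: "\<And>e. e > 0 \<Longrightarrow> \<exists>g G. square_integrable g \<and> is_fourier_L2 g G \<and>
      norm2 (\<lambda>x. f x - g x) < e \<and> norm2 (\<lambda>\<xi>. F \<xi> - G \<xi>) < e"
  shows "is_fourier_L2 f F"
  unfolding is_fourier_L2_iff
proof (intro conjI F tendstoI)
  fix e :: real assume e: "e > 0"
  \<comment> \<open>With 8 in place of \<open>2 * pi\<close>, two triangle inequalities leave less
    than \<open>2 * d + 4 * d + 32 * d\<close>.\<close>
  define d where "d = e / 40"
  have d: "d > 0" using e by (simp add: d_def)
  from approx[OF d] obtain g G where g: "square_integrable g" "is_fourier_L2 g G"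
    and le: "norm2 (\<lambda>x. f x - g x) < d" "norm2 (\<lambda>\<xi>. F \<xi> - G \<xi>) < d" by blast
  have G: "square_integrable G" using g by (auto simp: is_fourier_L2_iff)
  have "\<forall>\<^sub>F R in at_top. dist (norm2 (\<lambda>\<xi>. G \<xi> - ft (trunc R g) \<xi>)) 0 < d"
    using g(2) d unfolding is_fourier_L2_iff by (auto dest: tendstoD)
  then show "\<forall>\<^sub>F R in at_top. dist (norm2 (\<lambda>\<xi>. F \<xi> - ft (trunc R f) \<xi>)) 0 < e"
  proof eventually_elim
    case (elim R)
    let ?f = "ft (trunc R f)" and ?g = "ft (trunc R g)"
    have fg: "square_integrable ?f" "square_integrable ?g"
      by (intro square_integrable_ft_trunc f g)+
    have "?g \<xi> - ?f \<xi> = (-1) * ft (trunc R (\<lambda>x. f x - g x)) \<xi>" for \<xi>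
      using ft_add[OF integrable_restrict_Icc[OF f] integrable_restrict_Icc[OF square_integrable_cmult[OF g(1)]], of "-R" R "-R" R "-1" \<xi>]
       ft_cmult[of "-1" "trunc R g" \<xi>] by (simp add: scaleR_diff_right)
    then have "norm2 (\<lambda>\<xi>. ?g \<xi> - ?f \<xi>) = norm2 (ft (trunc R (\<lambda>x. f x - g x)))"
      by (simp only: norm2_cmult) simp
    also have "\<dots> \<le> 2 * pi * norm2 (trunc R (\<lambda>x. f x - g x))"
      by (intro plancherel_le integrable_restrict_Icc square_integrable_trunc square_integrable_diff f g)
    also have "\<dots> \<le> 2 * 4 * norm2 (\<lambda>x. f x - g x)"
      using pi_less_4 by (intro mult_mono norm2_mono square_integrable_diff f g norm2_nonneg) (auto split: split_indicator)
    finally have 1: "norm2 (\<lambda>\<xi>. ?g \<xi> - ?f \<xi>) < 8 * d" using le by simp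
    have 2: "norm2 (\<lambda>\<xi>. F \<xi> - ?f \<xi>) \<le> 2 * norm2 (\<lambda>\<xi>. F \<xi> - G \<xi>) + 2 * norm2 (\<lambda>\<xi>. G \<xi> - ?f \<xi>)"
      by (intro norm2_triangle square_integrable_diff F G fg)
    have 3: "norm2 (\<lambda>\<xi>. G \<xi> - ?f \<xi>) \<le> 2 * norm2 (\<lambda>\<xi>. G \<xi> - ?g \<xi>) + 2 * norm2 (\<lambda>\<xi>. ?g \<xi> - ?f \<xi>)"
      by (intro norm2_triangle square_integrable_diff F G fg)
    have "norm2 (\<lambda>\<xi>. F \<xi> - ?f \<xi>) < e" using 1 2 3 le elim d unfolding d_def by simp
    then show ?case by (simp add: norm2_nonneg)
  qed
qed

text \<open>The definition provides some transform with finite weighted norm, while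
  \<open>P_op\<close> uses the one picked by the choice operator; by uniqueness both agree almost
  everywhere.\<close>

lemma in_sobolev_fourier_hat:
  assumes "in_sobolev s f"
  shows "is_fourier_L2 f (fourier_hat f)"
    and "integrable lborel (\<lambda>\<xi>. (1 + \<xi>\<^sup>2) powr s * (cmod (fourier_hat f \<xi>))\<^sup>2)"
proof -
  from assms obtain F where f: "square_integrable f" and F: "is_fourier_L2 f F"
    and int: "integrable lborel (wsq s F)"
    by (auto simp: in_sobolev_def)
  show hat: "is_fourier_L2 f (fourier_hat f)"
    unfolding fourier_hat_def using F by (rule someI[of "is_fourier_L2 f"])
  have [measurable]: "F \<in> borel_measurable lborel" "fourier_hat f \<in> borel_measurable lborel"
    using F hat by (auto simp: is_fourier_L2_def square_integrable_def)
  show "integrable lborel (\<lambda>\<xi>. (1 + \<xi>\<^sup>2) powr s * (cmod (fourier_hat f \<xi>))\<^sup>2)"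
    by (subst integrable_cong_AE[where g="\<lambda>\<xi>. wsq s F \<xi>"])
       (use is_fourier_L2_unique[OF f F hat] int in auto)
qed

subsection \<open>The Poisson extension\<close>

text \<open>Normalised to be \<open>2 * pi\<close> times the Poisson extension of the function with Fourier transform \<open>H\<close>.\<close>

definition pext :: "(real \<Rightarrow> complex) \<Rightarrow> real \<Rightarrow> real \<Rightarrow> complex" where
  "pext H y h = (LINT \<xi>|lborel. cis (y * \<xi>) * of_real (damp h \<xi>) * H \<xi>)"

lemma square_integrable_exp:
  assumes "h > 0"
  shows "square_integrable (\<lambda>\<xi>. cis (y * \<xi>) * of_real (damp h \<xi>))"
proof (rule square_integrable_bound)
  show "integrable lborel (\<lambda>\<xi>. damp (2 * h) \<xi>)"
    using assms by (intro exp_neg_abs_integrable) auto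
qed (auto simp: norm_mult exp_double[symmetric] algebra_simps)

lemma square_integrable_poisson:
  assumes "h > 0"
  shows "square_integrable (\<lambda>z. of_real (pker h (x - z)))"
proof (rule square_integrable_bound)
  let ?K = "\<lambda>z. pker h (x - z)"
  show "integrable lborel (\<lambda>z. 2 / h * ?K z)"
    using has_bochner_integral_poisson[OF assms, of x]
    by (intro integrable_mult_right) (simp add: has_bochner_integral_iff)
  fix z
  have K0: "0 \<le> ?K z" using assms by simp
  have "?K z \<le> 2 * h / h\<^sup>2" using assms by (intro divide_left_mono) (auto simp: add_pos_nonneg)
  also have "\<dots> = 2 / h" using assms by (simp add: power2_eq_square)
  finally have "?K z * ?K z \<le> 2 / h * ?K z" using K0 by (rule mult_right_mono)
  then show "(cmod (of_real (?K z)))\<^sup>2 \<le> 2 / h * ?K z" by (simp only: norm_of_real power2_abs) (simp only: power2_eq_square)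
qed measurable

lemma pext_ft:
  assumes G: "integrable lborel G" and h: "h > 0"
  shows "pext (ft G) x h = (LINT z|lborel. G z * of_real (pker h (x - z)))"
proof -
  note [measurable] = borel_measurable_integrable[OF G]
  let ?w = "\<lambda>\<xi>. complex_of_real (damp h \<xi>)"
  have "pext (ft G) x h = (LINT \<xi>|lborel. LINT z|lborel. G z * (cis ((x - z) * \<xi>) * ?w \<xi>))"
    unfolding pext_def ft_def
  proof (intro Bochner_Integration.integral_cong refl)
    fix \<xi>
    have "cis ((x - z) * \<xi>) = cis (x * \<xi>) * cis (- (z * \<xi>))" for z
      by (simp add: cis_mult algebra_simps)
    then have "(LINT z|lborel. G z * (cis ((x - z) * \<xi>) * ?w \<xi>)) =
        (LINT z|lborel. cis (x * \<xi>) * ?w \<xi> * (cis (- (z * \<xi>)) * G z))"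
      by (intro Bochner_Integration.integral_cong refl) simp
    then show "cis (x * \<xi>) * ?w \<xi> * (LINT z|lborel. cis (- (z * \<xi>)) * G z)
       = (LINT z|lborel. G z * (cis ((x - z) * \<xi>) * ?w \<xi>))"
      by simp
  qed
  also have "\<dots> = (LINT z|lborel. LINT \<xi>|lborel. G z * (cis ((x - z) * \<xi>) * ?w \<xi>))"
    by (rule lborel_pair.Fubini_integral[symmetric],
        rule lborel_pair.integrable_product_bound[where f="\<lambda>\<xi>. damp h \<xi>" and g="\<lambda>x. cmod (G x)"])
       (auto simp: norm_mult G mult_ac exp_neg_abs_integrable[OF h])
  also have "\<dots> = (LINT z|lborel. G z * of_real (pker h (x - z)))"
    using has_bochner_integral_poisson_fourier[OF h] by (simp add: has_bochner_integral_iff)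
  finally show ?thesis .
qed

lemma pext_diff_bound:
  assumes "square_integrable F" "square_integrable G" "h > 0"
  shows "(cmod (pext F x h - pext G x h))\<^sup>2 \<le> norm2 (\<lambda>\<xi>. cis (x * \<xi>) * of_real (damp h \<xi>)) * norm2 (\<lambda>\<xi>. F \<xi> - G \<xi>)"
proof -
  have "pext F x h - pext G x h = (LINT \<xi>|lborel. (cis (x * \<xi>) * of_real (damp h \<xi>)) * (F \<xi> - G \<xi>))"
    unfolding pext_def
    by (subst Bochner_Integration.integral_diff[symmetric])
       (auto intro!: square_integrable_mult square_integrable_exp assms simp: right_diff_distrib)
  then show ?thesis
    by (simp only:) (intro cauchy_schwarz_L2 square_integrable_exp square_integrable_diff assms)
qed

lemma tendsto_pext_L2:
  assumes F: "square_integrable F" and G: "\<And>n. square_integrable (G n)" and h: "h > 0"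
    and lim: "(\<lambda>n. norm2 (\<lambda>\<xi>. F \<xi> - G n \<xi>)) \<longlonglongrightarrow> 0"
  shows "(\<lambda>n. pext (G n) x h) \<longlonglongrightarrow> pext F x h"
proof -
  let ?A = "norm2 (\<lambda>\<xi>. cis (x * \<xi>) * of_real (damp h \<xi>))"
  have lim0: "(\<lambda>n. ?A * norm2 (\<lambda>\<xi>. F \<xi> - G n \<xi>)) \<longlonglongrightarrow> 0"
    using tendsto_mult_left[OF lim, of ?A] by simp
  have "(\<lambda>n. (cmod (pext F x h - pext (G n) x h))\<^sup>2) \<longlonglongrightarrow> 0"
  proof (rule tendsto_sandwich[OF _ _ tendsto_const lim0])
    show "\<forall>\<^sub>F n in sequentially. (cmod (pext F x h - pext (G n) x h))\<^sup>2 \<le> ?A * norm2 (\<lambda>\<xi>. F \<xi> - G n \<xi>)"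
      by (intro always_eventually allI pext_diff_bound F G h)
  qed simp
  from tendsto_real_sqrt[OF this]
  have "(\<lambda>n. cmod (pext (G n) x h - pext F x h)) \<longlonglongrightarrow> 0"
    by (simp add: norm_minus_commute)
  then show ?thesis by (simp add: tendsto_norm_zero_iff LIM_zero_iff)
qed

text \<open>Fubini's theorem gives the formula for the truncations, which are integrable. Then both
  sides pass to the limit, the left by Cauchy-Schwarz in frequency and the right by dominated
  convergence. This ties the extension, defined through \<open>F\<close>, to the values of
  \<open>f\<close>.\<close>

lemma pext_eq_poisson:
  assumes f: "square_integrable f" and F: "is_fourier_L2 f F" and h: "h > 0"
  shows "pext F x h = (LINT z|lborel. f z * of_real (pker h (x - z)))"
proof (rule LIMSEQ_unique)
  let ?T = "\<lambda>n::nat. ft (trunc (real n) f)"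
  have sF: "square_integrable F" using F by (auto simp: is_fourier_L2_iff)
  have "(\<lambda>n. norm2 (\<lambda>\<xi>. F \<xi> - ?T n \<xi>)) \<longlonglongrightarrow> 0"
    using F by (auto simp: is_fourier_L2_iff intro: filterlim_compose[OF _ filterlim_real_sequentially])
  then show "(\<lambda>n. pext (?T n) x h) \<longlonglongrightarrow> pext F x h"
    by (intro tendsto_pext_L2 sF h square_integrable_ft_trunc f)
  have [measurable]: "f \<in> borel_measurable lborel" using f by measurable
  let ?K = "\<lambda>z. complex_of_real (pker h (x - z))"
  have "(\<lambda>n. LINT z|lborel. trunc (real n) f z * ?K z) \<longlonglongrightarrow> (LINT z|lborel. f z * ?K z)"
  proof (rule integral_dominated_convergence[where w="\<lambda>z. cmod (f z * ?K z)"])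
    show "integrable lborel (\<lambda>z. cmod (f z * ?K z))"
      by (intro integrable_norm square_integrable_mult f square_integrable_poisson h)
    show "AE z in lborel. (\<lambda>n. trunc (real n) f z * ?K z) \<longlonglongrightarrow> f z * ?K z"
    proof (rule AE_I2)
      fix z :: real
      have "\<forall>\<^sub>F n in sequentially. trunc (real n) f z * ?K z = f z * ?K z"
        using eventually_ge_at_top[of "nat \<lceil>\<bar>z\<bar>\<rceil>"]
      proof eventually_elim
        case (elim n)
        then have "z \<in> {- real n..real n}" by (auto simp: abs_le_iff)
        then show ?case by simp
      qed
      then show "(\<lambda>n. trunc (real n) f z * ?K z) \<longlonglongrightarrow> f z * ?K z" by (rule tendsto_eventually)
    qed
  qed (auto split: split_indicator)
  then show "(\<lambda>n. pext (?T n) x h) \<longlonglongrightarrow> (LINT z|lborel. f z * ?K z)"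
    by (simp add: pext_ft[OF integrable_restrict_Icc[OF f] h])
qed

subsection \<open>Tangential limits\<close>

text \<open>Square integrability is lost under multiplication by the frequency. This larger class is
  stable under it, so that derivatives of an extension are again extensions.\<close>

definition exp_integrable :: "(real \<Rightarrow> complex) \<Rightarrow> bool" where
  "exp_integrable G \<longleftrightarrow> G \<in> borel_measurable lborel \<and>
     (\<forall>h>0. integrable lborel (\<lambda>\<xi>. damp h \<xi> * cmod (G \<xi>)))"

lemma exp_integrable_measurable [measurable_dest]:
  "exp_integrable G \<Longrightarrow> G \<in> borel_measurable lborel"
  by (simp add: exp_integrable_def)

lemma exp_integrable_pext:
  assumes "exp_integrable G" "h > 0"
  shows "integrable lborel (\<lambda>\<xi>. cis (y * \<xi>) * of_real (damp h \<xi>) * G \<xi>)"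
proof (rule Bochner_Integration.integrable_bound)
  show "integrable lborel (\<lambda>\<xi>. damp h \<xi> * cmod (G \<xi>))"
    using assms by (simp add: exp_integrable_def)
  show "(\<lambda>\<xi>. cis (y * \<xi>) * of_real (damp h \<xi>) * G \<xi>) \<in> borel_measurable lborel"
    using assms(1) by measurable
qed (auto simp: norm_mult)

lemma square_integrable_exp_integrable:
  assumes G: "square_integrable G"
  shows "exp_integrable G"
  unfolding exp_integrable_def
proof (intro conjI allI impI)
  fix h :: real assume "h > 0"
  from square_integrable_mult[OF square_integrable_exp[OF this, of 0] G]
  show "integrable lborel (\<lambda>\<xi>. damp h \<xi> * cmod (G \<xi>))"
    by (auto dest: integrable_norm simp: norm_mult)
qed (use G in measurable)

text \<open>Half of the damping pays for the factor \<open>\<bar>\<xi>\<bar>\<close>.\<close>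

lemma exp_integrable_mult:
  assumes G: "exp_integrable G" and [measurable]: "m \<in> borel_measurable lborel"
    and m: "\<And>\<xi>. cmod (m \<xi>) \<le> \<bar>\<xi>\<bar>"
  shows "exp_integrable (\<lambda>\<xi>. m \<xi> * G \<xi>)"
  unfolding exp_integrable_def
proof (intro conjI allI impI)
  note [measurable] = exp_integrable_measurable[OF G]
  show "(\<lambda>\<xi>. m \<xi> * G \<xi>) \<in> borel_measurable lborel" by measurable
  fix h :: real assume h: "h > 0"
  show "integrable lborel (\<lambda>\<xi>. damp h \<xi> * cmod (m \<xi> * G \<xi>))"
  proof (rule Bochner_Integration.integrable_bound)
    show "integrable lborel (\<lambda>\<xi>. (2/h) * (damp (h/2) \<xi> * cmod (G \<xi>)))"
      using G[unfolded exp_integrable_def, THEN conjunct2, rule_format, of "h/2"] h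
      by (intro integrable_mult_right) simp
    show "(\<lambda>\<xi>. damp h \<xi> * cmod (m \<xi> * G \<xi>)) \<in> borel_measurable lborel" by measurable
    show "AE \<xi> in lborel. norm (damp h \<xi> * cmod (m \<xi> * G \<xi>)) \<le>
       norm ((2/h) * (damp (h/2) \<xi> * cmod (G \<xi>)))"
    proof (rule AE_I2)
      fix \<xi> :: real
      have "h/2 * \<bar>\<xi>\<bar> \<le> exp (h/2 * \<bar>\<xi>\<bar>)" using exp_ge_add_one_self[of "h/2 * \<bar>\<xi>\<bar>"] by linarith
      then have "\<bar>\<xi>\<bar> \<le> 2/h * exp (h/2 * \<bar>\<xi>\<bar>)" using h by (simp add: field_simps)
      with m[of \<xi>] have "cmod (m \<xi>) \<le> 2/h * exp (h/2 * \<bar>\<xi>\<bar>)" by linarith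
      from mult_right_mono[OF this, of "damp h \<xi>"]
      have "cmod (m \<xi>) * damp h \<xi> \<le> 2/h * (exp (h/2 * \<bar>\<xi>\<bar>) * damp h \<xi>)" by simp
      also have "exp (h/2 * \<bar>\<xi>\<bar>) * damp h \<xi> = damp (h/2) \<xi>"
        by (subst exp_add[symmetric]) (simp add: field_simps)
      finally have "cmod (m \<xi>) * damp h \<xi> * cmod (G \<xi>) \<le> 2/h * damp (h/2) \<xi> * cmod (G \<xi>)"
        by (rule mult_right_mono) simp
      then show "norm (damp h \<xi> * cmod (m \<xi> * G \<xi>)) \<le> norm ((2/h) * (damp (h/2) \<xi> * cmod (G \<xi>)))"
        using h by (simp add: norm_mult mult_ac)
    qed
  qed
qed

section \<open>Increments of the extension and a local Sobolev inequality\<close>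

lemma borel_measurable_pext [measurable (raw)]:
  assumes [measurable]: "f \<in> borel_measurable M" "g \<in> borel_measurable M" "G \<in> borel_measurable lborel"
  shows "(\<lambda>x. pext G (f x) (g x)) \<in> borel_measurable M"
  unfolding pext_def by measurable

text \<open>Differentiation under the integral sign in integrated form: the pointwise fundamental
  theorem followed by Fubini's theorem replaces a proof that the integral is differentiable.\<close>

lemma integral_parameter_FTC:
  fixes k k' :: "real \<Rightarrow> real \<Rightarrow> complex" and a b :: real
  assumes ab: "a \<le> b"
    and k: "\<And>t x. t \<in> {a..b} \<Longrightarrow> ((\<lambda>t. k t x) has_vector_derivative k' t x) (at t within {a..b})"
    and cont: "\<And>x. continuous_on {a..b} (\<lambda>t. k' t x)"
    and [measurable]: "case_prod k' \<in> borel_measurable (lborel \<Otimes>\<^sub>M lborel)"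
    and g: "integrable lborel g"
    and le: "\<And>t x. t \<in> {a..b} \<Longrightarrow> cmod (k' t x) \<le> g x"
    and ka: "integrable lborel (k a)" and kb: "integrable lborel (k b)"
  defines "K' \<equiv> \<lambda>t. LINT x|lborel. k' t x"
  shows "integrable lborel (\<lambda>t. indicat_real {a..b} t *\<^sub>R K' t)"
    and "cmod ((LINT x|lborel. k b x) - (LINT x|lborel. k a x)) \<le> (LINT t|lborel. indicat_real {a..b} t * cmod (K' t))"
proof -
  let ?f = "\<lambda>t x. indicat_real {a..b} t *\<^sub>R k' t x"
  have g0: "0 \<le> g x" for x using le[of a x] ab norm_ge_zero[of "k' a x"] by (simp del: norm_ge_zero)
  have int: "integrable (lborel \<Otimes>\<^sub>M lborel) (case_prod ?f)"
  proof (rule lborel_pair.integrable_product_bound[OF _ _ g])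
    show "integrable lborel (indicat_real {a..b})"
      by (rule integrable_indicator_Icc)
    show "case_prod ?f \<in> borel_measurable (lborel \<Otimes>\<^sub>M lborel)" by measurable
  qed (auto split: split_indicator intro: le g0)
  have eq: "(LINT x|lborel. ?f t x) = indicat_real {a..b} t *\<^sub>R K' t" for t
    by (simp add: K'_def)
  show int': "integrable lborel (\<lambda>t. indicat_real {a..b} t *\<^sub>R K' t)"
    using lborel_pair.integrable_fst[OF int] unfolding eq .
  have "(LINT x|lborel. k b x) - (LINT x|lborel. k a x) = (LINT x|lborel. k b x - k a x)"
    by (simp add: ka kb)
  also have "\<dots> = (LINT x|lborel. LINT t|lborel. ?f t x)"
    by (intro Bochner_Integration.integral_cong refl integral_FTC_atLeastAtMost[symmetric] ab cont k) auto
  also have "\<dots> = (LINT t|lborel. LINT x|lborel. ?f t x)"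
    by (rule lborel_pair.Fubini_integral[OF int])
  also have "\<dots> = (LINT t|lborel. indicat_real {a..b} t *\<^sub>R K' t)" by (simp only: eq)
  finally have "cmod ((LINT x|lborel. k b x) - (LINT x|lborel. k a x)) \<le> (LINT t|lborel. cmod (indicat_real {a..b} t *\<^sub>R K' t))"
    by (simp only: integral_norm_bound)
  then show "cmod ((LINT x|lborel. k b x) - (LINT x|lborel. k a x)) \<le> (LINT t|lborel. indicat_real {a..b} t * cmod (K' t))"
    by simp
qed

lemma cis_has_vector_derivative:
  "((\<lambda>t. cis (t * x)) has_vector_derivative \<i> * of_real x * cis (t * x)) (at t within S)"
proof -
  have eq: "cis (t * x) = exp (of_real t * (\<i> * of_real x))" for t
    by (simp add: cis_conv_exp mult_ac)
  have "((\<lambda>z. exp (z * (\<i> * of_real x))) has_field_derivative \<i> * of_real x * cis (t * x)) (at (of_real t))"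
    unfolding eq by (auto intro!: derivative_eq_intros)
  from field_vector_diff_chain_at[OF has_vector_derivative_of_real[OF DERIV_ident] this]
  have "((\<lambda>t. cis (t * x)) has_vector_derivative \<i> * of_real x * cis (t * x)) (at t)"
    by (simp add: o_def eq[symmetric])
  then show ?thesis by (rule has_vector_derivative_at_within)
qed

text \<open>The derivative in the height multiplies the transform by
  \<open>- \<bar>\<xi>\<bar>\<close>; the sign disappears in the norm. On the segment the damping at
  the lowest height \<open>h\<close> dominates.\<close>

lemma pext_vertical:
  assumes G: "exp_integrable G" and h: "0 < h" "h \<le> h0"
  shows "integrable lborel (\<lambda>t. indicat_real {h..h0} t *\<^sub>R pext (\<lambda>\<xi>. of_real \<bar>\<xi>\<bar> * G \<xi>) y t)"
    and "cmod (pext G y h - pext G y h0) \<le> (LINT t|lborel. indicat_real {h..h0} t * cmod (pext (\<lambda>\<xi>. of_real \<bar>\<xi>\<bar> * G \<xi>) y t))"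
proof -
  note [measurable] = exp_integrable_measurable[OF G]
  let ?G = "\<lambda>\<xi>. of_real \<bar>\<xi>\<bar> * G \<xi>"
  have G1: "exp_integrable ?G" by (rule exp_integrable_mult[OF G]) auto
  define k where "k = (\<lambda>t \<xi>. cis (y * \<xi>) * of_real (damp t \<xi>) * G \<xi>)"
  define k' where "k' = (\<lambda>t \<xi>. - (cis (y * \<xi>) * of_real (damp t \<xi>) * ?G \<xi>))"
  have 1: "((\<lambda>t. k t \<xi>) has_vector_derivative k' t \<xi>) (at t within {h..h0})" for t \<xi>
    unfolding k_def k'_def
    by (rule derivative_eq_intros has_vector_derivative_of_real has_vector_derivative_mult_right has_vector_derivative_mult_left refl)+
       (auto simp: algebra_simps)
  have 2: "continuous_on {h..h0} (\<lambda>t. k' t \<xi>)" for \<xi>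
    unfolding k'_def by (intro continuous_intros)
  have 3: "case_prod k' \<in> borel_measurable (lborel \<Otimes>\<^sub>M lborel)"
    unfolding k'_def by measurable
  have 4: "integrable lborel (\<lambda>\<xi>. damp h \<xi> * cmod (?G \<xi>))"
    using G1 h by (auto simp: exp_integrable_def)
  have 5: "cmod (k' t \<xi>) \<le> damp h \<xi> * cmod (?G \<xi>)" if "t \<in> {h..h0}" for t \<xi>
  proof -
    have "damp t \<xi> \<le> damp h \<xi>" using that by (auto intro: mult_right_mono)
    from mult_right_mono[OF this, of "cmod (?G \<xi>)"] show ?thesis by (simp add: k'_def norm_mult)
  qed
  have 6: "integrable lborel (k t)" if "t > 0" for t
    unfolding k_def by (rule exp_integrable_pext[OF G that])
  have K': "(LINT \<xi>|lborel. k' t \<xi>) = - pext ?G y t" for t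
    by (simp add: k'_def pext_def)
  have K: "(LINT \<xi>|lborel. k t \<xi>) = pext G y t" for t
    by (simp add: k_def pext_def)
  note FTC = integral_parameter_FTC[OF h(2) 1 2 3 4 5 6 6, unfolded K K']
  show "integrable lborel (\<lambda>t. indicat_real {h..h0} t *\<^sub>R pext ?G y t)"
    using FTC(1) h by simp
  show "cmod (pext G y h - pext G y h0) \<le> (LINT t|lborel. indicat_real {h..h0} t * cmod (pext ?G y t))"
    using FTC(2) h by (simp add: norm_minus_commute)
qed

lemma pext_horizontal:
  assumes G: "exp_integrable G" and h: "0 < h" and ab: "a \<le> b"
  shows "integrable lborel (\<lambda>t. indicat_real {a..b} t *\<^sub>R pext (\<lambda>\<xi>. \<i> * of_real \<xi> * G \<xi>) t h)"
    and "cmod (pext G b h - pext G a h) \<le> (LINT t|lborel. indicat_real {a..b} t * cmod (pext (\<lambda>\<xi>. \<i> * of_real \<xi> * G \<xi>) t h))"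
proof -
  note [measurable] = exp_integrable_measurable[OF G]
  let ?G = "\<lambda>\<xi>. \<i> * of_real \<xi> * G \<xi>"
  have G1: "exp_integrable ?G" by (rule exp_integrable_mult[OF G]) (auto simp: norm_mult)
  define k where "k = (\<lambda>t \<xi>. cis (t * \<xi>) * of_real (damp h \<xi>) * G \<xi>)"
  define k' where "k' = (\<lambda>t \<xi>. cis (t * \<xi>) * of_real (damp h \<xi>) * ?G \<xi>)"
  have 1: "((\<lambda>t. k t \<xi>) has_vector_derivative k' t \<xi>) (at t within {a..b})" for t \<xi>
    using has_vector_derivative_mult_left[OF has_vector_derivative_mult_left[OF cis_has_vector_derivative]]
    unfolding k_def k'_def by (rule has_vector_derivative_eq_rhs) (simp add: mult_ac)
  have 2: "continuous_on {a..b} (\<lambda>t. k' t \<xi>)" for \<xi>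
    unfolding k'_def by (intro continuous_intros)
  have 3: "case_prod k' \<in> borel_measurable (lborel \<Otimes>\<^sub>M lborel)"
    unfolding k'_def by measurable
  have 4: "integrable lborel (\<lambda>\<xi>. damp h \<xi> * cmod (?G \<xi>))"
    using G1 h by (auto simp: exp_integrable_def)
  have 5: "cmod (k' t \<xi>) \<le> damp h \<xi> * cmod (?G \<xi>)" for t \<xi>
    by (simp add: k'_def norm_mult)
  have 6: "integrable lborel (k t)" for t
    unfolding k_def by (rule exp_integrable_pext[OF G h])
  note FTC = integral_parameter_FTC[OF ab 1 2 3 4 5 6 6]
  show "integrable lborel (\<lambda>t. indicat_real {a..b} t *\<^sub>R pext ?G t h)"
    using FTC(1) by (simp add: k'_def pext_def)
  show "cmod (pext G b h - pext G a h) \<le> (LINT t|lborel. indicat_real {a..b} t * cmod (pext ?G t h))"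
    using FTC(2) by (simp add: k'_def k_def pext_def)
qed

lemma pext_bound:
  assumes "exp_integrable G" "h > 0"
  shows "cmod (pext G y h) \<le> (LINT \<xi>|lborel. damp h \<xi> * cmod (G \<xi>))"
  unfolding pext_def by (rule order_trans[OF integral_norm_bound]) (simp add: norm_mult)

lemma pext_indicator_square_integrable:
  assumes G: "exp_integrable G" and h: "h > 0"
  shows "square_integrable (\<lambda>t. of_real (indicat_real {a..b} t) * pext G t h)"
proof (rule square_integrable_bound)
  note [measurable] = exp_integrable_measurable[OF G]
  let ?C = "LINT \<xi>|lborel. damp h \<xi> * cmod (G \<xi>)"
  show "(\<lambda>t. of_real (indicat_real {a..b} t) * pext G t h) \<in> borel_measurable lborel" by measurable
  show "integrable lborel (\<lambda>t. ?C\<^sup>2 * indicat_real {a..b} t)"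
    by (intro integrable_mult_right) (rule integrable_indicator_Icc)
  show "(cmod (of_real (indicat_real {a..b} t) * pext G t h))\<^sup>2 \<le> ?C\<^sup>2 * indicat_real {a..b} t" for t
    using power_mono[OF pext_bound[OF G h, of t], of 2] by (auto split: split_indicator)
qed

text \<open>The value at \<open>y\<close> differs from that at \<open>t\<close> by an integral of
  the horizontal derivative, which Cauchy-Schwarz estimates over the interval; averaging over
  \<open>t\<close> gives the bound. The length of the interval is the height because at height
  \<open>h\<close> a derivative costs a factor of order \<open>1 / h\<close>, which balances the two
  terms.\<close>

lemma pext_sobolev:
  assumes G: "exp_integrable G" and h: "h > 0"
  defines "V \<equiv> \<lambda>t. cmod (pext G t h)" and "V1 \<equiv> \<lambda>t. cmod (pext (\<lambda>\<xi>. \<i> * of_real \<xi> * G \<xi>) t h)"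
  shows "integrable lborel (\<lambda>t. indicat_real {y..y+h} t * (2 / h * (V t)\<^sup>2 + 2 * h * (V1 t)\<^sup>2))"
    and "(V y)\<^sup>2 \<le> (LINT t|lborel. indicat_real {y..y+h} t * (2 / h * (V t)\<^sup>2 + 2 * h * (V1 t)\<^sup>2))"
proof -
  let ?I = "indicat_real {y..y+h}"
  let ?G = "\<lambda>\<xi>. \<i> * of_real \<xi> * G \<xi>"
  have G1: "exp_integrable ?G" using exp_integrable_measurable[OF G]
    by (intro exp_integrable_mult[OF G]) (auto simp: norm_mult)
  have sq: "integrable lborel (\<lambda>t. ?I t * (cmod (pext F t h))\<^sup>2)" if "exp_integrable F" for F
    using pext_indicator_square_integrable[OF that h, of y "y+h"]
    by (simp add: square_integrable_def norm_mult power_mult_distrib)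
       (simp add: power2_eq_square indicator_inter_arith[symmetric])
  have I: "integrable lborel ?I" "(LINT t|lborel. ?I t) = h"
    using h by (auto intro: integrable_indicator_Icc)
  define B where "B = (LINT t|lborel. ?I t * (V1 t)\<^sup>2)"
  have iV: "integrable lborel (\<lambda>t. ?I t * (V t)\<^sup>2)" "integrable lborel (\<lambda>t. ?I t * (V1 t)\<^sup>2)"
    unfolding V_def V1_def by (intro sq G G1)+
  have eq: "?I t * (2 / h * (V t)\<^sup>2 + 2 * h * (V1 t)\<^sup>2) = 2 / h * (?I t * (V t)\<^sup>2) + 2 * h * (?I t * (V1 t)\<^sup>2)" for t
    by (simp add: algebra_simps)
  show "integrable lborel (\<lambda>t. ?I t * (2 / h * (V t)\<^sup>2 + 2 * h * (V1 t)\<^sup>2))"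
    unfolding eq using iV by auto
  have point: "(V y)\<^sup>2 \<le> 2 * (V t)\<^sup>2 + 2 * h * B" if t: "t \<in> {y..y+h}" for t
  proof -
    define J where "J = (LINT u|lborel. ?I u * V1 u)"
    \<comment> \<open>Cauchy-Schwarz against the indicator itself, which produces the factor
      \<open>h\<close>.\<close>
    have "complex_of_real J = (LINT u|lborel. of_real (?I u) * of_real (?I u * V1 u))"
      unfolding J_def by (subst integral_complex_of_real[symmetric], intro Bochner_Integration.integral_cong)
        (auto split: split_indicator)
    then have "J\<^sup>2 = (cmod (LINT u|lborel. of_real (?I u) * of_real (?I u * V1 u)))\<^sup>2"
      by (metis norm_of_real power2_abs)
    also have "\<dots> \<le> norm2 (\<lambda>u. of_real (?I u)) * norm2 (\<lambda>u. of_real (?I u * V1 u))"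
    proof (rule cauchy_schwarz_L2)
      show "square_integrable (\<lambda>u. of_real (?I u))"
        by (rule square_integrable_bound[OF _ I(1)]) (auto split: split_indicator)
      show "square_integrable (\<lambda>u. of_real (?I u * V1 u))"
      proof (rule square_integrable_dominated[OF _ pext_indicator_square_integrable[OF G1 h, of y "y+h"]])
        note [measurable] = exp_integrable_measurable[OF G1]
        show "(\<lambda>u. complex_of_real (?I u * V1 u)) \<in> borel_measurable lborel" unfolding V1_def by measurable
      qed (auto simp: V1_def norm_mult)
    qed
    also have "norm2 (\<lambda>u. of_real (?I u)) = (LINT u|lborel. ?I u)"
      unfolding norm2_def by (intro Bochner_Integration.integral_cong) (auto split: split_indicator)
    also have "norm2 (\<lambda>u. of_real (?I u * V1 u)) = B"
      unfolding norm2_def B_def by (intro Bochner_Integration.integral_cong) (auto split: split_indicator)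
    finally have J2: "J\<^sup>2 \<le> h * B" using I by simp
    have "cmod (pext G t h - pext G y h) \<le> (LINT u|lborel. indicat_real {y..t} u * V1 u)"
      unfolding V1_def using t by (intro pext_horizontal(2)[OF G h]) auto
    also have "\<dots> \<le> J" unfolding J_def
    proof (rule integral_mono)
      have int: "integrable lborel (\<lambda>u. indicat_real {a..b} u * V1 u)" if "a \<le> b" for a b
        using integrable_norm[OF pext_horizontal(1)[OF G h that]] by (simp add: V1_def)
      show "integrable lborel (\<lambda>u. indicat_real {y..t} u * V1 u)" "integrable lborel (\<lambda>u. ?I u * V1 u)"
        using t h by (auto intro: int)
    qed (use t in \<open>auto split: split_indicator simp: V1_def\<close>)
    finally have "cmod (pext G t h - pext G y h) \<le> J" .
    then have "V y \<le> V t + J" unfolding V_def using norm_triangle_ineq3[of "pext G t h" "pext G y h"] by linarith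
    then have "(V y)\<^sup>2 \<le> (V t + J)\<^sup>2" by (intro power_mono) (auto simp: V_def)
    also have "\<dots> \<le> 2 * (V t)\<^sup>2 + 2 * J\<^sup>2" using sum_squares_bound[of "V t" J] by (simp add: power2_sum)
    finally show ?thesis using J2 by linarith
  qed
  have "h * (V y)\<^sup>2 = (LINT t|lborel. ?I t * (V y)\<^sup>2)" using I by simp
  also have "\<dots> \<le> (LINT t|lborel. 2 * (?I t * (V t)\<^sup>2) + ?I t * (2 * h * B))"
    using I iV point by (intro integral_mono) (auto split: split_indicator)
  also have "\<dots> = 2 * (LINT t|lborel. ?I t * (V t)\<^sup>2) + h * (2 * h * B)" using I iV by simp
  finally have "(V y)\<^sup>2 \<le> 2 / h * (LINT t|lborel. ?I t * (V t)\<^sup>2) + 2 * h * B"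
    using h by (simp add: field_simps)
  also have "\<dots> = (LINT t|lborel. ?I t * (2 / h * (V t)\<^sup>2 + 2 * h * (V1 t)\<^sup>2))"
    unfolding eq B_def using iV by simp
  finally show "(V y)\<^sup>2 \<le> (LINT t|lborel. ?I t * (2 / h * (V t)\<^sup>2 + 2 * h * (V1 t)\<^sup>2))" .
qed

text \<open>In the scale-free variables \<open>t\<close> and \<open>q\<close>, with
  \<open>t\<^sup>2 \<le> q\<close>, the claim is \<open>key\<close>. For \<open>q \<le> 1\<close>
  the factor \<open>t\<^sup>2\<close> suffices, since \<open>q \<le> q powr s\<close> for
  \<open>s \<le> 1\<close>; for larger \<open>q\<close> the exponential keeps the left side below
  16. The exponents 2 and 4 belong to the squares of first and second derivatives.\<close>

lemma exp_weight_bound: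
  fixes \<eta> x s :: real
  assumes \<eta>: "0 < \<eta>" and s: "0 \<le> s" "s \<le> 1" and n: "n = 2 \<or> n = 4"
  shows "\<bar>x\<bar> ^ n * damp (2 * \<eta>) x \<le> 16 * \<eta> powr (2 * s - real n) * (1 + x\<^sup>2) powr s"
proof -
  define t where "t = \<eta> * \<bar>x\<bar>"
  define q where "q = \<eta>\<^sup>2 * (1 + x\<^sup>2)"
  have t0: "0 \<le> t" using \<eta> by (simp add: t_def)
  have q: "q > 0" "t\<^sup>2 \<le> q" using \<eta> by (auto simp: q_def t_def power_mult_distrib algebra_simps add_pos_nonneg)
  have key: "t ^ n * exp (- (2 * t)) \<le> 16 * q powr s"
  proof (cases "q \<le> 1")
    case True
    with q have "t\<^sup>2 \<le> 1" by linarith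
    then have t1: "t \<le> 1" using power2_le_imp_le[of t 1] by simp
    have "t ^ n * exp (- (2 * t)) \<le> t\<^sup>2 * 1"
      using n t0 t1 by (intro mult_mono power_decreasing) auto
    also have "\<dots> \<le> q powr 1" using q by simp
    also have "\<dots> \<le> q powr s" using q True s by (intro powr_mono') auto
    also have "\<dots> \<le> 16 * q powr s" by simp
    finally show ?thesis .
  next
    case False
    \<comment> \<open>The fourth power of this inequality has just the exponential
      \<open>exp (2 * t)\<close> that is available; \<open>2 ^ 4\<close> is the constant of the
      lemma.\<close>
    have "t / 2 \<le> exp (t / 2)" using exp_ge_add_one_self[of "t/2"] by linarith
    then have "(t / 2) ^ 4 \<le> exp (t / 2) ^ 4" using t0 by (intro power_mono) auto
    also have "\<dots> = exp (2 * t)" by (subst exp_of_nat_mult[symmetric]) simp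
    finally have 4: "t ^ 4 \<le> 16 * exp (2 * t)" by (simp add: power_divide)
    have "t \<le> exp t" using exp_ge_add_one_self[of t] by linarith
    then have "t ^ 2 \<le> exp t ^ 2" using t0 by (intro power_mono) auto
    also have "\<dots> = exp (2 * t)" by (subst exp_of_nat_mult[symmetric]) simp
    finally have 2: "t ^ 2 \<le> 16 * exp (2 * t)" using exp_gt_zero[of "2 * t"] by linarith
    have "t ^ n \<le> 16 * exp (2 * t)" using n 2 4 by auto
    then have "t ^ n * exp (- (2 * t)) \<le> 16 * exp (2 * t) * exp (- (2 * t))" by (rule mult_right_mono) simp
    also have "\<dots> = 16" by (simp add: exp_minus field_simps)
    also have "\<dots> \<le> 16 * q powr s" using False s by (simp add: ge_one_powr_ge_zero)
    finally show ?thesis .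
  qed
  have "\<bar>x\<bar> ^ n * damp (2 * \<eta>) x = \<eta> powr (- real n) * (t ^ n * exp (- (2 * t)))"
    using \<eta> by (simp add: t_def power_mult_distrib powr_minus powr_realpow mult_ac)
  also have "\<dots> \<le> \<eta> powr (- real n) * (16 * q powr s)"
    by (intro mult_left_mono key) simp
  also have "q powr s = \<eta> powr (2 * s) * (1 + x\<^sup>2) powr s"
    using \<eta> by (simp add: q_def powr_mult powr_powr[symmetric])
  also have "\<eta> powr (- real n) * (16 * (\<eta> powr (2 * s) * (1 + x\<^sup>2) powr s)) = 16 * \<eta> powr (2 * s - real n) * (1 + x\<^sup>2) powr s"
    using \<eta> by (simp add: powr_diff powr_minus field_simps)
  finally show ?thesis .
qed

text \<open>The slice at height \<eta> is the reflected transform of the damped \<open>G\<close>, so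
  Plancherel's inequality applies; squaring doubles both the damping and the order \<open>n\<close>.
  The constant is \<open>2 * pi\<close> times the 16 of the weight bound.\<close>

lemma pext_norm2_le:
  assumes H: "square_integrable H" and W: "integrable lborel (wsq s H)"
    and \<eta>: "0 < \<eta>" and s: "0 \<le> s" "s \<le> 1" and n: "n = 1 \<or> n = 2"
    and G: "exp_integrable G" "\<And>\<xi>. cmod (G \<xi>) = \<bar>\<xi>\<bar> ^ n * cmod (H \<xi>)"
  shows "square_integrable (\<lambda>z. pext G z \<eta>)"
    and "norm2 (\<lambda>z. pext G z \<eta>) \<le> 32 * pi * \<eta> powr (2 * s - 2 * real n) * (LINT \<xi>|lborel. wsq s H \<xi>)"
proof -
  note [measurable] = exp_integrable_measurable[OF G(1)]
  define E where "E = (\<lambda>\<xi>. of_real (damp \<eta> \<xi>) * G \<xi>)"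
  let ?c = "16 * \<eta> powr (2 * s - real (2 * n))"
  have E1: "integrable lborel E"
    using exp_integrable_pext[OF G(1) \<eta>, of 0] by (simp add: E_def)
  have le: "(cmod (E \<xi>))\<^sup>2 \<le> ?c * (wsq s H \<xi>)" for \<xi>
  proof -
    have "(cmod (E \<xi>))\<^sup>2 = (\<bar>\<xi>\<bar> ^ (2 * n) * damp (2 * \<eta>) \<xi>) * (cmod (H \<xi>))\<^sup>2"
      by (simp add: E_def norm_mult G(2) power_mult_distrib exp_double[symmetric] power_mult[symmetric] mult_ac)
    also have "\<dots> \<le> (?c * (1 + \<xi>\<^sup>2) powr s) * (cmod (H \<xi>))\<^sup>2"
      using n by (intro mult_right_mono exp_weight_bound \<eta> s) auto
    finally show ?thesis by (simp add: mult_ac)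
  qed
  have E2: "square_integrable E"
    by (rule square_integrable_bound[OF _ _ le]) (use W in \<open>auto simp: E_def\<close>)
  have eq: "pext G z \<eta> = ft E (- z)" for z
    by (simp add: pext_def ft_def E_def mult_ac)
  have P: "square_integrable (ft E)" "norm2 (ft E) \<le> 2 * pi * norm2 E"
    using plancherel_le[OF E1 E2] by auto
  show "square_integrable (\<lambda>z. pext G z \<eta>)"
    unfolding eq by (rule square_integrable_reflect[OF P(1)])
  have "norm2 (\<lambda>z. pext G z \<eta>) = norm2 (ft E)"
    unfolding eq by (rule norm2_reflect[OF P(1)])
  also have "\<dots> \<le> 2 * pi * norm2 E" by (rule P)
  also have "norm2 E \<le> (LINT \<xi>|lborel. ?c * (wsq s H \<xi>))"
    unfolding norm2_def using E2 W le by (intro integral_mono) (auto simp: square_integrable_def)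
  also have "\<dots> = ?c * (LINT \<xi>|lborel. wsq s H \<xi>)" by simp
  finally show "norm2 (\<lambda>z. pext G z \<eta>) \<le> 32 * pi * \<eta> powr (2 * s - 2 * real n) * (LINT \<xi>|lborel. wsq s H \<xi>)"
    by (simp add: mult_ac)
qed

text \<open>The Sobolev density at height \<open>\<eta>\<close> of the vertical derivative, whose transform is \<open>\<bar>\<xi>\<bar> * H \<xi>\<close> up to sign,
  its integral over the section at height \<open>\<eta>\<close> of a region of tangential approach to \<open>x\<close>, and the resulting
  bound of the oscillation in the region below height \<open>h0\<close>.\<close>

definition pdens :: "(real \<Rightarrow> complex) \<Rightarrow> real \<Rightarrow> real \<Rightarrow> real" where
  "pdens H \<eta> z = 2 / \<eta> * (cmod (pext (\<lambda>\<xi>. of_real \<bar>\<xi>\<bar> * H \<xi>) z \<eta>))\<^sup>2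
     + 2 * \<eta> * (cmod (pext (\<lambda>\<xi>. \<i> * of_real \<xi> * (of_real \<bar>\<xi>\<bar> * H \<xi>)) z \<eta>))\<^sup>2"

definition tarea :: "real \<Rightarrow> real \<Rightarrow> (real \<Rightarrow> complex) \<Rightarrow> real \<Rightarrow> real \<Rightarrow> ennreal" where
  "tarea B \<beta> H \<eta> x = (\<integral>\<^sup>+z. (if \<bar>z - x\<bar> \<le> B * \<eta> powr \<beta> then ennreal (pdens H \<eta> z) else 0) \<partial>lborel)"

definition tosc :: "real \<Rightarrow> real \<Rightarrow> real \<Rightarrow> (real \<Rightarrow> complex) \<Rightarrow> real \<Rightarrow> real \<Rightarrow> ennreal" where
  "tosc \<delta> B \<beta> H h0 x = (\<integral>\<^sup>+\<eta>. indicator {0<..h0} \<eta> *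
     (ennreal (\<eta> powr (\<delta> - 1)) + ennreal (\<eta> powr (1 - \<delta>)) * tarea B \<beta> H \<eta> x) \<partial>lborel)"

lemma borel_measurable_pdens [measurable (raw)]:
  assumes [measurable]: "f \<in> borel_measurable M" "g \<in> borel_measurable M" "H \<in> borel_measurable lborel"
  shows "(\<lambda>x. pdens H (f x) (g x)) \<in> borel_measurable M"
  unfolding pdens_def by measurable

lemma borel_measurable_tarea [measurable (raw)]:
  assumes [measurable]: "f \<in> borel_measurable M" "g \<in> borel_measurable M" "H \<in> borel_measurable lborel"
  shows "(\<lambda>x. tarea B \<beta> H (f x) (g x)) \<in> borel_measurable M"
  unfolding tarea_def by measurable

lemma pdens_nonneg: "0 < \<eta> \<Longrightarrow> 0 \<le> pdens H \<eta> z"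
  by (simp add: pdens_def)

text \<open>The aperture grows from \<open>A\<close> to \<open>A + 1\<close> to make room for the
  interval of length \<eta> in the Sobolev inequality, since
  \<open>\<eta> \<le> \<eta> powr \<beta>\<close> for heights up to 1. The exponent \<delta> is
  chosen only when the bound is integrated.\<close>

lemma pext_le_tosc:
  assumes H: "square_integrable H" and \<beta>: "0 < \<beta>" "\<beta> \<le> 1" and A: "0 \<le> A"
    and h: "0 < h" "h \<le> h0" "h0 \<le> 1" and y: "\<bar>y - x\<bar> \<le> A * h powr \<beta>"
  shows "ennreal (cmod (pext H y h - pext H y h0)) \<le> tosc \<delta> (A + 1) \<beta> H h0 x"
proof -
  note [measurable] = square_integrable_measurable[OF H]
  have G0: "exp_integrable H" by (rule square_integrable_exp_integrable[OF H])
  let ?G = "\<lambda>\<xi>. of_real \<bar>\<xi>\<bar> * H \<xi>"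
  have G: "exp_integrable ?G" by (rule exp_integrable_mult[OF G0]) auto
  have "ennreal (cmod (pext H y h - pext H y h0)) \<le> ennreal (LINT t|lborel. indicat_real {h..h0} t * cmod (pext ?G y t))"
    by (intro ennreal_leI pext_vertical(2)[OF G0 h(1,2)])
  also have "\<dots> = (\<integral>\<^sup>+t. ennreal (indicat_real {h..h0} t * cmod (pext ?G y t)) \<partial>lborel)"
    using integrable_norm[OF pext_vertical(1)[OF G0 h(1,2), of y]]
    by (intro nn_integral_eq_integral[symmetric]) auto
  also have "\<dots> \<le> tosc \<delta> (A + 1) \<beta> H h0 x"
    unfolding tosc_def
  proof (intro nn_integral_mono)
    fix \<eta> :: real
    show "ennreal (indicat_real {h..h0} \<eta> * cmod (pext ?G y \<eta>)) \<le> indicator {0<..h0} \<eta> *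
      (ennreal (\<eta> powr (\<delta> - 1)) + ennreal (\<eta> powr (1 - \<delta>)) * tarea (A + 1) \<beta> H \<eta> x)"
    proof (cases "\<eta> \<in> {h..h0}")
      case True
      then have \<eta>: "0 < \<eta>" "h \<le> \<eta>" "\<eta> \<le> h0" "\<eta> \<le> 1" using h by auto
      define v where "v = cmod (pext ?G y \<eta>)"
      define p where "p = \<eta> powr (\<delta> - 1)"
      have p: "p > 0" "\<eta> powr (1 - \<delta>) = 1 / p"
        using \<eta> by (simp_all add: p_def powr_diff)
      \<comment> \<open>The derivative enters linearly, but only its square is controlled. With the
        weight \<open>p\<close> the arithmetic-geometric mean inequality yields an integrable power
        of \<eta> and a weighted square.\<close>
      have "2 * v * p \<le> p\<^sup>2 + v\<^sup>2" using sum_squares_bound[of v p] by simp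
      moreover have "0 \<le> v * p" using p by (simp add: v_def)
      ultimately have "v * p \<le> p\<^sup>2 + v\<^sup>2" by linarith
      then have vp: "v \<le> p + 1 / p * v\<^sup>2" using p by (simp add: field_simps power2_eq_square)
      have "ennreal (v\<^sup>2) \<le> ennreal (LINT t|lborel. indicat_real {y..y+\<eta>} t * pdens H \<eta> t)"
        unfolding v_def pdens_def by (intro ennreal_leI pext_sobolev(2)[OF G \<eta>(1)])
      also have "\<dots> = (\<integral>\<^sup>+t. ennreal (indicat_real {y..y+\<eta>} t * pdens H \<eta> t) \<partial>lborel)"
      proof (intro nn_integral_eq_integral[symmetric])
        show "integrable lborel (\<lambda>t. indicat_real {y..y+\<eta>} t * pdens H \<eta> t)"
          unfolding pdens_def by (rule pext_sobolev(1)[OF G \<eta>(1)])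
      qed (simp add: pdens_nonneg[OF \<eta>(1)])
      also have "\<dots> \<le> tarea (A + 1) \<beta> H \<eta> x"
        unfolding tarea_def
      proof (intro nn_integral_mono)
        fix t :: real
        have "\<bar>t - x\<bar> \<le> (A + 1) * \<eta> powr \<beta>" if "t \<in> {y..y+\<eta>}"
        proof -
          have "\<bar>t - x\<bar> \<le> A * h powr \<beta> + \<eta>" using that y by auto
          moreover have "A * h powr \<beta> \<le> A * \<eta> powr \<beta>" using A h \<eta> \<beta> by (intro mult_left_mono powr_mono2) auto
          moreover have "\<eta> \<le> \<eta> powr \<beta>" using powr_mono'[of \<beta> 1 \<eta>] \<eta> \<beta> by simp
          ultimately show ?thesis by (simp add: algebra_simps)
        qed
        then show "ennreal (indicat_real {y..y+\<eta>} t * pdens H \<eta> t) \<le>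
          (if \<bar>t - x\<bar> \<le> (A + 1) * \<eta> powr \<beta> then ennreal (pdens H \<eta> t) else 0)"
          by (auto split: split_indicator)
      qed
      finally have v2: "ennreal (v\<^sup>2) \<le> tarea (A + 1) \<beta> H \<eta> x" .
      have "ennreal v \<le> ennreal p + ennreal (1 / p) * ennreal (v\<^sup>2)"
        using vp p by (simp add: ennreal_mult[symmetric] ennreal_plus[symmetric] del: ennreal_plus)
      also have "\<dots> \<le> ennreal p + ennreal (1 / p) * tarea (A + 1) \<beta> H \<eta> x"
        by (intro add_left_mono mult_left_mono v2) auto
      finally show ?thesis using True \<eta> p by (simp add: v_def p_def)
    qed simp
  qed
  finally show ?thesis .
qed

section \<open>Integrated oscillation and limits almost everywhere\<close>

lemma nn_integral_powr_unit_interval: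
  assumes "\<delta> > 0"
  shows "(\<integral>\<^sup>+\<eta>. indicator {0<..1} \<eta> * ennreal (\<eta> powr (\<delta> - 1)) \<partial>lborel) = ennreal (1 / \<delta>)"
proof -
  have "((\<lambda>x. x powr (\<delta> - 1)) has_integral (1 powr (\<delta> - 1 + 1) / (\<delta> - 1 + 1))) {0..1}"
    using assms by (intro has_integral_powr_from_0) auto
  then have "((\<lambda>x. if x \<in> {0..1} then x powr (\<delta> - 1) else 0) has_integral 1 / \<delta>) UNIV"
    by (subst has_integral_restrict_UNIV) simp
  then have "(\<integral>\<^sup>+x. ennreal (if x \<in> {0..1} then x powr (\<delta> - 1) else 0) \<partial>lborel) = ennreal (1 / \<delta>)"
    by (intro nn_integral_has_integral_lborel) auto
  also have "(\<integral>\<^sup>+x. ennreal (if x \<in> {0..1} then x powr (\<delta> - 1) else 0) \<partial>lborel) =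
     (\<integral>\<^sup>+\<eta>. indicator {0<..1} \<eta> * ennreal (\<eta> powr (\<delta> - 1)) \<partial>lborel)"
    by (intro nn_integral_cong) (auto split: split_indicator)
  finally show ?thesis .
qed

text \<open>The weights \<open>2 / \<eta>\<close> and \<open>2 * \<eta>\<close> in the density make
  both terms of order \<open>\<eta> powr (2 * s - 3)\<close>; each contributes \<open>2 * 32\<close>
  to the constant.\<close>

lemma nn_integral_pdens_le:
  assumes H: "square_integrable H" and W: "integrable lborel (wsq s H)"
    and \<eta>: "0 < \<eta>" and s: "0 \<le> s" "s \<le> 1"
  shows "(\<integral>\<^sup>+z. ennreal (pdens H \<eta> z) \<partial>lborel) \<le>
    ennreal (128 * pi * (LINT \<xi>|lborel. wsq s H \<xi>) * \<eta> powr (2 * s - 3))"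
proof -
  define w where "w = (LINT \<xi>|lborel. wsq s H \<xi>)"
  note [measurable] = square_integrable_measurable[OF H]
  have G0: "exp_integrable H" by (rule square_integrable_exp_integrable[OF H])
  let ?G = "\<lambda>\<xi>. of_real \<bar>\<xi>\<bar> * H \<xi>"
  let ?G1 = "\<lambda>\<xi>. \<i> * of_real \<xi> * (of_real \<bar>\<xi>\<bar> * H \<xi>)"
  have G: "exp_integrable ?G" by (rule exp_integrable_mult[OF G0]) auto
  have G1: "exp_integrable ?G1" by (rule exp_integrable_mult[OF G]) (auto simp: norm_mult)
  have 1: "square_integrable (\<lambda>z. pext ?G z \<eta>)" "norm2 (\<lambda>z. pext ?G z \<eta>) \<le> 32 * pi * \<eta> powr (2 * s - 2) * w"
    using pext_norm2_le[OF H W \<eta> s _ G, of 1] by (auto simp: norm_mult w_def)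
  have 2: "square_integrable (\<lambda>z. pext ?G1 z \<eta>)" "norm2 (\<lambda>z. pext ?G1 z \<eta>) \<le> 32 * pi * \<eta> powr (2 * s - 4) * w"
    using pext_norm2_le[OF H W \<eta> s _ G1, of 2] by (auto simp: norm_mult w_def power2_eq_square mult_ac)
  have "(\<integral>\<^sup>+z. ennreal (pdens H \<eta> z) \<partial>lborel) = ennreal (LINT z|lborel. pdens H \<eta> z)"
    using 1(1) 2(1) pdens_nonneg[OF \<eta>, of H]
    by (intro nn_integral_eq_integral) (auto simp: pdens_def square_integrable_def)
  also have "(LINT z|lborel. pdens H \<eta> z) = 2 / \<eta> * norm2 (\<lambda>z. pext ?G z \<eta>) + 2 * \<eta> * norm2 (\<lambda>z. pext ?G1 z \<eta>)"
    using 1(1) 2(1) unfolding pdens_def norm2_def square_integrable_def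
    by (subst Bochner_Integration.integral_add) auto
  also have "\<dots> \<le> 2 / \<eta> * (32 * pi * \<eta> powr (2 * s - 2) * w) + 2 * \<eta> * (32 * pi * \<eta> powr (2 * s - 4) * w)"
    using \<eta> by (intro add_mono mult_left_mono 1 2) auto
  also have "\<dots> = 128 * pi * w * \<eta> powr (2 * s - 3)"
  proof -
    have "\<eta> powr (2 * s - 2) = \<eta> powr (2 * s - 3) * \<eta>"
      using \<eta> powr_add[of \<eta> "2 * s - 3" 1] by simp
    moreover have "\<eta> powr (2 * s - 3) = \<eta> powr (2 * s - 4) * \<eta>"
      using \<eta> powr_add[of \<eta> "2 * s - 4" 1] by simp
    ultimately show ?thesis using \<eta> by (simp add: field_simps)
  qed
  finally show ?thesis unfolding w_def by (simp add: ennreal_leI)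
qed

text \<open>The exponents balance: the area term costs \<open>\<eta> powr \<beta>\<close>, so that the choice of \<open>\<delta>\<close>
  leaves the integrable power \<open>\<eta> powr (\<delta> - 1)\<close>.\<close>

lemma nn_integral_tarea_finite:
  assumes H: "square_integrable H" and W: "integrable lborel (wsq s H)"
    and s: "0 \<le> s" "s \<le> 1" and B: "0 \<le> B" and \<delta>: "\<delta> = (\<beta> + 2 * s - 1) / 2" "\<delta> > 0"
  shows "(\<integral>\<^sup>+x. (\<integral>\<^sup>+\<eta>. indicator {0<..1} \<eta> * (ennreal (\<eta> powr (1 - \<delta>)) * tarea B \<beta> H \<eta> x) \<partial>lborel) \<partial>lborel) < \<infinity>"
proof -
  note [measurable] = square_integrable_measurable[OF H]
  define w where "w = (LINT \<xi>|lborel. wsq s H \<xi>)"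
  have w: "0 \<le> w" unfolding w_def by simp
  have area: "(\<integral>\<^sup>+x. tarea B \<beta> H \<eta> x \<partial>lborel) \<le> ennreal (256 * pi * B * w * \<eta> powr (\<beta> + 2 * s - 3))"
    if \<eta>: "0 < \<eta>" for \<eta>
  proof -
    let ?r = "B * \<eta> powr \<beta>"
    have r: "0 \<le> ?r" using B by simp
    \<comment> \<open>A fixed \<open>z\<close> lies in the section above \<open>x\<close> for a set
      of \<open>x\<close> of length \<open>2 * ?r\<close>: this is the whole price of the tangential
      region.\<close>
    have "(\<integral>\<^sup>+x. tarea B \<beta> H \<eta> x \<partial>lborel) =
       (\<integral>\<^sup>+z. (\<integral>\<^sup>+x. (if \<bar>z - x\<bar> \<le> ?r then ennreal (pdens H \<eta> z) else 0) \<partial>lborel) \<partial>lborel)"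
      unfolding tarea_def by (rule lborel_pair.Fubini') measurable
    also have "\<dots> = (\<integral>\<^sup>+z. ennreal (pdens H \<eta> z) * ennreal (2 * ?r) \<partial>lborel)"
    proof (intro nn_integral_cong)
      fix z
      have "(\<integral>\<^sup>+x. (if \<bar>z - x\<bar> \<le> ?r then ennreal (pdens H \<eta> z) else 0) \<partial>lborel) =
        (\<integral>\<^sup>+x. ennreal (pdens H \<eta> z) * indicator {z - ?r..z + ?r} x \<partial>lborel)"
        by (intro nn_integral_cong) (auto split: split_indicator simp: abs_le_iff)
      also have "\<dots> = ennreal (pdens H \<eta> z) * ennreal (2 * ?r)"
        using r by (subst nn_integral_cmult_indicator) auto
      finally show "(\<integral>\<^sup>+x. (if \<bar>z - x\<bar> \<le> ?r then ennreal (pdens H \<eta> z) else 0) \<partial>lborel) = \<dots>" .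
    qed
    also have "\<dots> = (\<integral>\<^sup>+z. ennreal (pdens H \<eta> z) \<partial>lborel) * ennreal (2 * ?r)"
      by (rule nn_integral_multc) measurable
    also have "\<dots> \<le> ennreal (128 * pi * w * \<eta> powr (2 * s - 3)) * ennreal (2 * ?r)"
      unfolding w_def by (intro mult_right_mono nn_integral_pdens_le H W \<eta> s) auto
    also have "\<dots> = ennreal (256 * pi * B * w * (\<eta> powr (2 * s - 3) * \<eta> powr \<beta>))"
      using w r by (subst ennreal_mult[symmetric]) (auto simp: mult_ac)
    also have "\<eta> powr (2 * s - 3) * \<eta> powr \<beta> = \<eta> powr (\<beta> + 2 * s - 3)"
      by (subst powr_add[symmetric]) (simp add: algebra_simps)
    finally show ?thesis .
  qed
  have "(\<integral>\<^sup>+x. (\<integral>\<^sup>+\<eta>. indicator {0<..1} \<eta> * (ennreal (\<eta> powr (1 - \<delta>)) * tarea B \<beta> H \<eta> x) \<partial>lborel) \<partial>lborel)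
     = (\<integral>\<^sup>+\<eta>. (\<integral>\<^sup>+x. indicator {0<..1} \<eta> * (ennreal (\<eta> powr (1 - \<delta>)) * tarea B \<beta> H \<eta> x) \<partial>lborel) \<partial>lborel)"
    by (rule lborel_pair.Fubini') measurable
  also have "\<dots> = (\<integral>\<^sup>+\<eta>. indicator {0<..1} \<eta> * (ennreal (\<eta> powr (1 - \<delta>)) * (\<integral>\<^sup>+x. tarea B \<beta> H \<eta> x \<partial>lborel)) \<partial>lborel)"
    by (simp add: nn_integral_cmult)
  also have "\<dots> \<le> (\<integral>\<^sup>+\<eta>. ennreal (256 * pi * B * w) * (indicator {0<..1} \<eta> * ennreal (\<eta> powr (\<delta> - 1))) \<partial>lborel)"
  proof (intro nn_integral_mono)
    fix \<eta> :: real
    show "indicator {0<..1} \<eta> * (ennreal (\<eta> powr (1 - \<delta>)) * (\<integral>\<^sup>+x. tarea B \<beta> H \<eta> x \<partial>lborel)) \<le>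
       ennreal (256 * pi * B * w) * (indicator {0<..1} \<eta> * ennreal (\<eta> powr (\<delta> - 1)))"
    proof (cases "\<eta> \<in> {0<..1}")
      case True
      then have \<eta>: "0 < \<eta>" by simp
      have "ennreal (\<eta> powr (1 - \<delta>)) * (\<integral>\<^sup>+x. tarea B \<beta> H \<eta> x \<partial>lborel) \<le>
         ennreal (\<eta> powr (1 - \<delta>)) * ennreal (256 * pi * B * w * \<eta> powr (\<beta> + 2 * s - 3))"
        by (intro mult_left_mono area \<eta>) auto
      also have "\<dots> = ennreal (256 * pi * B * w * (\<eta> powr (1 - \<delta>) * \<eta> powr (\<beta> + 2 * s - 3)))"
        using w B by (subst ennreal_mult[symmetric]) (auto simp: mult_ac)
      \<comment> \<open>By the choice of \<delta> the second exponent is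
        \<open>2 * \<delta> - 2\<close>.\<close>
      also have "\<eta> powr (1 - \<delta>) * \<eta> powr (\<beta> + 2 * s - 3) = \<eta> powr (\<delta> - 1)"
        by (subst powr_add[symmetric]) (simp add: \<delta>(1) field_simps)
      finally show ?thesis using True w B by (simp add: ennreal_mult)
    qed simp
  qed
  also have "\<dots> = ennreal (256 * pi * B * w) * ennreal (1 / \<delta>)"
    by (simp add: nn_integral_cmult nn_integral_powr_unit_interval[OF \<delta>(2)])
  also have "\<dots> < \<infinity>" by (simp add: ennreal_mult_less_top)
  finally show ?thesis .
qed

lemma tosc_tendsto_zero:
  assumes [measurable]: "H \<in> borel_measurable lborel" and fin: "tosc \<delta> B \<beta> H 1 x < \<infinity>"
  shows "(\<lambda>n. tosc \<delta> B \<beta> H (1 / real (Suc n)) x) \<longlonglongrightarrow> 0"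
proof -
  let ?q = "\<lambda>\<eta>. ennreal (\<eta> powr (\<delta> - 1)) + ennreal (\<eta> powr (1 - \<delta>)) * tarea B \<beta> H \<eta> x"
  have "(\<lambda>n. tosc \<delta> B \<beta> H (1 / real (Suc n)) x) \<longlonglongrightarrow> (\<integral>\<^sup>+\<eta>. 0 \<partial>(lborel::real measure))"
    unfolding tosc_def
  proof (rule nn_integral_dominated_convergence[where w="\<lambda>\<eta>. indicator {0<..1} \<eta> * ?q \<eta>"])
    show "(\<integral>\<^sup>+\<eta>. indicator {0<..1} \<eta> * ?q \<eta> \<partial>lborel) < \<infinity>" using fin by (simp add: tosc_def)
    show "AE \<eta> in lborel. indicator {0<..1 / real (Suc n)} \<eta> * ?q \<eta> \<le> indicator {0<..1} \<eta> * ?q \<eta>" for n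
    proof (rule AE_I2)
      fix \<eta> :: real
      have le: "1 / real (Suc n) \<le> 1" by simp
      have "\<eta> \<le> 1" if "\<eta> \<le> 1 / real (Suc n)" using that le by (rule order_trans)
      then have "indicator {0<..1 / real (Suc n)} \<eta> \<le> (indicator {0<..1} \<eta> :: ennreal)"
        unfolding indicator_def by (simp del: of_nat_Suc)
      then show "indicator {0<..1 / real (Suc n)} \<eta> * ?q \<eta> \<le> indicator {0<..1} \<eta> * ?q \<eta>"
        by (rule mult_right_mono) simp
    qed
    show "AE \<eta> in lborel. (\<lambda>n. indicator {0<..1 / real (Suc n)} \<eta> * ?q \<eta>) \<longlonglongrightarrow> 0"
    proof (rule AE_I2)
      fix \<eta> :: real
      have "\<forall>\<^sub>F n in sequentially. indicator {0<..1 / real (Suc n)} \<eta> = (0::ennreal)"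
      proof (cases "\<eta> > 0")
        case True
        have "(\<lambda>n. 1 / real (Suc n)) \<longlonglongrightarrow> 0" by real_asymp
        from order_tendstoD(2)[OF this True] show ?thesis by eventually_elim auto
      qed auto
      then have "\<forall>\<^sub>F n in sequentially. indicator {0<..1 / real (Suc n)} \<eta> * ?q \<eta> = 0" by eventually_elim simp
      then show "(\<lambda>n. indicator {0<..1 / real (Suc n)} \<eta> * ?q \<eta>) \<longlonglongrightarrow> 0" by (rule tendsto_eventually)
    qed
  qed measurable
  then show ?thesis by simp
qed

lemma tendsto_pext_horizontal:
  assumes H: "exp_integrable H" and h: "0 < h"
  shows "((\<lambda>y. pext H y h) \<longlongrightarrow> pext H x h) (at x)"
  unfolding tendsto_at_iff_sequentially o_def pext_def
proof (intro allI impI)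
  fix X :: "nat \<Rightarrow> real" assume X: "X \<longlonglongrightarrow> x"
  note [measurable] = exp_integrable_measurable[OF H]
  show "(\<lambda>n. LINT \<xi>|lborel. cis (X n * \<xi>) * of_real (damp h \<xi>) * H \<xi>)
    \<longlonglongrightarrow> (LINT \<xi>|lborel. cis (x * \<xi>) * of_real (damp h \<xi>) * H \<xi>)"
  proof (rule integral_dominated_convergence[where w="\<lambda>\<xi>. damp h \<xi> * cmod (H \<xi>)"])
    show "integrable lborel (\<lambda>\<xi>. damp h \<xi> * cmod (H \<xi>))"
      using H h by (simp add: exp_integrable_def)
    show "(\<lambda>\<xi>. cis (x * \<xi>) * of_real (damp h \<xi>) * H \<xi>) \<in> borel_measurable lborel" by measurable
    show "(\<lambda>\<xi>. cis (X n * \<xi>) * of_real (damp h \<xi>) * H \<xi>) \<in> borel_measurable lborel" for n by measurable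
    show "AE \<xi> in lborel. (\<lambda>n. cis (X n * \<xi>) * of_real (damp h \<xi>) * H \<xi>)
      \<longlonglongrightarrow> cis (x * \<xi>) * of_real (damp h \<xi>) * H \<xi>"
    proof (rule AE_I2)
      fix \<xi> :: real
      have "(\<lambda>n. cis (X n * \<xi>)) \<longlonglongrightarrow> cis (x * \<xi>)"
        by (rule continuous_on_tendsto_compose[of UNIV cis]) (auto intro!: tendsto_intros X continuous_intros)
      then show "(\<lambda>n. cis (X n * \<xi>) * of_real (damp h \<xi>) * H \<xi>)
        \<longlonglongrightarrow> cis (x * \<xi>) * of_real (damp h \<xi>) * H \<xi>"
        by (intro tendsto_mult tendsto_const)
    qed
  qed (auto simp: norm_mult)
qed

text \<open>Where the integrated oscillation is finite it tends to 0 with the height, which is a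
  Cauchy condition over the whole region. The limit stays anonymous because the result is applied to
  halves of the spectrum as well. The second claim supplies the majorant, uniform in the height,
  with which the limit of the full extension is identified.\<close>

lemma tangential_limit:
  assumes H: "square_integrable H" and W: "integrable lborel (wsq s H)"
    and s: "0 \<le> s" "s \<le> 1" "(1 - \<beta>) / 2 < s" and \<beta>: "0 < \<beta>" "\<beta> \<le> 1" and A: "0 \<le> A"
  shows "AE x in lborel. \<exists>L. \<forall>e>0. \<exists>d>0. \<forall>h y. 0 < h \<and> h < d \<and> \<bar>y - x\<bar> \<le> A * h powr \<beta> \<longrightarrow> cmod (pext H y h - L) < e"
    and "\<exists>S c. integrable lborel S \<and> (AE x in lborel. \<forall>h. 0 < h \<and> h \<le> 1 \<longrightarrow> cmod (pext H x h - pext H x 1) \<le> c + S x)"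
proof -
  note [measurable] = square_integrable_measurable[OF H]
  define \<delta> where "\<delta> = (\<beta> + 2 * s - 1) / 2"
  have \<delta>: "\<delta> > 0" using s by (simp add: \<delta>_def field_simps)
  let ?T = "tosc \<delta> (A + 1) \<beta> H"
  define S where "S = (\<lambda>x. \<integral>\<^sup>+\<eta>. indicator {0<..1} \<eta> * (ennreal (\<eta> powr (1 - \<delta>)) * tarea (A + 1) \<beta> H \<eta> x) \<partial>lborel)"
  have [measurable]: "S \<in> borel_measurable lborel" unfolding S_def by measurable
  have intS: "(\<integral>\<^sup>+x. S x \<partial>lborel) < \<infinity>"
    unfolding S_def by (rule nn_integral_tarea_finite[OF H W s(1,2)]) (use A \<delta> in \<open>auto simp: \<delta>_def\<close>)
  \<comment> \<open>The oscillation splits into a constant, which is not integrable over the line,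
    and \<open>S\<close>, which is; hence the separate \<open>c\<close> in the second claim.\<close>
  have T1: "?T 1 x = ennreal (1 / \<delta>) + S x" for x
    unfolding tosc_def S_def nn_integral_powr_unit_interval[OF \<delta>, symmetric]
    by (subst nn_integral_add[symmetric]) (auto simp: distrib_left)
  have AES: "AE x in lborel. S x \<noteq> \<infinity>"
    using intS by (intro nn_integral_PInf_AE) auto
  have T: "ennreal (cmod (pext H y h - pext H y h0)) \<le> ?T h0 x"
    if "0 < h" "h \<le> h0" "h0 \<le> 1" "\<bar>y - x\<bar> \<le> A * h powr \<beta>" for x y h h0
    by (rule pext_le_tosc[OF H \<beta> A that])
  show "\<exists>S c. integrable lborel S \<and> (AE x in lborel. \<forall>h. 0 < h \<and> h \<le> 1 \<longrightarrow> cmod (pext H x h - pext H x 1) \<le> c + S x)"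
  proof (intro exI conjI)
    show "integrable lborel (\<lambda>x. enn2real (S x))"
    proof (rule integrableI_bounded)
      have "(\<integral>\<^sup>+x. ennreal (norm (enn2real (S x))) \<partial>lborel) = (\<integral>\<^sup>+x. S x \<partial>lborel)"
        by (intro nn_integral_cong_AE) (use AES in eventually_elim, auto simp: top.not_eq_extremum)
      then show "(\<integral>\<^sup>+x. ennreal (norm (enn2real (S x))) \<partial>lborel) < \<infinity>" using intS by simp
    qed measurable
    show "AE x in lborel. \<forall>h. 0 < h \<and> h \<le> 1 \<longrightarrow> cmod (pext H x h - pext H x 1) \<le> 1 / \<delta> + enn2real (S x)"
      using AES
    proof eventually_elim
      case (elim x)
      show ?case
      proof (intro allI impI)
        fix h :: real assume h: "0 < h \<and> h \<le> 1"
        have "ennreal (cmod (pext H x h - pext H x 1)) \<le> ?T 1 x"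
          using h A by (intro T) auto
        also have "\<dots> = ennreal (1 / \<delta> + enn2real (S x))"
          using elim \<delta> by (simp add: T1 ennreal_plus top.not_eq_extremum)
        finally show "cmod (pext H x h - pext H x 1) \<le> 1 / \<delta> + enn2real (S x)"
          using \<delta> by (subst (asm) ennreal_le_iff) auto
      qed
    qed
  qed
  show "AE x in lborel. \<exists>L. \<forall>e>0. \<exists>d>0. \<forall>h y. 0 < h \<and> h < d \<and> \<bar>y - x\<bar> \<le> A * h powr \<beta> \<longrightarrow> cmod (pext H y h - L) < e"
    using AES
  proof eventually_elim
    case (elim x)
    then have "?T 1 x < \<infinity>" by (simp add: T1 top.not_eq_extremum)
    from tosc_tendsto_zero[OF _ this] have lim: "(\<lambda>n. ?T (1 / real (Suc n)) x) \<longlonglongrightarrow> 0" by simp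
    have small: "\<exists>h0>0. h0 \<le> 1 \<and> ?T h0 x < ennreal e" if "e > 0" for e
    proof -
      have "\<forall>\<^sub>F n in sequentially. ?T (1 / real (Suc n)) x < ennreal e"
        using that by (intro order_tendstoD(2)[OF lim]) auto
      then obtain n where "?T (1 / real (Suc n)) x < ennreal e" by (auto simp: eventually_sequentially)
      then show ?thesis by (intro exI[of _ "1 / real (Suc n)"]) auto
    qed
    \<comment> \<open>All values are compared with \<open>pext H x h0\<close>: from height
      \<open>h\<close> one rises vertically to \<open>h0\<close>, at a cost bounded by the
      oscillation, and then moves horizontally to \<open>x\<close>, using continuity at the fixed
      height \<open>h0\<close>.\<close>
    have cauchy: "\<exists>h0>0. \<exists>d>0. \<forall>h y. 0 < h \<and> h < d \<and> \<bar>y - x\<bar> \<le> A * h powr \<beta> \<longrightarrow> cmod (pext H y h - pext H x h0) < e" if e: "e > 0" for e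
    proof -
      obtain h0 where h0: "h0 > 0" "h0 \<le> 1" "?T h0 x < ennreal (e/2)" using small[of "e/2"] e by auto
      have "\<forall>\<^sub>F y in at x. dist (pext H y h0) (pext H x h0) < e / 2"
        using e h0 by (intro tendstoD tendsto_pext_horizontal square_integrable_exp_integrable H) auto
      then obtain r where r: "r > 0" "\<And>y. dist y x < r \<Longrightarrow> cmod (pext H y h0 - pext H x h0) < e / 2"
        unfolding eventually_at using e by (metis dist_norm dist_self half_gt_zero_iff UNIV_I)
      have "((\<lambda>h. A * h powr \<beta>) \<longlongrightarrow> A * 0 powr \<beta>) (at_right 0)"
        using \<beta> by (intro tendsto_intros) (auto simp: eventually_at_filter)
      then have "((\<lambda>h. A * h powr \<beta>) \<longlongrightarrow> 0) (at_right 0)" by simp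
      from order_tendstoD(2)[OF this r(1)]
      obtain d where d: "d > 0" "\<And>h. 0 < h \<Longrightarrow> h < d \<Longrightarrow> A * h powr \<beta> < r"
        unfolding eventually_at_right_field by auto
      have "cmod (pext H y h - pext H x h0) < e" if y: "0 < h" "h < min d h0" "\<bar>y - x\<bar> \<le> A * h powr \<beta>" for h y
      proof -
        have "ennreal (cmod (pext H y h - pext H y h0)) < ennreal (e/2)"
          using T[of h h0 y x] y h0 by (intro le_less_trans[OF _ h0(3)]) auto
        then have 1: "cmod (pext H y h - pext H y h0) < e / 2" using e by (simp add: ennreal_less_iff)
        have 2: "cmod (pext H y h0 - pext H x h0) < e / 2"
          using d(2)[of h] y by (intro r(2)) (auto simp: dist_real_def)
        show ?thesis using norm_triangle_ineq[of "pext H y h - pext H y h0" "pext H y h0 - pext H x h0"] 1 2 by simp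
      qed
      then show ?thesis using h0(1) d(1) by (intro exI[of _ h0] conjI exI[of _ "min d h0"]) auto
    qed
    have "Cauchy (\<lambda>n. pext H x (1 / real (Suc n)))"
    proof (rule metric_CauchyI)
      fix e :: real assume e: "e > 0"
      obtain h0 d where d: "d > 0" "\<And>h y. 0 < h \<and> h < d \<and> \<bar>y - x\<bar> \<le> A * h powr \<beta> \<Longrightarrow> cmod (pext H y h - pext H x h0) < e / 2"
        using cauchy[of "e/2"] e by auto
      have "(\<lambda>n. 1 / real (Suc n)) \<longlonglongrightarrow> 0" by real_asymp
      from order_tendstoD(2)[OF this d(1)] obtain M where M: "\<And>n. n \<ge> M \<Longrightarrow> 1 / real (Suc n) < d"
        by (auto simp: eventually_sequentially)
      have c: "cmod (pext H x (1 / real (Suc n)) - pext H x h0) < e / 2" if "n \<ge> M" for n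
        using M[OF that] A by (intro d(2)) auto
      show "\<exists>M. \<forall>m\<ge>M. \<forall>n\<ge>M. dist (pext H x (1 / real (Suc m))) (pext H x (1 / real (Suc n))) < e"
      proof (intro exI[of _ M] allI impI)
        fix m n assume "m \<ge> M" "n \<ge> M"
        from c[OF this(1)] c[OF this(2)]
        show "dist (pext H x (1 / real (Suc m))) (pext H x (1 / real (Suc n))) < e"
          unfolding dist_norm[symmetric] by (rule dist_triangle_half_l)
      qed
    qed
    then obtain L where L: "(\<lambda>n. pext H x (1 / real (Suc n))) \<longlonglongrightarrow> L"
      using Cauchy_convergent convergent_def by blast
    show ?case
    proof (intro exI[of _ L] allI impI)
      fix e :: real assume e: "e > 0"
      obtain h0 d where d: "d > 0" "\<And>h y. 0 < h \<and> h < d \<and> \<bar>y - x\<bar> \<le> A * h powr \<beta> \<Longrightarrow> cmod (pext H y h - pext H x h0) < e / 2"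
        using cauchy[of "e/2"] e by auto
      have "(\<lambda>n. 1 / real (Suc n)) \<longlonglongrightarrow> 0" by real_asymp
      from order_tendstoD(2)[OF this d(1)]
      have "\<forall>\<^sub>F n in sequentially. cmod (pext H x (1 / real (Suc n)) - pext H x h0) \<le> e / 2"
        by eventually_elim (use d(2) A in \<open>auto intro!: less_imp_le\<close>)
      then have "cmod (L - pext H x h0) \<le> e / 2"
        by (intro tendsto_upperbound[OF tendsto_norm[OF tendsto_diff[OF L tendsto_const]]]) auto
      then have "cmod (pext H y h - L) < e" if "0 < h \<and> h < d \<and> \<bar>y - x\<bar> \<le> A * h powr \<beta>" for h y
        using d(2)[OF that] norm_triangle_ineq4[of "pext H y h - pext H x h0" "L - pext H x h0"] by simp
      then show "\<exists>d>0. \<forall>h y. 0 < h \<and> h < d \<and> \<bar>y - x\<bar> \<le> A * h powr \<beta> \<longrightarrow> cmod (pext H y h - L) < e"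
        using d(1) by blast
    qed
  qed
qed

subsection \<open>Identification of the limit\<close>

lemma divide_le_divide_cross:
  fixes p q u v :: real
  assumes "p * v \<le> q * u" "0 < u" "0 < v"
  shows "p / u \<le> q / v"
  using assms by (simp add: divide_simps)

lemma poisson_interval:
  assumes h: "0 < h" and ab: "a \<le> (b::real)"
  shows "has_bochner_integral lborel (\<lambda>x. indicat_real {a..b} x * (pker h (x - z)))
    (2 * (arctan ((b - z) / h) - arctan ((a - z) / h)))"
proof -
  let ?K = "\<lambda>x. pker h (x - z)"
  have pos: "h\<^sup>2 + (x - z)\<^sup>2 > 0" for x using h by (simp add: add_pos_nonneg)
  have cont: "continuous_on {a..b} ?K"
    by (intro continuous_intros) (metis less_irrefl pos)
  have der: "((\<lambda>x. 2 * arctan ((x - z) / h)) has_vector_derivative ?K x) (at x within {a..b})" for x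
  proof -
    have "((\<lambda>x. 2 * arctan ((x - z) / h)) has_real_derivative 2 * (inverse (1 + ((x - z) / h)\<^sup>2) * (1 / h))) (at x within {a..b})"
      using h by (auto intro!: derivative_eq_intros)
    also have "2 * (inverse (1 + ((x - z) / h)\<^sup>2) * (1 / h)) = ?K x"
    proof -
      have "1 + ((x - z) / h)\<^sup>2 = (h\<^sup>2 + (x - z)\<^sup>2) / h\<^sup>2"
        using h by (simp add: power_divide add_divide_distrib)
      then show ?thesis using h by (simp add: power2_eq_square)
    qed
    finally show ?thesis by (simp add: has_real_derivative_iff_has_vector_derivative)
  qed
  have "integrable lborel (\<lambda>x. indicat_real {a..b} x *\<^sub>R ?K x)"
    using borel_integrable_atLeastAtMost'[OF cont] by (simp add: set_integrable_def)
  moreover have "(LINT x|lborel. indicat_real {a..b} x *\<^sub>R ?K x) = 2 * arctan ((b - z) / h) - 2 * arctan ((a - z) / h)"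
    by (rule integral_FTC_atLeastAtMost[OF ab der cont])
  ultimately show ?thesis by (simp add: has_bochner_integral_iff)
qed

text \<open>\<open>2 * pi\<close> times the harmonic measure of \<open>{a..b}\<close> seen from the point \<open>z\<close> at height \<open>h\<close>.\<close>

definition hmeas :: "real \<Rightarrow> real \<Rightarrow> real \<Rightarrow> real \<Rightarrow> real" where
  "hmeas a b h z = 2 * (arctan ((b - z) / h) - arctan ((a - z) / h))"

lemma hmeas_nonneg:
  assumes "0 < h" "a \<le> b" shows "0 \<le> hmeas a b h z"
  using assms by (simp add: hmeas_def arctan_le_iff divide_right_mono)

text \<open>A majorant uniform in \<open>h \<le> 1\<close> with the decay of a fixed Poisson kernel,
  so that its product with a square integrable function is integrable. Near the interval the total
  mass \<open>2 * pi\<close> is bound enough; far from it the kernel itself is small.\<close>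

lemma hmeas_le:
  assumes h: "0 < h" "h \<le> 1" and ab: "a \<le> b"
  defines "R \<equiv> max \<bar>a\<bar> \<bar>b\<bar>"
  shows "hmeas a b h z \<le> (2 * pi * (1 + (2 * R + 1)\<^sup>2) + 16 * (b - a)) / (1 + z\<^sup>2)"
proof (cases "\<bar>z\<bar> \<le> 2 * R + 1")
  case True
  have "z\<^sup>2 \<le> (2 * R + 1)\<^sup>2" using True by (intro power2_le_iff_abs_le[THEN iffD2]) (auto simp: R_def)
  then have le: "2 * pi * (1 + z\<^sup>2) \<le> 2 * pi * (1 + (2 * R + 1)\<^sup>2)"
    by (intro mult_left_mono) auto
  have "hmeas a b h z \<le> 2 * pi"
    using arctan_bounded[of "(b - z) / h"] arctan_bounded[of "(a - z) / h"] by (simp add: hmeas_def)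
  then have "hmeas a b h z * (1 + z\<^sup>2) \<le> 2 * pi * (1 + z\<^sup>2)" by (rule mult_right_mono) simp
  from order_trans[OF this le]
  have "hmeas a b h z * (1 + z\<^sup>2) \<le> 2 * pi * (1 + (2 * R + 1)\<^sup>2) + 16 * (b - a)"
    using ab by (intro add_increasing2) auto
  then show ?thesis by (subst pos_le_divide_eq) (auto intro: add_pos_nonneg)
next
  case False
  have zR: "1 \<le> \<bar>z\<bar>" "2 * R \<le> \<bar>z\<bar>" using False by (auto simp: R_def)
  have z2: "1 \<le> z\<^sup>2" using zR by (metis abs_ge_zero one_le_power power2_abs)
  have "hmeas a b h z = (LINT x|lborel. indicat_real {a..b} x * (pker h (x - z)))"
    using poisson_interval[OF h(1) ab, of z] by (simp add: has_bochner_integral_iff hmeas_def)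
  also have "\<dots> \<le> (LINT x|lborel. indicat_real {a..b} x * (16 / (1 + z\<^sup>2)))"
  proof (rule integral_mono)
    show "integrable lborel (\<lambda>x. indicat_real {a..b} x * (pker h (x - z)))"
      using poisson_interval[OF h(1) ab, of z] by (simp add: has_bochner_integral_iff)
    show "integrable lborel (\<lambda>x. indicat_real {a..b} x * (16 / (1 + z\<^sup>2)))"
      by (intro integrable_mult_left) (rule integrable_indicator_Icc)
    fix x :: real
    have "pker h (x - z) \<le> 16 / (1 + z\<^sup>2)" if x: "x \<in> {a..b}"
    proof -
      have "\<bar>x\<bar> \<le> R" using x by (auto simp: R_def)
      \<comment> \<open>Far out, \<open>1 + z\<^sup>2\<close> is at most
        \<open>2 * z\<^sup>2\<close> and hence at most 8 times the squared distance to
        \<open>x\<close>; the factor 2 of the kernel makes this 16.\<close>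
      then have "\<bar>z\<bar> / 2 \<le> \<bar>x - z\<bar>" using zR by linarith
      then have "(\<bar>z\<bar> / 2)\<^sup>2 \<le> \<bar>x - z\<bar>\<^sup>2" by (intro power_mono) auto
      then have le: "1 + z\<^sup>2 \<le> 8 * (h\<^sup>2 + (x - z)\<^sup>2)" using z2 by (simp add: power_divide) (use zero_le_power2[of h] in linarith)
      have "2 * h * (1 + z\<^sup>2) \<le> 2 * (1 + z\<^sup>2)" using h by (intro mult_right_mono) auto
      also have "\<dots> \<le> 2 * (8 * (h\<^sup>2 + (x - z)\<^sup>2))" by (intro mult_left_mono le) simp
      finally have "2 * h * (1 + z\<^sup>2) \<le> 16 * (h\<^sup>2 + (x - z)\<^sup>2)" by simp
      then show ?thesis using h by (intro divide_le_divide_cross) (auto simp: add_pos_nonneg)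
    qed
    then show "indicat_real {a..b} x * (pker h (x - z)) \<le> indicat_real {a..b} x * (16 / (1 + z\<^sup>2))"
      by (auto split: split_indicator)
  qed
  also have "\<dots> = 16 * (b - a) / (1 + z\<^sup>2)"
    using ab by simp
  also have "\<dots> \<le> (2 * pi * (1 + (2 * R + 1)\<^sup>2) + 16 * (b - a)) / (1 + z\<^sup>2)"
    by (intro divide_right_mono) auto
  finally show ?thesis .
qed

text \<open>Both arctangents tend to \<open>pi / 2\<close> with the sign of their argument, and
  these cancel unless \<open>z\<close> lies between the endpoints. At an endpoint the limit would be
  \<open>pi\<close>, half of the mass.\<close>

lemma hmeas_tendsto:
  assumes h: "X \<longlonglongrightarrow> 0" "\<And>n. X n > 0" and ab: "a < b" and z: "z \<noteq> a" "z \<noteq> b"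
  shows "(\<lambda>n. hmeas a b (X n) z) \<longlonglongrightarrow> 2 * pi * indicat_real {a..b} z"
proof -
  have lim: "(\<lambda>n. arctan (c / X n)) \<longlonglongrightarrow> sgn c * (pi / 2)" if "c \<noteq> 0" for c
  proof -
    have inv: "filterlim (\<lambda>n. inverse (X n)) at_top sequentially"
      using h by (intro filterlim_compose[OF filterlim_inverse_at_top_right] tendsto_imp_filterlim_at_right) auto
    show ?thesis
    proof (cases "c > 0")
      case True
      have "filterlim (\<lambda>n. c * inverse (X n)) at_top sequentially"
        by (rule filterlim_tendsto_pos_mult_at_top[OF tendsto_const True inv])
      from filterlim_compose[OF tendsto_arctan_at_top this] True show ?thesis by (simp add: field_simps)
    next
      case False
      then have c: "c < 0" using that by simp
      have "filterlim (\<lambda>n. c * inverse (X n)) at_bot sequentially"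
        by (rule filterlim_tendsto_neg_mult_at_bot[OF tendsto_const c inv])
      from filterlim_compose[OF tendsto_arctan_at_bot this] c show ?thesis by (simp add: field_simps)
    qed
  qed
  have "(\<lambda>n. hmeas a b (X n) z) \<longlonglongrightarrow> 2 * (sgn (b - z) * (pi / 2) - sgn (a - z) * (pi / 2))"
    unfolding hmeas_def using z by (intro tendsto_intros lim) auto
  then show ?thesis using z ab by (auto simp: sgn_if split: if_splits split_indicator)
qed

text \<open>Tested against an interval, the extension becomes \<open>f\<close> tested against an
  explicit function whose limit is known.\<close>

lemma integral_pext_interval:
  assumes f: "square_integrable f" and F: "is_fourier_L2 f F" and h: "h > 0" and ab: "a \<le> b"
  shows "(LINT x|lborel. indicat_real {a..b} x *\<^sub>R pext F x h) = (LINT z|lborel. f z * of_real (hmeas a b h z))"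
proof -
  note [measurable] = square_integrable_measurable[OF f]
  let ?K = "\<lambda>x z. pker h (x - z)"
  define R where "R = max \<bar>a\<bar> \<bar>b\<bar>"
  \<comment> \<open>From \<open>1 + z\<^sup>2 \<le> (1 + 2 * R\<^sup>2) + 2 * (x -
    z)\<^sup>2\<close>, each part being compared with \<open>h\<^sup>2 + (x - z)\<^sup>2\<close>.
    Dependence on \<open>h\<close> is harmless, as \<open>h\<close> is fixed while the integrals are
    exchanged.\<close>
  define C where "C = h * ((1 + 2 * R\<^sup>2) / h\<^sup>2 + 2)"
  have K_le: "?K x z \<le> C * (pker 1 (0 - z))" if "x \<in> {a..b}" for x z
  proof -
    have "\<bar>x\<bar> \<le> R" using that by (auto simp: R_def)
    then have "x\<^sup>2 \<le> R\<^sup>2" by (metis abs_ge_zero power2_abs power_mono)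
    moreover have "z\<^sup>2 \<le> 2 * x\<^sup>2 + 2 * (x - z)\<^sup>2"
      using zero_le_power2[of "2 * x - z"] by (simp add: power2_eq_square algebra_simps)
    ultimately have "1 + z\<^sup>2 \<le> (1 + 2 * R\<^sup>2) + 2 * (x - z)\<^sup>2" by linarith
    also have "\<dots> \<le> ((1 + 2 * R\<^sup>2) / h\<^sup>2 + 2) * (h\<^sup>2 + (x - z)\<^sup>2)"
    proof -
      have "0 \<le> (1 + 2 * R\<^sup>2) / h\<^sup>2 * (x - z)\<^sup>2 + 2 * h\<^sup>2" by simp
      moreover have "(1 + 2 * R\<^sup>2) / h\<^sup>2 * h\<^sup>2 = 1 + 2 * R\<^sup>2" using h by simp
      ultimately show ?thesis unfolding distrib_left distrib_right by linarith
    qed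
    finally have "2 * h * (1 + z\<^sup>2) \<le> 2 * h * (((1 + 2 * R\<^sup>2) / h\<^sup>2 + 2) * (h\<^sup>2 + (x - z)\<^sup>2))"
      using h by (intro mult_left_mono) auto
    then have le: "2 * h * (1 + z\<^sup>2) \<le> 2 * C * (h\<^sup>2 + (x - z)\<^sup>2)" by (simp only: C_def mult_ac)
    have pos: "h\<^sup>2 + (x - z)\<^sup>2 > 0" "1 + z\<^sup>2 > 0" using h by (auto simp: add_pos_nonneg)
    then have "?K x z \<le> 2 * C / (1 + z\<^sup>2)"
      using le by (intro divide_le_divide_cross)
    then show ?thesis by (simp add: mult.commute)
  qed
  have C: "0 \<le> C" using h by (simp add: C_def)
  have "(LINT x|lborel. indicat_real {a..b} x *\<^sub>R pext F x h) =
    (LINT x|lborel. LINT z|lborel. indicat_real {a..b} x *\<^sub>R (f z * of_real (?K x z)))"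
    by (simp add: pext_eq_poisson[OF f F h])
  also have "\<dots> = (LINT z|lborel. LINT x|lborel. indicat_real {a..b} x *\<^sub>R (f z * of_real (?K x z)))"
  proof (rule lborel_pair.Fubini_integral[symmetric],
      rule lborel_pair.integrable_product_bound[where f="indicat_real {a..b}" and g="\<lambda>z. C * cmod (f z * of_real (pker 1 (0 - z)))"])
    show "integrable lborel (indicat_real {a..b})"
      by (rule integrable_indicator_Icc)
    show "integrable lborel (\<lambda>z. C * cmod (f z * of_real (pker 1 (0 - z))))"
      by (intro integrable_mult_right integrable_norm square_integrable_mult f square_integrable_poisson) simp
    show "(\<lambda>(x, z). indicat_real {a..b} x *\<^sub>R (f z * of_real (?K x z))) \<in> borel_measurable (lborel \<Otimes>\<^sub>M lborel)"
      by measurable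
    fix x z
    show "cmod (indicat_real {a..b} x *\<^sub>R (f z * of_real (?K x z))) \<le> indicat_real {a..b} x * (C * cmod (f z * of_real (pker 1 (0 - z))))"
    proof (cases "x \<in> {a..b}")
      case True
      have "0 \<le> ?K x z" using h by simp
      then have "cmod (f z * of_real (?K x z)) = cmod (f z) * ?K x z" by (simp only: norm_mult norm_of_real abs_of_nonneg)
      also have "\<dots> \<le> cmod (f z) * (C * (pker 1 (0 - z)))" by (intro mult_left_mono K_le True) auto
      also have "\<dots> = C * cmod (f z * of_real (pker 1 (0 - z)))"
        by (simp only: norm_mult norm_of_real) simp
      finally show ?thesis using True by simp
    qed simp
  qed
  also have "\<dots> = (LINT z|lborel. f z * of_real (hmeas a b h z))"
  proof (intro Bochner_Integration.integral_cong refl)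
    fix z
    have "(LINT x|lborel. indicat_real {a..b} x *\<^sub>R (f z * of_real (?K x z)))
      = (LINT x|lborel. f z * of_real (indicat_real {a..b} x * ?K x z))"
      by (intro Bochner_Integration.integral_cong refl) (auto split: split_indicator)
    also have "\<dots> = f z * of_real (LINT x|lborel. indicat_real {a..b} x * ?K x z)"
      by (simp only: integral_mult_right_zero integral_complex_of_real)
    also have "(LINT x|lborel. indicat_real {a..b} x * ?K x z) = hmeas a b h z"
      using poisson_interval[OF h ab, of z] by (simp add: has_bochner_integral_iff hmeas_def)
    finally show "(LINT x|lborel. indicat_real {a..b} x *\<^sub>R (f z * of_real (?K x z))) = f z * of_real (hmeas a b h z)" .
  qed
  finally show ?thesis .
qed

text \<open>Lebesgue's differentiation theorem: outside a negligible set \<open>D x\<close> is the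
  limit of averages over short intervals starting at \<open>x\<close>, and these all vanish.\<close>

lemma AE_zero_if_interval_integrals_zero:
  fixes D :: "real \<Rightarrow> complex"
  assumes int: "\<And>a b. a < b \<Longrightarrow> integrable lborel (\<lambda>x. indicat_real {a..b} x *\<^sub>R D x)"
    and zero: "\<And>a b. a < b \<Longrightarrow> (LINT x|lborel. indicat_real {a..b} x *\<^sub>R D x) = 0"
  shows "AE x in lborel. D x = 0"
proof -
  have si: "set_integrable lborel {a..b} D" if "a < b" for a b
    using int[OF that] by (simp add: set_integrable_def)
  have "D integrable_on cbox a b" for a b
  proof (cases "a < b")
    case True
    then show ?thesis using set_borel_integral_eq_integral(1)[OF si] by simp
  next
    case False
    then have "negligible (cbox a b)" by (cases "a = b") auto
    then show ?thesis by (rule integrable_negligible)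
  qed
  from integrable_ccontinuous_explicit[of D, OF this]
  obtain N where N: "negligible N" "\<And>x e. x \<notin> N \<Longrightarrow> 0 < e \<Longrightarrow>
     \<exists>d>0. \<forall>h. 0 < h \<and> h < d \<longrightarrow> norm (integral (cbox x (x + h *\<^sub>R One)) D /\<^sub>R h ^ DIM(real) - D x) < e"
    by blast
  have "D x = 0" if xN: "x \<notin> N" for x
  proof (rule ccontr)
    assume "D x \<noteq> 0"
    then obtain d where d: "d > 0" "\<And>h. 0 < h \<and> h < d \<Longrightarrow> norm (integral (cbox x (x + h *\<^sub>R One)) D /\<^sub>R h ^ DIM(real) - D x) < norm (D x)"
      using N(2)[OF xN, of "norm (D x)"] by auto
    have "integral {x..x + d/2} D = 0"
      using set_borel_integral_eq_integral(2)[OF si[of x "x + d/2"]] zero[of x "x + d/2"] d(1)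
      by (simp add: set_lebesgue_integral_def)
    with d(2)[of "d/2"] d(1) show False by simp
  qed
  then have "AE x in lebesgue. D x = 0"
    using N(1) by (intro AE_I'[of N]) (auto simp: negligible_iff_null_sets)
  then show ?thesis by (simp add: AE_completion_iff)
qed

text \<open>Only the value of the limit is at stake. Its integral over an interval is computed
  twice, by dominated convergence with the majorant \<open>S\<close> and through harmonic measure;
  comparing the two for all intervals determines the limit.\<close>

lemma pext_AE_tendsto:
  assumes f: "square_integrable f" and F: "is_fourier_L2 f F"
    and lim: "AE x in lborel. \<exists>L. ((\<lambda>h. pext F x h) \<longlongrightarrow> L) (at_right 0)"
    and S: "integrable lborel S" "AE x in lborel. \<forall>h. 0 < h \<and> h \<le> 1 \<longrightarrow> cmod (pext F x h - pext F x 1) \<le> c + S x"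
  shows "AE x in lborel. ((\<lambda>h. pext F x h) \<longlongrightarrow> of_real (2 * pi) * f x) (at_right 0)"
proof -
  have sF: "square_integrable F" using F by (simp add: is_fourier_L2_iff)
  note [measurable] = square_integrable_measurable[OF f] square_integrable_measurable[OF sF] borel_measurable_integrable[OF S(1)]
  have eF: "exp_integrable F" by (rule square_integrable_exp_integrable[OF sF])
  define X where "X = (\<lambda>n. 1 / real (Suc n))"
  have X: "X \<longlonglongrightarrow> 0" "\<And>n. 0 < X n" "\<And>n. X n \<le> 1" unfolding X_def by real_asymp auto
  have Xr: "filterlim X (at_right 0) sequentially"
    using X by (intro tendsto_imp_filterlim_at_right) auto
  \<comment> \<open>A limit along a sequence, so that measurability comes for free.\<close>
  define L where "L = (\<lambda>x. lim (\<lambda>n. pext F x (X n)))"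
  have [measurable]: "L \<in> borel_measurable lborel" unfolding L_def by measurable
  have L: "AE x in lborel. ((\<lambda>h. pext F x h) \<longlongrightarrow> L x) (at_right 0)"
    using lim
  proof eventually_elim
    case (elim x)
    then obtain l where l: "((\<lambda>h. pext F x h) \<longlongrightarrow> l) (at_right 0)" by blast
    have "L x = l" unfolding L_def by (rule limI, rule filterlim_compose[OF l Xr])
    with l show ?case by simp
  qed
  have Lseq: "AE x in lborel. (\<lambda>n. pext F x (X n)) \<longlonglongrightarrow> L x"
    using L by eventually_elim (rule filterlim_compose[OF _ Xr])
  define C where "C = (LINT \<xi>|lborel. damp 1 \<xi> * cmod (F \<xi>))"
  have key: "integrable lborel (\<lambda>x. indicat_real {a..b} x *\<^sub>R L x) \<and>
      (LINT x|lborel. indicat_real {a..b} x *\<^sub>R L x) = of_real (2 * pi) * (LINT x|lborel. indicat_real {a..b} x *\<^sub>R f x)"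
    if ab: "a < b" for a b
  proof -
    let ?I = "indicat_real {a..b}"
    have iI: "integrable lborel ?I" by (rule integrable_indicator_Icc)
    \<comment> \<open>At height 1 the extension is bounded by \<open>C\<close> uniformly in
      \<open>x\<close>; cut off to the interval, the constants are integrable.\<close>
    let ?w = "\<lambda>x. (C + c) * ?I x + \<bar>S x\<bar>"
    have w: "integrable lborel ?w"
      by (intro Bochner_Integration.integrable_add integrable_mult_right iI integrable_abs S)
    have le: "AE x in lborel. norm (?I x *\<^sub>R pext F x (X n)) \<le> ?w x" for n
      using S(2)
    proof eventually_elim
      case (elim x)
      then have "cmod (pext F x (X n) - pext F x 1) \<le> c + S x" using X by auto
      moreover have "cmod (pext F x 1) \<le> C" unfolding C_def by (rule pext_bound[OF eF]) simp
      moreover have "cmod (pext F x (X n)) \<le> cmod (pext F x (X n) - pext F x 1) + cmod (pext F x 1)"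
        using norm_triangle_sub by (metis add.commute)
      ultimately have "cmod (pext F x (X n)) \<le> C + c + \<bar>S x\<bar>" by linarith
      then show ?case by (auto split: split_indicator)
    qed
    have ptw: "AE x in lborel. (\<lambda>n. ?I x *\<^sub>R pext F x (X n)) \<longlonglongrightarrow> ?I x *\<^sub>R L x"
      using Lseq by eventually_elim (intro tendsto_intros)
    have m: "(\<lambda>x. ?I x *\<^sub>R L x) \<in> borel_measurable lborel"
      "(\<lambda>x. ?I x *\<^sub>R pext F x (X n)) \<in> borel_measurable lborel" for n by measurable
    note dom = m w ptw le
    have lim1: "(\<lambda>n. LINT x|lborel. ?I x *\<^sub>R pext F x (X n)) \<longlonglongrightarrow> (LINT x|lborel. ?I x *\<^sub>R L x)"
      by (rule integral_dominated_convergence[OF dom])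
    have int: "integrable lborel (\<lambda>x. ?I x *\<^sub>R L x)"
      by (rule integrable_dominated_convergence[OF dom])
    define c' where "c' = 2 * pi * (1 + (2 * max \<bar>a\<bar> \<bar>b\<bar> + 1)\<^sup>2) + 16 * (b - a)"
    have "(\<lambda>n. LINT z|lborel. f z * of_real (hmeas a b (X n) z)) \<longlonglongrightarrow> (LINT z|lborel. f z * of_real (2 * pi * ?I z))"
    proof (rule integral_dominated_convergence[where w="\<lambda>z. c' / 2 * cmod (f z * of_real (pker 1 (0 - z)))"])
      show "integrable lborel (\<lambda>z. c' / 2 * cmod (f z * of_real (pker 1 (0 - z))))"
        by (intro integrable_mult_right integrable_norm square_integrable_mult f square_integrable_poisson) simp
      show "AE z in lborel. (\<lambda>n. f z * of_real (hmeas a b (X n) z)) \<longlonglongrightarrow> f z * of_real (2 * pi * ?I z)"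
        using AE_lborel_singleton[of a] AE_lborel_singleton[of b]
      proof eventually_elim
        case (elim z)
        have "(\<lambda>n. hmeas a b (X n) z) \<longlonglongrightarrow> 2 * pi * ?I z"
          by (rule hmeas_tendsto[OF X(1,2) ab elim])
        then show ?case by (intro tendsto_intros)
      qed
      show "AE z in lborel. norm (f z * of_real (hmeas a b (X n) z)) \<le> c' / 2 * cmod (f z * of_real (pker 1 (0 - z)))" for n
      proof (rule AE_I2)
        fix z
        have "norm (f z * of_real (hmeas a b (X n) z)) = cmod (f z) * hmeas a b (X n) z"
          using hmeas_nonneg[of "X n" a b z] X ab by (simp add: norm_mult)
        also have "\<dots> \<le> cmod (f z) * (c' / (1 + z\<^sup>2))"
          unfolding c'_def using ab X by (intro mult_left_mono hmeas_le) auto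
        also have "\<dots> = c' / 2 * cmod (f z * of_real (pker 1 (0 - z)))"
          by (simp only: norm_mult norm_of_real) simp
        finally show "norm (f z * of_real (hmeas a b (X n) z)) \<le> \<dots>" .
      qed
      show "(\<lambda>z. f z * of_real (2 * pi * ?I z)) \<in> borel_measurable lborel" by measurable
      show "(\<lambda>z. f z * of_real (hmeas a b (X n) z)) \<in> borel_measurable lborel" for n
        unfolding hmeas_def by measurable
    qed
    then have lim2: "(\<lambda>n. LINT x|lborel. ?I x *\<^sub>R pext F x (X n)) \<longlonglongrightarrow> (LINT z|lborel. f z * of_real (2 * pi * ?I z))"
      using ab X by (simp add: integral_pext_interval[OF f F])
    have "(LINT z|lborel. f z * of_real (2 * pi * ?I z)) = (LINT z|lborel. of_real (2 * pi) * (?I z *\<^sub>R f z))"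
      by (intro Bochner_Integration.integral_cong refl) (auto split: split_indicator)
    also have "\<dots> = of_real (2 * pi) * (LINT x|lborel. ?I x *\<^sub>R f x)" by (rule integral_mult_right_zero)
    finally show ?thesis using int LIMSEQ_unique[OF lim1 lim2] by simp
  qed
  have "AE x in lborel. L x - of_real (2 * pi) * f x = 0"
  proof (rule AE_zero_if_interval_integrals_zero)
    fix a b :: real assume ab: "a < b"
    have eq: "indicat_real {a..b} x *\<^sub>R (L x - of_real (2 * pi) * f x) =
       indicat_real {a..b} x *\<^sub>R L x - of_real (2 * pi) * (indicat_real {a..b} x *\<^sub>R f x)" for x
      by (simp add: scaleR_diff_right)
    have i2: "integrable lborel (\<lambda>x. of_real (2 * pi) * (indicat_real {a..b} x *\<^sub>R f x))"
      by (intro integrable_mult_right integrable_restrict_Icc f)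
    show "integrable lborel (\<lambda>x. indicat_real {a..b} x *\<^sub>R (L x - of_real (2 * pi) * f x))"
      unfolding eq using key[OF ab] i2 by (intro Bochner_Integration.integrable_diff) auto
    show "(LINT x|lborel. indicat_real {a..b} x *\<^sub>R (L x - of_real (2 * pi) * f x)) = 0"
      unfolding eq Bochner_Integration.integral_diff[OF conjunct1[OF key[OF ab]] i2]
        integral_mult_right_zero conjunct2[OF key[OF ab]] by (rule diff_self)
  qed
  with L show ?thesis by eventually_elim simp
qed

section \<open>Convergence above the threshold\<close>

lemma square_integrable_restrict:
  assumes H: "square_integrable H" and A: "A \<in> sets borel"
  shows "square_integrable (\<lambda>\<xi>. of_real (indicat_real A \<xi>) * H \<xi>)"
proof (rule square_integrable_dominated[OF _ H])
  note [measurable] = square_integrable_measurable[OF H] A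
  show "(\<lambda>\<xi>. of_real (indicat_real A \<xi>) * H \<xi>) \<in> borel_measurable lborel" by measurable
qed (auto split: split_indicator)

lemma weighted_integrable_restrict:
  assumes "square_integrable H" and [measurable]: "A \<in> sets borel"
    and W: "integrable lborel (wsq s H)"
  shows "integrable lborel (\<lambda>\<xi>. (1 + \<xi>\<^sup>2) powr s * (cmod (of_real (indicat_real A \<xi>) * H \<xi>))\<^sup>2)"
proof (rule Bochner_Integration.integrable_bound[OF W])
  note [measurable] = square_integrable_measurable[OF assms(1)]
  show "(\<lambda>\<xi>. (1 + \<xi>\<^sup>2) powr s * (cmod (of_real (indicat_real A \<xi>) * H \<xi>))\<^sup>2) \<in> borel_measurable lborel"
    by measurable
qed (auto split: split_indicator)

lemma weighted_integrable_mono: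
  assumes "square_integrable H" "s' \<le> s"
    and W: "integrable lborel (wsq s H)"
  shows "integrable lborel (wsq s' H)"
proof (rule Bochner_Integration.integrable_bound[OF W])
  note [measurable] = square_integrable_measurable[OF assms(1)]
  show "(wsq s' H) \<in> borel_measurable lborel" by measurable
  have "(1 + \<xi>\<^sup>2) powr s' \<le> (1 + \<xi>\<^sup>2) powr s" for \<xi> :: real
    using assms(2) by (intro powr_mono) auto
  then show "AE \<xi> in lborel. norm (wsq s' H \<xi>) \<le> norm (wsq s H \<xi>)"
    by (intro AE_I2) (simp add: mult_right_mono)
qed

lemma P_op_eq:
  "P_op 1 \<gamma> f y t = of_real (1 / (2 * pi)) *
    (LINT \<xi>|lborel. cis (y * \<xi> + t * \<bar>\<xi>\<bar>) * of_real (damp (t powr \<gamma>) \<xi>) * fourier_hat f \<xi>)"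
  unfolding P_op_def cis_conv_exp by simp

text \<open>For \<open>m = 1\<close> the positive and the negative frequencies travel rigidly in opposite directions.\<close>

lemma P_op_split:
  assumes F: "square_integrable (fourier_hat f)" and t: "0 < t"
  defines "Fp \<equiv> \<lambda>\<xi>. of_real (indicat_real {0<..} \<xi>) * fourier_hat f \<xi>"
    and "Fm \<equiv> \<lambda>\<xi>. of_real (indicat_real {..0} \<xi>) * fourier_hat f \<xi>"
  shows "P_op 1 \<gamma> f y t = of_real (1 / (2 * pi)) * (pext Fp (y + t) (t powr \<gamma>) + pext Fm (y - t) (t powr \<gamma>))"
proof -
  have "exp_integrable Fp" "exp_integrable Fm"
    unfolding Fp_def Fm_def by (intro square_integrable_exp_integrable square_integrable_restrict F; simp)+
  then have "pext Fp (y + t) (t powr \<gamma>) + pext Fm (y - t) (t powr \<gamma>) =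
     (LINT \<xi>|lborel. cis ((y + t) * \<xi>) * of_real (damp (t powr \<gamma>) \<xi>) * Fp \<xi>
        + cis ((y - t) * \<xi>) * of_real (damp (t powr \<gamma>) \<xi>) * Fm \<xi>)"
    unfolding pext_def using t
    by (intro Bochner_Integration.integral_add[symmetric] exp_integrable_pext) auto
  also have "\<dots> = (LINT \<xi>|lborel. cis (y * \<xi> + t * \<bar>\<xi>\<bar>) * of_real (damp (t powr \<gamma>) \<xi>) * fourier_hat f \<xi>)"
    by (intro Bochner_Integration.integral_cong refl)
       (auto simp: Fp_def Fm_def algebra_simps split: split_indicator)
  finally show ?thesis unfolding P_op_eq by simp
qed

lemma tendsto_along_curve:
  assumes L: "\<forall>e>0. \<exists>d>0. \<forall>h y. 0 < h \<and> h < d \<and> \<bar>y - x\<bar> \<le> A * h powr \<beta> \<longrightarrow> cmod (pext H y h - L) < e"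
    and h: "(h \<longlongrightarrow> 0) F" "\<forall>\<^sub>F t in F. 0 < h t \<and> \<bar>y t - x\<bar> \<le> A * h t powr \<beta>"
  shows "((\<lambda>t. pext H (y t) (h t)) \<longlongrightarrow> L) F"
proof (rule tendstoI)
  fix e :: real assume "e > 0"
  with L obtain d where d: "d > 0" "\<And>h y. 0 < h \<and> h < d \<and> \<bar>y - x\<bar> \<le> A * h powr \<beta> \<Longrightarrow> cmod (pext H y h - L) < e"
    by blast
  from h(2) order_tendstoD(2)[OF h(1) d(1)]
  show "\<forall>\<^sub>F t in F. dist (pext H (y t) (h t)) L < e"
    by eventually_elim (use d(2) in \<open>auto simp: dist_norm\<close>)
qed

text \<open>The halves of the spectrum converge to \<open>Lp\<close> and \<open>Lm\<close>, which in
  general are not determined by \<open>f x\<close> alone. Their sum is: on the vertical line above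
  \<open>x\<close> the two shifts are absent, and the halves recombine to the extension of
  \<open>f\<close>.\<close>

lemma convergence_above_threshold:
  fixes \<gamma> \<alpha> s :: real
  assumes \<gamma>: "0 < \<gamma>" and \<alpha>: "0 < \<alpha>" "\<alpha> \<le> 1" and adm: "admissible_curve \<alpha> \<Gamma>"
    and s: "s > 1/2 * max (1 - \<alpha> / \<gamma>) 0" and f: "in_sobolev s f"
  shows "converges_ae 1 \<gamma> \<Gamma> f"
proof -
  have sf: "square_integrable f" using f by (simp add: in_sobolev_def)
  define F where "F = fourier_hat f"
  have F: "is_fourier_L2 f F" and W: "integrable lborel (wsq s F)"
    unfolding F_def by (fact in_sobolev_fourier_hat[OF f])+
  have sF: "square_integrable F" using F by (simp add: is_fourier_L2_iff)
  define Fp where "Fp = (\<lambda>\<xi>. of_real (indicat_real {0<..} \<xi>) * F \<xi>)"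
  define Fm where "Fm = (\<lambda>\<xi>. of_real (indicat_real {..0} \<xi>) * F \<xi>)"
  have Fpm: "square_integrable Fp" "square_integrable Fm"
    unfolding Fp_def Fm_def by (intro square_integrable_restrict sF; simp)+
  \<comment> \<open>The oscillation estimate wants \<beta> at most 1 and the weight bound wants the
    same of the smoothness. Lowering \<open>s\<close> to 1 keeps it above the threshold, which is
    below 1/2.\<close>
  define \<beta> where "\<beta> = min 1 (\<alpha> / \<gamma>)"
  define s' where "s' = min s 1"
  have \<beta>: "0 < \<beta>" "\<beta> \<le> 1" "\<beta> \<le> \<alpha> / \<gamma>" using \<gamma> \<alpha> by (auto simp: \<beta>_def)
  have s': "0 \<le> s'" "s' \<le> 1" "(1 - \<beta>) / 2 < s'" using s \<beta> by (auto simp: s'_def \<beta>_def)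
  have W': "integrable lborel (wsq s' F)"
    by (rule weighted_integrable_mono[OF sF _ W]) (simp add: s'_def)
  have Wpm: "integrable lborel (wsq s' Fp)"
    "integrable lborel (wsq s' Fm)"
    unfolding Fp_def Fm_def by (intro weighted_integrable_restrict sF W'; simp)+
  obtain C where C: "C > 0" "\<And>x t. t \<in> {-1..1} \<Longrightarrow> \<bar>\<Gamma> x t - \<Gamma> x 0\<bar> \<le> C * \<bar>t - 0\<bar> powr \<alpha>" and \<Gamma>0: "\<And>x. \<Gamma> x 0 = x"
    using adm unfolding admissible_curve_def by (metis atLeastAtMost_iff neg_le_0_iff_le zero_le_one)
  \<comment> \<open>\<open>C\<close> for the Hoelder motion of the curve and 1 for the drift
    \<open>t\<close>, which is at most \<open>t powr \<alpha>\<close>.\<close>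
  define A where "A = C + 1"
  have A: "0 \<le> A" using C by (simp add: A_def)
  have near: "\<bar>\<Gamma> x t + c * t - x\<bar> \<le> A * (t powr \<gamma>) powr \<beta>" if t: "0 < t" "t \<le> 1" and c: "\<bar>c\<bar> \<le> 1" for x t c
  proof -
    have "\<bar>\<Gamma> x t - x\<bar> \<le> C * t powr \<alpha>" using C(2)[of t x] t \<Gamma>0 by simp
    moreover have "\<bar>c * t\<bar> \<le> t" using t c by (simp add: abs_mult mult_left_le_one_le)
    moreover have "t \<le> t powr \<alpha>" using powr_mono'[of \<alpha> 1 t] t \<alpha> by simp
    ultimately have "\<bar>\<Gamma> x t + c * t - x\<bar> \<le> A * t powr \<alpha>" by (simp add: A_def algebra_simps)
    moreover have "t powr \<alpha> \<le> t powr (\<gamma> * \<beta>)"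
      using t \<beta>(3) \<gamma> by (intro powr_mono') (auto simp: field_simps)
    then have "A * t powr \<alpha> \<le> A * (t powr \<gamma>) powr \<beta>" using A by (simp add: powr_powr mult_left_mono)
    ultimately show ?thesis by linarith
  qed
  have ev: "\<forall>\<^sub>F t in at_right (0::real). 0 < t \<and> t \<le> 1"
    unfolding eventually_at_right_field by (intro exI[of _ 1]) auto
  have h: "((\<lambda>t. t powr \<gamma>) \<longlongrightarrow> 0) (at_right 0)"
  proof -
    have "((\<lambda>t. t powr \<gamma>) \<longlongrightarrow> 0 powr \<gamma>) (at_right 0)"
      using \<gamma> by (intro tendsto_intros) (auto simp: eventually_at_filter)
    then show ?thesis by simp
  qed
  let ?lim = "\<lambda>H x L. \<forall>e>0. \<exists>d>0. \<forall>h y. 0 < h \<and> h < d \<and> \<bar>y - x\<bar> \<le> A * h powr \<beta> \<longrightarrow> cmod (pext H y h - L) < e"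
  note T = tangential_limit(1)[OF _ _ s' \<beta>(1,2) A]
  have vertical: "((\<lambda>h. pext H x h) \<longlongrightarrow> L) (at_right 0)" if "?lim H x L" for H x L
    using that by (rule tendsto_along_curve) (use A in \<open>auto simp: eventually_at_right_field intro: exI[of _ 1]\<close>)
  have limF: "AE x in lborel. ((\<lambda>h. pext F x h) \<longlongrightarrow> of_real (2 * pi) * f x) (at_right 0)"
  proof -
    obtain S c where S: "integrable lborel S" "AE x in lborel. \<forall>h. 0 < h \<and> h \<le> 1 \<longrightarrow> cmod (pext F x h - pext F x 1) \<le> c + S x"
      using tangential_limit(2)[OF sF W' s' \<beta>(1,2) A] by blast
    have "AE x in lborel. \<exists>L. ((\<lambda>h. pext F x h) \<longlongrightarrow> L) (at_right 0)"
      using T[OF sF W'] by eventually_elim (use vertical in blast)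
    from pext_AE_tendsto[OF sf F this S] show ?thesis .
  qed
  have "AE x in lborel. ((\<lambda>t. P_op 1 \<gamma> f (\<Gamma> x t) t) \<longlongrightarrow> f x) (at_right 0)"
    using limF T[OF Fpm(1) Wpm(1)] T[OF Fpm(2) Wpm(2)]
  proof eventually_elim
    case (elim x)
    from elim obtain Lp Lm where Lp: "?lim Fp x Lp" and Lm: "?lim Fm x Lm" by blast
    have "((\<lambda>h. pext Fp x h + pext Fm x h) \<longlongrightarrow> Lp + Lm) (at_right 0)"
      by (intro tendsto_add vertical Lp Lm)
    moreover have "\<forall>\<^sub>F h in at_right 0. pext Fp x h + pext Fm x h = pext F x h"
      using ev
    proof eventually_elim
      case (elim h)
      have "pext Fp x h + pext Fm x h = (LINT \<xi>|lborel. cis (x * \<xi>) * of_real (damp h \<xi>) * Fp \<xi>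
          + cis (x * \<xi>) * of_real (damp h \<xi>) * Fm \<xi>)"
        unfolding pext_def using elim
        by (intro Bochner_Integration.integral_add[symmetric] exp_integrable_pext square_integrable_exp_integrable Fpm) auto
      also have "\<dots> = pext F x h"
        unfolding pext_def by (intro Bochner_Integration.integral_cong refl)
          (auto simp: Fp_def Fm_def split: split_indicator)
      finally show ?case .
    qed
    ultimately have "((\<lambda>h. pext F x h) \<longlongrightarrow> Lp + Lm) (at_right 0)"
      by (rule Lim_transform_eventually)
    from tendsto_unique[OF _ this elim(1)] have L: "Lp + Lm = of_real (2 * pi) * f x" by simp
    have p: "((\<lambda>t. pext Fp (\<Gamma> x t + t) (t powr \<gamma>)) \<longlongrightarrow> Lp) (at_right 0)"
      by (rule tendsto_along_curve[OF Lp h]) (use ev in eventually_elim, use near[of _ 1] in auto)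
    have m: "((\<lambda>t. pext Fm (\<Gamma> x t - t) (t powr \<gamma>)) \<longlongrightarrow> Lm) (at_right 0)"
      by (rule tendsto_along_curve[OF Lm h]) (use ev in eventually_elim, use near[of _ "-1"] in auto)
    have "((\<lambda>t. of_real (1 / (2 * pi)) * (pext Fp (\<Gamma> x t + t) (t powr \<gamma>) + pext Fm (\<Gamma> x t - t) (t powr \<gamma>))) \<longlongrightarrow>
        of_real (1 / (2 * pi)) * (Lp + Lm)) (at_right 0)"
      by (intro tendsto_intros p m)
    also have "of_real (1 / (2 * pi)) * (Lp + Lm) = f x" unfolding L by simp
    finally show ?case
    proof (rule Lim_transform_eventually)
      show "\<forall>\<^sub>F t in at_right 0. of_real (1 / (2 * pi)) * (pext Fp (\<Gamma> x t + t) (t powr \<gamma>) + pext Fm (\<Gamma> x t - t) (t powr \<gamma>)) = P_op 1 \<gamma> f (\<Gamma> x t) t"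
        using ev by eventually_elim (use P_op_split[of f] sF in \<open>simp add: F_def Fp_def Fm_def\<close>)
    qed
  qed
  then show ?thesis by (simp add: converges_ae_def)
qed

subsection \<open>Superpositions of bumps\<close>

lemma inverse_ft_bound:
  assumes G: "integrable lborel G" "square_integrable G"
  defines "g \<equiv> \<lambda>x. of_real (1 / (2 * pi)) * (LINT \<xi>|lborel. cis (x * \<xi>) * G \<xi>)"
  shows "square_integrable g" and "norm2 g \<le> norm2 G"
proof -
  have eq: "g x = of_real (1 / (2 * pi)) * ft G (- x)" for x
    by (simp add: g_def ft_def mult.commute)
  note P = plancherel_le[OF G]
  show "square_integrable g"
    unfolding eq by (intro square_integrable_cmult square_integrable_reflect P(1))
  have "norm2 g = (cmod (of_real (1 / (2 * pi))))\<^sup>2 * norm2 (\<lambda>x. ft G (- x))"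
    unfolding eq by (rule norm2_cmult)
  also have "norm2 (\<lambda>x. ft G (- x)) = norm2 (ft G)" by (rule norm2_reflect[OF P(1)])
  also have "(cmod (of_real (1 / (2 * pi))))\<^sup>2 * norm2 (ft G) \<le> (cmod (of_real (1 / (2 * pi))))\<^sup>2 * (2 * pi * norm2 G)"
    by (intro mult_left_mono P) auto
  also have "\<dots> = 1 / (2 * pi) * norm2 G"
    by (simp add: norm_divide power2_eq_square)
  also have "\<dots> \<le> 1 * norm2 G"
    using pi_gt3 by (intro mult_right_mono norm2_nonneg) (simp add: field_simps)
  finally show "norm2 g \<le> norm2 G" by simp
qed

text \<open>The defect of the truncated transform is bounded by the defect in Plancherel's identity.\<close>

lemma is_fourier_L2_inverse:
  assumes G: "integrable lborel G" "square_integrable G"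
  defines "g \<equiv> \<lambda>x. of_real (1 / (2 * pi)) * (LINT \<xi>|lborel. cis (x * \<xi>) * G \<xi>)"
  assumes eq: "norm2 G = 2 * pi * norm2 g"
  shows "is_fourier_L2 g G"
  unfolding is_fourier_L2_iff
proof (intro conjI G)
  have g: "square_integrable g" unfolding g_def by (rule inverse_ft_bound[OF G])
  note [measurable] = square_integrable_measurable[OF g] square_integrable_measurable[OF G(2)]
  \<comment> \<open>By Fubini's theorem the truncated transform is adjoint to the inverse transform
    that defines \<open>g\<close>, so the pairing returns the square of \<open>g\<close> on the
    truncation interval.\<close>
  have inner: "(LINT \<xi>|lborel. cnj (G \<xi>) * ft (trunc R g) \<xi>) = of_real (2 * pi * norm2 (trunc R g))" for R
  proof -
    have iT: "integrable lborel (trunc R g)" by (rule integrable_restrict_Icc[OF g])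
    have "(LINT \<xi>|lborel. cnj (G \<xi>) * ft (trunc R g) \<xi>) =
       (LINT \<xi>|lborel. LINT x|lborel. cnj (G \<xi>) * (cis (- (x * \<xi>)) * trunc R g x))"
      by (simp only: ft_def integral_mult_right_zero)
    also have "\<dots> = (LINT x|lborel. LINT \<xi>|lborel. cnj (G \<xi>) * (cis (- (x * \<xi>)) * trunc R g x))"
    proof (rule lborel_pair.Fubini_integral[symmetric],
        rule lborel_pair.integrable_product_bound[where f="\<lambda>\<xi>. cmod (G \<xi>)" and g="\<lambda>x. cmod (trunc R g x)"])
      show "(\<lambda>(\<xi>, x). cnj (G \<xi>) * (cis (- (x * \<xi>)) * trunc R g x)) \<in> borel_measurable (lborel \<Otimes>\<^sub>M lborel)"
        by measurable
      show "integrable lborel (\<lambda>\<xi>. cmod (G \<xi>))" "integrable lborel (\<lambda>x. cmod (trunc R g x))"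
        using G(1) iT by (auto simp del: norm_scaleR)
    qed (simp add: norm_mult)
    also have "\<dots> = (LINT x|lborel. complex_of_real (2 * pi * (cmod (trunc R g x))\<^sup>2))"
    proof (intro Bochner_Integration.integral_cong refl)
      fix x
      have "(LINT \<xi>|lborel. cnj (G \<xi>) * (cis (- (x * \<xi>)) * trunc R g x)) =
         trunc R g x * (LINT \<xi>|lborel. cnj (cis (x * \<xi>) * G \<xi>))"
        by (subst integral_mult_right_zero[symmetric]) (simp add: cis_cnj mult_ac)
      also have "(LINT \<xi>|lborel. cnj (cis (x * \<xi>) * G \<xi>)) = cnj (of_real (2 * pi) * g x)"
        by (simp only: Bochner_Integration.integral_cnj) (simp add: g_def)
      also have "trunc R g x * cnj (of_real (2 * pi) * g x) = complex_of_real (2 * pi * (cmod (trunc R g x))\<^sup>2)"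
        by (auto simp: complex_norm_square split: split_indicator simp del: of_real_power)
      finally show "(LINT \<xi>|lborel. cnj (G \<xi>) * (cis (- (x * \<xi>)) * trunc R g x)) = complex_of_real (2 * pi * (cmod (trunc R g x))\<^sup>2)" .
    qed
    also have "\<dots> = of_real (2 * pi * norm2 (trunc R g))"
      by (simp only: integral_complex_of_real norm2_def integral_mult_right_zero)
    finally show ?thesis .
  qed
  \<comment> \<open>When the square is expanded, the cross term is
    \<open>- 4 * pi * norm2 (trunc R g)\<close>, and Plancherel's inequality gives back at most half
    of it. By \<open>eq\<close> what remains tends to 0.\<close>
  have le: "norm2 (\<lambda>\<xi>. G \<xi> - ft (trunc R g) \<xi>) \<le> norm2 G - 2 * pi * norm2 (trunc R g)" for R
  proof -
    let ?T = "ft (trunc R g)"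
    have T: "square_integrable ?T" by (rule square_integrable_ft_trunc[OF g])
    have cG: "square_integrable (\<lambda>\<xi>. cnj (G \<xi>))"
      by (rule square_integrable_dominated[OF _ G(2)]) auto
    have iGT: "integrable lborel (\<lambda>\<xi>. cnj (G \<xi>) * ?T \<xi>)" by (rule square_integrable_mult[OF cG T])
    have pt: "(cmod (G \<xi> - ?T \<xi>))\<^sup>2 = (cmod (G \<xi>))\<^sup>2 + (cmod (?T \<xi>))\<^sup>2 - 2 * Re (cnj (G \<xi>) * ?T \<xi>)" for \<xi>
      unfolding cmod_power2 by (simp add: power2_eq_square algebra_simps)
    have I1: "integrable lborel (\<lambda>\<xi>. (cmod (G \<xi>))\<^sup>2 + (cmod (?T \<xi>))\<^sup>2)"
      using G(2) T by (auto simp: square_integrable_def)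
    have I2: "integrable lborel (\<lambda>\<xi>. 2 * Re (cnj (G \<xi>) * ?T \<xi>))"
      by (intro integrable_mult_right integrable_Re iGT)
    have "norm2 (\<lambda>\<xi>. G \<xi> - ?T \<xi>) = (LINT \<xi>|lborel. (cmod (G \<xi>))\<^sup>2 + (cmod (?T \<xi>))\<^sup>2)
        - (LINT \<xi>|lborel. 2 * Re (cnj (G \<xi>) * ?T \<xi>))"
      unfolding norm2_def pt by (rule Bochner_Integration.integral_diff[OF I1 I2])
    also have "(LINT \<xi>|lborel. (cmod (G \<xi>))\<^sup>2 + (cmod (?T \<xi>))\<^sup>2) = norm2 G + norm2 ?T"
      unfolding norm2_def using G(2) T
      by (intro Bochner_Integration.integral_add) (auto simp: square_integrable_def)
    also have "(LINT \<xi>|lborel. 2 * Re (cnj (G \<xi>) * ?T \<xi>)) = 2 * Re (LINT \<xi>|lborel. cnj (G \<xi>) * ?T \<xi>)"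
      by (simp only: integral_mult_right_zero integral_Re[OF iGT])
    finally have "norm2 (\<lambda>\<xi>. G \<xi> - ?T \<xi>) = norm2 G + norm2 ?T - 4 * pi * norm2 (trunc R g)"
      by (simp add: inner)
    moreover have "norm2 ?T \<le> 2 * pi * norm2 (trunc R g)"
      by (intro plancherel_le integrable_restrict_Icc square_integrable_trunc g)
    ultimately show ?thesis by simp
  qed
  have "((\<lambda>R. norm2 (trunc R g)) \<longlongrightarrow> norm2 g) at_top"
    unfolding norm2_def
  proof (rule integral_dominated_convergence_at_top[where w="\<lambda>x. (cmod (g x))\<^sup>2"])
    show "integrable lborel (\<lambda>x. (cmod (g x))\<^sup>2)" using g by (simp add: square_integrable_def)
    show "AE x in lborel. ((\<lambda>R. (cmod (trunc R g x))\<^sup>2) \<longlongrightarrow> (cmod (g x))\<^sup>2) at_top"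
    proof (rule AE_I2)
      fix x :: real
      have "\<forall>\<^sub>F R in at_top. (cmod (trunc R g x))\<^sup>2 = (cmod (g x))\<^sup>2"
        using eventually_ge_at_top[of "\<bar>x\<bar>"] by eventually_elim (auto simp: abs_le_iff)
      then show "((\<lambda>R. (cmod (trunc R g x))\<^sup>2) \<longlongrightarrow> (cmod (g x))\<^sup>2) at_top" by (rule tendsto_eventually)
    qed
  qed (auto split: split_indicator)
  then have "((\<lambda>R. norm2 G - 2 * pi * norm2 (trunc R g)) \<longlongrightarrow> norm2 G - 2 * pi * norm2 g) at_top"
    by (intro tendsto_intros)
  then have lim: "((\<lambda>R. norm2 G - 2 * pi * norm2 (trunc R g)) \<longlongrightarrow> 0) at_top" using eq by simp
  show "((\<lambda>R. norm2 (\<lambda>\<xi>. G \<xi> - ft (trunc R g) \<xi>)) \<longlongrightarrow> 0) at_top"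
    by (rule tendsto_sandwich[OF _ _ tendsto_const lim]) (auto intro!: always_eventually norm2_nonneg le)
qed

text \<open>Supported in the positive frequencies, so that the evolution is a single translated
  extension and further damping merges with the width \<open>h\<close>.\<close>

definition bump_hat :: "real \<Rightarrow> real \<Rightarrow> real \<Rightarrow> complex" where
  "bump_hat c h \<xi> = of_real (2 * pi) * (indicat_real {0<..} \<xi> *\<^sub>R (cis (- (c * \<xi>)) * of_real (exp (- (h * \<xi>)))))"

text \<open>Up to the factor \<open>\<i>\<close> this is the Cauchy kernel with pole
  \<open>c - \<i> * h\<close> in the lower half plane. Its real part is half a Poisson kernel, hence
  positive.\<close>

definition bump :: "real \<Rightarrow> real \<Rightarrow> real \<Rightarrow> complex" where
  "bump c h x = 1 / (of_real h - \<i> * of_real (x - c))"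

lemma bump_hat_measurable [measurable]: "bump_hat c h \<in> borel_measurable lborel"
  unfolding bump_hat_def by measurable

lemma has_bochner_integral_exp_half_line_real:
  assumes "0 < h"
  shows "has_bochner_integral lborel (\<lambda>x. indicat_real {0<..} x * exp (- (h * x))) (1 / h)"
proof -
  have "has_bochner_integral lborel (\<lambda>x. Re (indicat_real {0<..} x *\<^sub>R (cis (0 * x) * of_real (exp (- (h * x))))))
     (Re (1 / (of_real h - \<i> * of_real 0)))"
    by (intro has_bochner_integral_bounded_linear[OF bounded_linear_Re] has_bochner_integral_exp_half_line assms)
  then show ?thesis by simp
qed

lemma bump_hat_integrable:
  assumes h: "0 < h"
  shows "integrable lborel (bump_hat c h)" "square_integrable (bump_hat c h)" "norm2 (bump_hat c h) = 2 * pi\<^sup>2 / h"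
proof -
  show "integrable lborel (bump_hat c h)"
    using has_bochner_integral_exp_half_line[OF h, of "- c"]
    unfolding bump_hat_def by (intro integrable_mult_right) (auto simp: has_bochner_integral_iff)
  have eq: "(cmod (bump_hat c h \<xi>))\<^sup>2 = 4 * pi\<^sup>2 * (indicat_real {0<..} \<xi> * exp (- (2 * h * \<xi>)))" for \<xi>
    by (simp add: bump_hat_def norm_mult power_mult_distrib exp_double[symmetric] mult_ac split: split_indicator)
  have I: "has_bochner_integral lborel (\<lambda>\<xi>. indicat_real {0<..} \<xi> * exp (- (2 * h * \<xi>))) (1 / (2 * h))"
    using h by (intro has_bochner_integral_exp_half_line_real) simp
  then show "square_integrable (bump_hat c h)"
    unfolding square_integrable_def eq by (auto simp: has_bochner_integral_iff)
  show "norm2 (bump_hat c h) = 2 * pi\<^sup>2 / h"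
    unfolding norm2_def eq using I by (simp add: has_bochner_integral_iff)
qed

lemma bump_eq:
  assumes h: "0 < h"
  shows "bump c h x = of_real (1 / (2 * pi)) * (LINT \<xi>|lborel. cis (x * \<xi>) * bump_hat c h \<xi>)"
proof -
  have "(LINT \<xi>|lborel. cis (x * \<xi>) * bump_hat c h \<xi>) =
     (LINT \<xi>|lborel. of_real (2 * pi) * (indicat_real {0<..} \<xi> *\<^sub>R (cis ((x - c) * \<xi>) * of_real (exp (- (h * \<xi>))))))"
  proof (intro Bochner_Integration.integral_cong refl)
    fix \<xi>
    have "cis ((x - c) * \<xi>) = cis (x * \<xi>) * cis (- (c * \<xi>))" by (simp add: cis_mult algebra_simps)
    then show "cis (x * \<xi>) * bump_hat c h \<xi> = of_real (2 * pi) * (indicat_real {0<..} \<xi> *\<^sub>R (cis ((x - c) * \<xi>) * of_real (exp (- (h * \<xi>)))))"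
      by (simp add: bump_hat_def)
  qed
  also have "\<dots> = of_real (2 * pi) * bump c h x"
    using has_bochner_integral_exp_half_line[OF h, of "x - c"]
    by (simp only: integral_mult_right_zero) (simp add: has_bochner_integral_iff bump_def)
  finally show ?thesis by simp
qed

text \<open>The squared norms on the two sides are explicit, \<open>pi / h\<close> and
  \<open>2 * pi\<^sup>2 / h\<close>, so the equality that \<open>is_fourier_L2_inverse\<close> asks
  for can be checked.\<close>

lemma bump_fourier:
  assumes h: "0 < h"
  shows "square_integrable (bump c h)" and "is_fourier_L2 (bump c h) (bump_hat c h)"
proof -
  note G = bump_hat_integrable[OF h, of c]
  have eq: "bump c h = (\<lambda>x. of_real (1 / (2 * pi)) * (LINT \<xi>|lborel. cis (x * \<xi>) * bump_hat c h \<xi>))"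
    using bump_eq[OF h] by blast
  show "square_integrable (bump c h)" unfolding eq by (rule inverse_ft_bound[OF G(1,2)])
  have "(cmod (bump c h x))\<^sup>2 = 1 / (2 * h) * (pker h (c - x))" for x
    using h by (simp add: bump_def norm_divide power_divide cmod_power2 power2_commute[of c x])
  then have "norm2 (bump c h) = (LINT x|lborel. 1 / (2 * h) * (pker h (c - x)))"
    by (simp only: norm2_def)
  also have "\<dots> = 1 / (2 * h) * (2 * pi)"
    using has_bochner_integral_poisson[OF h, of c] by (simp only: integral_mult_right_zero has_bochner_integral_iff)
  finally have n: "norm2 (bump c h) = pi / h" using h by simp
  have "norm2 (bump_hat c h) = 2 * pi * norm2 (bump c h)" using n G(3) by (simp add: power2_eq_square)
  then show "is_fourier_L2 (bump c h) (bump_hat c h)"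
    using is_fourier_L2_inverse[OF G(1,2)] unfolding eq[symmetric] by simp
qed

lemma pext_bump_hat:
  assumes h: "0 < h" "0 \<le> \<eta>"
  shows "pext (bump_hat c h) y \<eta> = of_real (2 * pi) * bump c (h + \<eta>) y"
proof -
  have eq: "complex_of_real (exp (- ((h + \<eta>) * \<xi>))) = of_real (exp (- (\<eta> * \<xi>))) * of_real (exp (- (h * \<xi>)))" for \<xi>
    unfolding of_real_mult[symmetric] exp_add[symmetric] by (simp add: algebra_simps)
  have "pext (bump_hat c h) y \<eta> = (LINT \<xi>|lborel. cis (y * \<xi>) * bump_hat c (h + \<eta>) \<xi>)"
    unfolding pext_def
    by (intro Bochner_Integration.integral_cong refl)
       (auto simp: bump_hat_def eq split: split_indicator)
  also have "\<dots> = of_real (2 * pi) * bump c (h + \<eta>) y"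
    using bump_eq[of "h + \<eta>" c y] h by simp
  finally show ?thesis .
qed

lemma Re_bump: "Re (bump c h x) = h / (h\<^sup>2 + (x - c)\<^sup>2)"
  by (simp add: bump_def Re_divide) (metis power2_commute)

text \<open>Cauchy--Schwarz with the geometric weights \<open>q ^ k\<close>.\<close>

lemma square_integrable_suminf:
  assumes A: "\<And>k. square_integrable (A k)" and q: "0 < q" "q < 1"
    and le: "\<And>k. norm2 (A k) \<le> C * q ^ (4 * k)"
  shows "AE x in lborel. summable (\<lambda>k. A k x)"
    and "square_integrable (\<lambda>x. \<Sum>k. A k x)"
    and "(\<lambda>n. norm2 (\<lambda>x. (\<Sum>k. A k x) - (\<Sum>k<n. A k x))) \<longlonglongrightarrow> 0"
proof -
  have [measurable]: "A k \<in> borel_measurable lborel" for k using A by measurable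
  \<comment> \<open>Half of the assumed decay is taken out: \<open>b k\<close> still has integral at
    most \<open>C * q ^ (2 * k)\<close>, while the weights \<open>q ^ k\<close> are square
    summable.\<close>
  define b where "b = (\<lambda>k x. (cmod (A k x) / q ^ k)\<^sup>2)"
  have [measurable]: "b k \<in> borel_measurable lborel" for k unfolding b_def by measurable
  have b0: "0 \<le> b k x" for k x by (simp add: b_def)
  have q2: "q\<^sup>2 < 1" using q by (simp add: power_less_one_iff)
  have geo: "summable (\<lambda>k. (q\<^sup>2) ^ k)" using q2 q by (intro summable_geometric) auto
  have C0: "0 \<le> C" using le[of 0] norm2_nonneg[of "A 0"] by simp
  have int_b: "integrable lborel (b k)" "(LINT x|lborel. b k x) \<le> C * (q\<^sup>2) ^ k" for k
  proof -
    have beq: "b k x = (cmod (A k x))\<^sup>2 / (q\<^sup>2) ^ k" for x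
      by (simp add: b_def power_divide power_mult[symmetric] mult.commute)
    show "integrable lborel (b k)" unfolding beq using A by (auto simp: square_integrable_def)
    have "(LINT x|lborel. b k x) = norm2 (A k) / (q\<^sup>2) ^ k" unfolding beq norm2_def by simp
    also have "\<dots> \<le> C * q ^ (4 * k) / (q\<^sup>2) ^ k" using q by (intro divide_right_mono le) auto
    also have "\<dots> = C * (q\<^sup>2) ^ k"
    proof -
      have "q ^ (4 * k) = (q\<^sup>2) ^ k * (q\<^sup>2) ^ k"
        by (simp add: power_add[symmetric] power_mult[symmetric])
      then show ?thesis using q by simp
    qed
    finally show "(LINT x|lborel. b k x) \<le> C * (q\<^sup>2) ^ k" .
  qed
  have sumint: "summable (\<lambda>k. LINT x|lborel. norm (b k x))"
    using int_b(2) b0 by (intro summable_comparison_test[OF _ summable_mult[OF geo, of C]])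
      (auto intro!: exI[of _ 0])
  have sumb: "AE x in lborel. summable (\<lambda>k. b k x)"
  proof -
    have "(\<integral>\<^sup>+x. (\<Sum>k. ennreal (b k x)) \<partial>lborel) = (\<Sum>k. \<integral>\<^sup>+x. ennreal (b k x) \<partial>lborel)"
      by (rule nn_integral_suminf) measurable
    also have "\<dots> = (\<Sum>k. ennreal (LINT x|lborel. b k x))"
      by (intro suminf_cong nn_integral_eq_integral int_b AE_I2 b0)
    also have "\<dots> < \<infinity>"
      using sumint b0 by (subst suminf_ennreal2) auto
    finally have "AE x in lborel. (\<Sum>k. ennreal (b k x)) \<noteq> \<infinity>"
      by (intro nn_integral_PInf_AE) auto
    then show ?thesis
    proof eventually_elim
      case (elim x)
      show ?case
        using summable_iff_suminf_neq_top[of "\<lambda>k. b k x", OF b0] elim by fastforce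
    qed
  qed
  define M where "M = (\<lambda>x. \<Sum>k. b k x)"
  have intM: "integrable lborel M"
    unfolding M_def by (rule integrable_suminf[OF int_b(1) _ sumint]) (use sumb b0 in auto)
  define Q where "Q = 1 / (1 - q\<^sup>2)"
  have Q: "(\<Sum>k\<in>I. (q\<^sup>2) ^ k) \<le> Q" if "finite I" for I
  proof -
    have "(\<Sum>k\<in>I. (q\<^sup>2) ^ k) \<le> (\<Sum>k. (q\<^sup>2) ^ k)" by (intro sum_le_suminf geo that) auto
    also have "\<dots> = Q" unfolding Q_def using q2 q by (intro suminf_geometric) auto
    finally show ?thesis .
  qed
  have Q0: "0 \<le> Q" using q2 by (simp add: Q_def)
  have fin: "(cmod (\<Sum>k\<in>I. A k x))\<^sup>2 \<le> Q * M x" if "finite I" "summable (\<lambda>k. b k x)" for I x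
  proof -
    have "cmod (\<Sum>k\<in>I. A k x) \<le> (\<Sum>k\<in>I. q ^ k * (cmod (A k x) / q ^ k))"
      using q by (intro order_trans[OF norm_sum]) simp
    then have "(cmod (\<Sum>k\<in>I. A k x))\<^sup>2 \<le> (\<Sum>k\<in>I. q ^ k * (cmod (A k x) / q ^ k))\<^sup>2"
      by (intro power_mono) auto
    also have "\<dots> \<le> (\<Sum>k\<in>I. (q ^ k)\<^sup>2) * (\<Sum>k\<in>I. (cmod (A k x) / q ^ k)\<^sup>2)"
      by (rule Cauchy_Schwarz_ineq_sum)
    also have "\<dots> \<le> Q * M x"
    proof (intro mult_mono)
      show "(\<Sum>k\<in>I. (q ^ k)\<^sup>2) \<le> Q" using Q[OF that(1)] by (simp add: power_mult[symmetric] mult.commute)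
      show "(\<Sum>k\<in>I. (cmod (A k x) / q ^ k)\<^sup>2) \<le> M x"
        using sum_le_suminf[OF that(2,1) b0] unfolding M_def b_def .
    qed (auto simp: Q0 intro: sum_nonneg)
    finally show ?thesis .
  qed
  have summ: "summable (\<lambda>k. A k x)" if "summable (\<lambda>k. b k x)" for x
  proof (rule summable_comparison_test'[where N=0])
    show "summable (\<lambda>k. (q\<^sup>2) ^ k + b k x)" by (intro summable_add geo that)
    fix k
    have "2 * (q ^ k) * (cmod (A k x) / q ^ k) \<le> (q ^ k)\<^sup>2 + b k x"
      unfolding b_def by (rule sum_squares_bound)
    then show "norm (A k x) \<le> (q\<^sup>2) ^ k + b k x"
      using q by (simp add: power_mult[symmetric] mult.commute) (use norm_ge_zero[of "A k x"] in linarith)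
  qed
  show AEs: "AE x in lborel. summable (\<lambda>k. A k x)"
    using sumb by eventually_elim (rule summ)
  define S where "S = (\<lambda>x. \<Sum>k. A k x)"
  have [measurable]: "S \<in> borel_measurable lborel" unfolding S_def by measurable
  have lim: "(\<lambda>n. \<Sum>k<n. A k x) \<longlonglongrightarrow> S x" if "summable (\<lambda>k. b k x)" for x
    unfolding S_def by (rule summable_LIMSEQ[OF summ[OF that]])
  \<comment> \<open>All tails have the same integrable majorant \<open>Q * M\<close>. With
    \<open>n = 0\<close> it bounds the sum itself, and it dominates the convergence of the partial
    sums.\<close>
  have tail: "(cmod (S x - (\<Sum>k<n. A k x)))\<^sup>2 \<le> Q * M x" if "summable (\<lambda>k. b k x)" for x n
  proof (rule tendsto_upperbound)
    show "(\<lambda>m. (cmod ((\<Sum>k<m. A k x) - (\<Sum>k<n. A k x)))\<^sup>2) \<longlonglongrightarrow> (cmod (S x - (\<Sum>k<n. A k x)))\<^sup>2"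
      by (intro tendsto_intros lim that)
    show "\<forall>\<^sub>F m in sequentially. (cmod ((\<Sum>k<m. A k x) - (\<Sum>k<n. A k x)))\<^sup>2 \<le> Q * M x"
      using eventually_ge_at_top[of n]
    proof eventually_elim
      case (elim m)
      have "(\<Sum>k<m. A k x) - (\<Sum>k<n. A k x) = (\<Sum>k\<in>{..<m} - {..<n}. A k x)"
        using elim by (subst sum_diff) auto
      then show ?case using fin[OF _ that, of "{..<m} - {..<n}"] by simp
    qed
  qed simp
  have "integrable lborel (\<lambda>x. (cmod (S x))\<^sup>2)"
  proof (rule Bochner_Integration.integrable_bound)
    show "integrable lborel (\<lambda>x. Q * M x)" using intM by simp
    show "AE x in lborel. norm ((cmod (S x))\<^sup>2) \<le> norm (Q * M x)"
      using sumb by eventually_elim (use tail[of _ 0] in \<open>auto intro: order_trans[OF _ abs_ge_self]\<close>)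
  qed measurable
  then show "square_integrable (\<lambda>x. \<Sum>k. A k x)" by (simp add: square_integrable_def S_def[symmetric])
  have "(\<lambda>n. norm2 (\<lambda>x. S x - (\<Sum>k<n. A k x))) \<longlonglongrightarrow> (LINT x|(lborel::real measure). 0)"
    unfolding norm2_def
  proof (rule integral_dominated_convergence[where w="\<lambda>x. Q * M x"])
    show "AE x in lborel. norm ((cmod (S x - (\<Sum>k<n. A k x)))\<^sup>2) \<le> Q * M x" for n
      using sumb by eventually_elim (use tail in auto)
    show "AE x in lborel. (\<lambda>n. (cmod (S x - (\<Sum>k<n. A k x)))\<^sup>2) \<longlonglongrightarrow> 0"
      using sumb
    proof eventually_elim
      case (elim x)
      have "(\<lambda>n. (cmod (S x - (\<Sum>k<n. A k x)))\<^sup>2) \<longlonglongrightarrow> (cmod (S x - S x))\<^sup>2"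
        by (intro tendsto_intros lim elim)
      then show ?case by simp
    qed
    show "integrable lborel (\<lambda>x. Q * M x)" using intM by simp
  qed measurable
  then show "(\<lambda>n. norm2 (\<lambda>x. (\<Sum>k. A k x) - (\<Sum>k<n. A k x))) \<longlonglongrightarrow> 0" by (simp add: S_def)
qed

subsection \<open>Combs\<close>

text \<open>The correction term lets the induction telescope; at \<open>n = 0\<close> there is
  equality.\<close>

lemma sum_inverse_square_le: "(\<Sum>d\<le>n. 1 / (1 + (real d)\<^sup>2)) \<le> 3 - 2 / (real n + 1)"
proof (induction n)
  case (Suc n)
  have "1 / (1 + (real (Suc n))\<^sup>2) \<le> 2 / ((real n + 1) * (real n + 2))"
    by (intro divide_le_divide_cross) (auto simp: power2_eq_square algebra_simps add_pos_nonneg)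
  also have "\<dots> = 2 / (real n + 1) - 2 / (real (Suc n) + 1)"
    by (simp add: divide_simps)
  finally show ?case using Suc by simp
qed simp

text \<open>On either side of \<open>l\<close> the distances are distinct natural numbers, so each
  side contributes at most 3.\<close>

lemma lattice_sum_le:
  assumes l: "l \<in> {1..N}"
  shows "(\<Sum>l'\<in>{1..N}. 1 / (1 + (real l' - real l)\<^sup>2)) \<le> 6"
proof -
  let ?g = "\<lambda>d::nat. 1 / (1 + (real d)\<^sup>2)"
  have three: "(\<Sum>d\<le>N. ?g d) \<le> 3"
    using sum_inverse_square_le[of N] by (rule order_trans) simp
  have part: "(\<Sum>l'\<in>A. 1 / (1 + (real l' - real l)\<^sup>2)) \<le> 3"
    if inj: "inj_on d A" and sub: "d ` A \<subseteq> {..N}" and d: "\<And>l'. l' \<in> A \<Longrightarrow> (real (d l'))\<^sup>2 = (real l' - real l)\<^sup>2"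
    for A and d :: "nat \<Rightarrow> nat"
  proof -
    have "(\<Sum>l'\<in>A. 1 / (1 + (real l' - real l)\<^sup>2)) = (\<Sum>l'\<in>A. ?g (d l'))"
      by (intro sum.cong refl) (simp add: d)
    also have "\<dots> = (\<Sum>d\<in>d ` A. ?g d)" by (subst sum.reindex[OF inj]) (simp add: o_def)
    also have "\<dots> \<le> (\<Sum>d\<le>N. ?g d)" by (intro sum_mono2 sub) auto
    finally show ?thesis using three by linarith
  qed
  have "{1..N} = {1..l} \<union> {l<..N}"
    using l unfolding set_eq_iff Un_iff atLeastAtMost_iff greaterThanAtMost_iff by linarith
  then have "(\<Sum>l'\<in>{1..N}. 1 / (1 + (real l' - real l)\<^sup>2)) =
     (\<Sum>l'\<in>{1..l}. 1 / (1 + (real l' - real l)\<^sup>2)) + (\<Sum>l'\<in>{l<..N}. 1 / (1 + (real l' - real l)\<^sup>2))"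
    by (simp only:) (intro sum.union_disjoint, auto)
  also have "(\<Sum>l'\<in>{1..l}. 1 / (1 + (real l' - real l)\<^sup>2)) \<le> 3"
    using l by (intro part[of "\<lambda>l'. l - l'"]) (auto simp: inj_on_def of_nat_diff power2_commute)
  also have "(\<Sum>l'\<in>{l<..N}. 1 / (1 + (real l' - real l)\<^sup>2)) \<le> 3"
    using l by (intro part[of "\<lambda>l'. l' - l"]) (auto simp: inj_on_def of_nat_diff)
  finally show ?thesis by simp
qed

text \<open>The teeth are almost orthogonal: expanding the square gives Poisson kernels at the
  differences of the centres, and these decay like inverse squares because the spacing
  \<open>1 / N\<close> is at least \<open>h\<close>. The bound is therefore of the order of
  \<open>N\<close> single teeth.\<close>

lemma comb_integral_le:
  assumes h: "0 < h" "h * real N \<le> 1"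
  defines "E \<equiv> \<lambda>\<xi>. (\<Sum>l\<in>{1..N}. cis (- (real l / real N * \<xi>)))"
  shows "integrable lborel (\<lambda>\<xi>. indicat_real {0<..} \<xi> * (exp (- (h * \<xi>)) * (cmod (E \<xi>))\<^sup>2))"
    and "(LINT \<xi>|lborel. indicat_real {0<..} \<xi> * (exp (- (h * \<xi>)) * (cmod (E \<xi>))\<^sup>2)) \<le> 6 * real N / h"
proof -
  define c where "c = (\<lambda>l l'::nat. (real l' - real l) / real N)"
  let ?f = "\<lambda>l l' \<xi>. indicat_real {0<..} \<xi> *\<^sub>R (cis (c l l' * \<xi>) * complex_of_real (exp (- (h * \<xi>))))"
  have "has_bochner_integral lborel (\<lambda>\<xi>. \<Sum>l\<in>{1..N}. \<Sum>l'\<in>{1..N}. ?f l l' \<xi>)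
     (\<Sum>l\<in>{1..N}. \<Sum>l'\<in>{1..N}. 1 / (of_real h - \<i> * of_real (c l l')))"
    by (intro has_bochner_integral_sum has_bochner_integral_exp_half_line h)
  then have "has_bochner_integral lborel (\<lambda>\<xi>. Re (\<Sum>l\<in>{1..N}. \<Sum>l'\<in>{1..N}. ?f l l' \<xi>))
     (Re (\<Sum>l\<in>{1..N}. \<Sum>l'\<in>{1..N}. 1 / (of_real h - \<i> * of_real (c l l'))))"
    by (rule has_bochner_integral_bounded_linear[OF bounded_linear_Re])
  moreover have "(\<Sum>l\<in>{1..N}. \<Sum>l'\<in>{1..N}. ?f l l' \<xi>) =
     complex_of_real (indicat_real {0<..} \<xi> * (exp (- (h * \<xi>)) * (cmod (E \<xi>))\<^sup>2))" for \<xi>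
  proof -
    have "complex_of_real ((cmod (E \<xi>))\<^sup>2) = E \<xi> * cnj (E \<xi>)" by (rule complex_norm_square)
    also have "\<dots> = (\<Sum>l\<in>{1..N}. \<Sum>l'\<in>{1..N}. cis (- (real l / real N * \<xi>)) * cnj (cis (- (real l' / real N * \<xi>))))"
      by (simp add: E_def sum_product)
    also have "\<dots> = (\<Sum>l\<in>{1..N}. \<Sum>l'\<in>{1..N}. cis (c l l' * \<xi>))"
      by (intro sum.cong refl) (simp add: cis_cnj cis_mult c_def diff_divide_distrib algebra_simps)
    finally have "complex_of_real (indicat_real {0<..} \<xi> * (exp (- (h * \<xi>)) * (cmod (E \<xi>))\<^sup>2)) =
       of_real (indicat_real {0<..} \<xi>) * (of_real (exp (- (h * \<xi>))) * (\<Sum>l\<in>{1..N}. \<Sum>l'\<in>{1..N}. cis (c l l' * \<xi>)))"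
      by (simp only: of_real_mult)
    then show ?thesis by (simp add: sum_distrib_left scaleR_conv_of_real mult_ac)
  qed
  moreover have "Re (\<Sum>l\<in>{1..N}. \<Sum>l'\<in>{1..N}. 1 / (of_real h - \<i> * of_real (c l l'))) =
     (\<Sum>l\<in>{1..N}. \<Sum>l'\<in>{1..N}. h / (h\<^sup>2 + (c l l')\<^sup>2))"
    by (simp add: Re_divide)
  ultimately have I: "has_bochner_integral lborel (\<lambda>\<xi>. indicat_real {0<..} \<xi> * (exp (- (h * \<xi>)) * (cmod (E \<xi>))\<^sup>2))
      (\<Sum>l\<in>{1..N}. \<Sum>l'\<in>{1..N}. h / (h\<^sup>2 + (c l l')\<^sup>2))"
    by (simp only: Re_complex_of_real)
  then show "integrable lborel (\<lambda>\<xi>. indicat_real {0<..} \<xi> * (exp (- (h * \<xi>)) * (cmod (E \<xi>))\<^sup>2))"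
    by (simp add: has_bochner_integral_iff)
  have "(\<Sum>l\<in>{1..N}. \<Sum>l'\<in>{1..N}. h / (h\<^sup>2 + (c l l')\<^sup>2)) \<le> (\<Sum>l\<in>{1..N}. \<Sum>l'\<in>{1..N}. (1 / h) * (1 / (1 + (real l' - real l)\<^sup>2)))"
  proof (intro sum_mono)
    fix l l' assume "l \<in> {1..N}" "l' \<in> {1..N}"
    then have N: "0 < real N" by simp
    have "h \<le> 1 / real N" using h N by (simp add: field_simps)
    then have "h\<^sup>2 \<le> (1 / real N)\<^sup>2" using h by (intro power_mono) auto
    from mult_left_mono[OF this, of "(real l' - real l)\<^sup>2"]
    have le: "(real l' - real l)\<^sup>2 * h\<^sup>2 \<le> (c l l')\<^sup>2" by (simp add: c_def power_divide)
    have "h * (h * (1 + (real l' - real l)\<^sup>2)) = h\<^sup>2 + (real l' - real l)\<^sup>2 * h\<^sup>2"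
      by (simp add: power2_eq_square algebra_simps)
    also have "\<dots> \<le> 1 * (h\<^sup>2 + (c l l')\<^sup>2)" using le by simp
    finally have "h / (h\<^sup>2 + (c l l')\<^sup>2) \<le> 1 / (h * (1 + (real l' - real l)\<^sup>2))"
      using h by (intro divide_le_divide_cross) (auto simp: add_pos_nonneg)
    then show "h / (h\<^sup>2 + (c l l')\<^sup>2) \<le> (1 / h) * (1 / (1 + (real l' - real l)\<^sup>2))" by simp
  qed
  also have "\<dots> = (\<Sum>l\<in>{1..N}. (1 / h) * (\<Sum>l'\<in>{1..N}. 1 / (1 + (real l' - real l)\<^sup>2)))"
    by (simp only: sum_distrib_left)
  also have "\<dots> \<le> (\<Sum>l\<in>{1..N}. (1 / h) * 6)"
    using h by (intro sum_mono mult_left_mono lattice_sum_le) auto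
  also have "\<dots> = 6 * real N / h" by simp
  finally show "(LINT \<xi>|lborel. indicat_real {0<..} \<xi> * (exp (- (h * \<xi>)) * (cmod (E \<xi>))\<^sup>2)) \<le> 6 * real N / h"
    using I by (simp add: has_bochner_integral_iff)
qed

text \<open>The factor \<open>h\<close> gives every bump the value 1 at its centre, so that
  \<open>a\<close> is the amplitude.\<close>

definition comb_hat :: "real \<Rightarrow> real \<Rightarrow> nat \<Rightarrow> real \<Rightarrow> complex" where
  "comb_hat a h N \<xi> = of_real (a * h) * (\<Sum>l\<in>{1..N}. bump_hat (real l / real N) h \<xi>)"

definition comb :: "real \<Rightarrow> real \<Rightarrow> nat \<Rightarrow> real \<Rightarrow> complex" where
  "comb a h N x = of_real (a * h) * (\<Sum>l\<in>{1..N}. bump (real l / real N) h x)"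

lemma comb_hat_measurable [measurable]: "comb_hat a h N \<in> borel_measurable lborel"
  unfolding comb_hat_def by measurable

lemma comb_fourier:
  assumes h: "0 < h"
  shows "square_integrable (comb a h N)" "square_integrable (comb_hat a h N)"
    "is_fourier_L2 (comb a h N) (comb_hat a h N)" "integrable lborel (comb_hat a h N)"
    "norm2 (comb a h N) \<le> norm2 (comb_hat a h N)"
proof -
  have e1: "comb a h N = (\<lambda>x. of_real (a * h) * (\<Sum>l\<in>{1..N}. bump (real l / real N) h x))"
    and e2: "comb_hat a h N = (\<lambda>x. of_real (a * h) * (\<Sum>l\<in>{1..N}. bump_hat (real l / real N) h x))"
    by (rule ext, simp add: comb_def comb_hat_def)+
  show "square_integrable (comb a h N)"
    unfolding e1 by (intro square_integrable_cmult square_integrable_sum bump_fourier h)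
  show 2: "square_integrable (comb_hat a h N)"
    unfolding e2 by (intro square_integrable_cmult square_integrable_sum bump_hat_integrable h)
  show "is_fourier_L2 (comb a h N) (comb_hat a h N)"
    unfolding e1 e2 by (intro is_fourier_L2_cmult is_fourier_L2_sum conjI bump_fourier h)
  show 1: "integrable lborel (comb_hat a h N)"
    unfolding e2 by (intro integrable_mult_right Bochner_Integration.integrable_sum bump_hat_integrable h)
  have "comb a h N x = of_real (1 / (2 * pi)) * (LINT \<xi>|lborel. cis (x * \<xi>) * comb_hat a h N \<xi>)" for x
  proof -
    have "(LINT \<xi>|lborel. cis (x * \<xi>) * comb_hat a h N \<xi>) =
       (LINT \<xi>|lborel. of_real (a * h) * (\<Sum>l\<in>{1..N}. cis (x * \<xi>) * bump_hat (real l / real N) h \<xi>))"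
      by (intro Bochner_Integration.integral_cong refl) (simp add: comb_hat_def sum_distrib_left mult_ac)
    also have "\<dots> = of_real (a * h) * (\<Sum>l\<in>{1..N}. LINT \<xi>|lborel. cis (x * \<xi>) * bump_hat (real l / real N) h \<xi>)"
      unfolding integral_mult_right_zero
      by (subst Bochner_Integration.integral_sum) (auto intro!: integrable_cis_mult bump_hat_integrable h)
    finally show ?thesis
      unfolding comb_def bump_eq[OF h] by (simp add: sum_distrib_left mult_ac)
  qed
  then have "comb a h N = (\<lambda>x. of_real (1 / (2 * pi)) * (LINT \<xi>|lborel. cis (x * \<xi>) * comb_hat a h N \<xi>))"
    by blast
  then show "norm2 (comb a h N) \<le> norm2 (comb_hat a h N)"
    using inverse_ft_bound(2)[OF 1 2] by simp
qed

text \<open>Half of the decay pays for the Sobolev weight, since \<open>h\<^sup>2 * (1 + x\<^sup>2)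
  \<le> 1 + (h * x)\<^sup>2 \<le> 2 * exp (h * x)\<close>. What is left is the exponential of
  \<open>comb_integral_le\<close>.\<close>

lemma weighted_exp_le:
  fixes h s x :: real
  assumes h: "0 < h" "h \<le> 1" and s: "0 \<le> s" "s \<le> 1" and x: "0 \<le> x"
  shows "(1 + x\<^sup>2) powr s * exp (- (2 * h * x)) \<le> 2 * h powr (- (2 * s)) * exp (- (h * x))"
proof -
  let ?t = "h * x"
  have t: "0 \<le> ?t" using h x by simp
  have "h\<^sup>2 \<le> 1" using h by (simp add: power_le_one)
  then have le: "h\<^sup>2 * (1 + x\<^sup>2) \<le> 1 + ?t\<^sup>2" by (simp add: power_mult_distrib distrib_left)
  have "h powr (2 * s) * (1 + x\<^sup>2) powr s = (h\<^sup>2 * (1 + x\<^sup>2)) powr s"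
    using h by (simp add: powr_mult powr_powr[symmetric])
  also have "\<dots> \<le> (1 + ?t\<^sup>2) powr s" using le s h by (intro powr_mono2) auto
  also have "\<dots> \<le> (1 + ?t\<^sup>2) powr 1" using s by (intro powr_mono) auto
  also have "\<dots> = 1 + ?t\<^sup>2" by (simp add: add_pos_nonneg)
  also have "\<dots> \<le> 2 * exp ?t"
    using exp_lower_Taylor_quadratic[OF t] t by (simp add: field_simps)
  finally have "h powr (2 * s) * (1 + x\<^sup>2) powr s \<le> 2 * exp ?t" .
  then have "(1 + x\<^sup>2) powr s \<le> 2 * exp ?t * h powr (- (2 * s))"
    using h by (simp add: powr_minus field_simps)
  then have "(1 + x\<^sup>2) powr s * exp (- (2 * h * x)) \<le> 2 * exp ?t * h powr (- (2 * s)) * exp (- (2 * h * x))"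
    by (rule mult_right_mono) simp
  also have "\<dots> = 2 * h powr (- (2 * s)) * (exp ?t * exp (- (2 * h * x)))" by simp
  also have "exp ?t * exp (- (2 * h * x)) = exp (- (h * x))"
    by (subst exp_add[symmetric]) (simp add: algebra_simps)
  finally show ?thesis .
qed

text \<open>\<open>norm2 A\<close> is the squared Sobolev norm of the comb: \<open>N\<close> almost
  orthogonal teeth, each of order \<open>a\<^sup>2 * h powr (1 - 2 * s)\<close>. The constant is
  \<open>(2 * pi)\<^sup>2 * 2 * 6\<close>.\<close>

lemma comb_hat_weighted:
  fixes a h s :: real and N :: nat
  assumes h: "0 < h" "h \<le> 1" "h * real N \<le> 1" and s: "0 \<le> s" "s \<le> 1"
  defines "A \<equiv> \<lambda>\<xi>. of_real ((1 + \<xi>\<^sup>2) powr (s / 2)) * comb_hat a h N \<xi>"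
  shows "square_integrable A" "norm2 A \<le> 48 * pi\<^sup>2 * (a\<^sup>2 * h powr (1 - 2 * s) * real N)"
proof -
  define E where "E = (\<lambda>\<xi>. (\<Sum>l\<in>{1..N}. cis (- (real l / real N * \<xi>))))"
  let ?J = "\<lambda>\<xi>. indicat_real {0<..} \<xi> * (exp (- (h * \<xi>)) * (cmod (E \<xi>))\<^sup>2)"
  let ?c = "8 * pi\<^sup>2 * a\<^sup>2 * h powr (2 - 2 * s)"
  have I: "integrable lborel ?J" "(LINT \<xi>|lborel. ?J \<xi>) \<le> 6 * real N / h"
    unfolding E_def by (rule comb_integral_le[OF h(1,3)])+
  have [measurable]: "A \<in> borel_measurable lborel" unfolding A_def by measurable
  have le: "(cmod (A \<xi>))\<^sup>2 \<le> ?c * ?J \<xi>" for \<xi>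
  proof (cases "0 < \<xi>")
    case True
    have "comb_hat a h N \<xi> = of_real (2 * pi * a * h) * (of_real (exp (- (h * \<xi>))) * E \<xi>)"
      using True by (simp add: comb_hat_def bump_hat_def E_def sum_distrib_left mult_ac)
    then have "(cmod (A \<xi>))\<^sup>2 = ((1 + \<xi>\<^sup>2) powr (s / 2))\<^sup>2 * ((2 * pi * a * h)\<^sup>2 * ((exp (- (h * \<xi>)))\<^sup>2 * (cmod (E \<xi>))\<^sup>2))"
      by (simp add: A_def norm_mult power_mult_distrib)
    also have "((1 + \<xi>\<^sup>2) powr (s / 2))\<^sup>2 = (1 + \<xi>\<^sup>2) powr s"
      by (simp add: power2_eq_square[of "_ powr _"] powr_add[symmetric])
    also have "(exp (- (h * \<xi>)))\<^sup>2 = exp (- (2 * h * \<xi>))" by (simp add: exp_double[symmetric])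
    also have "(1 + \<xi>\<^sup>2) powr s * ((2 * pi * a * h)\<^sup>2 * (exp (- (2 * h * \<xi>)) * (cmod (E \<xi>))\<^sup>2)) =
      (2 * pi * a * h)\<^sup>2 * (((1 + \<xi>\<^sup>2) powr s * exp (- (2 * h * \<xi>))) * (cmod (E \<xi>))\<^sup>2)"
      by (simp only: mult_ac)
    also have "\<dots> \<le> (2 * pi * a * h)\<^sup>2 * ((2 * h powr (- (2 * s)) * exp (- (h * \<xi>))) * (cmod (E \<xi>))\<^sup>2)"
      using True by (intro mult_left_mono mult_right_mono weighted_exp_le h s) auto
    also have "\<dots> = 8 * pi\<^sup>2 * a\<^sup>2 * (h\<^sup>2 * h powr (- (2 * s))) * (exp (- (h * \<xi>)) * (cmod (E \<xi>))\<^sup>2)"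
      by (simp add: power_mult_distrib)
    also have "h\<^sup>2 * h powr (- (2 * s)) = h powr (2 - 2 * s)"
      using h powr_add[of h 2 "- (2 * s)"] by simp
    finally show ?thesis using True by simp
  next
    case False
    then show ?thesis by (simp add: A_def comb_hat_def bump_hat_def)
  qed
  show sq: "square_integrable A"
    by (rule square_integrable_bound[OF _ integrable_mult_right[OF I(1)] le]) measurable
  have "norm2 A \<le> (LINT \<xi>|lborel. ?c * ?J \<xi>)"
    unfolding norm2_def using sq I(1) le by (intro integral_mono) (auto simp: square_integrable_def)
  also have "\<dots> = ?c * (LINT \<xi>|lborel. ?J \<xi>)" by (rule integral_mult_right_zero)
  also have "\<dots> \<le> ?c * (6 * real N / h)" by (intro mult_left_mono I(2)) auto
  also have "\<dots> = 48 * pi\<^sup>2 * (a\<^sup>2 * (h powr (2 - 2 * s) / h) * real N)" by simp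
  also have "h powr (2 - 2 * s) / h = h powr (1 - 2 * s)"
    using h powr_diff[of h "2 - 2 * s" 1] by simp
  finally show "norm2 A \<le> 48 * pi\<^sup>2 * (a\<^sup>2 * h powr (1 - 2 * s) * real N)" .
qed

section \<open>Divergence below the threshold\<close>

lemma Re_of_real_times: "Re (of_real r * z) = r * Re z"
  by simp

lemma Re_pext_comb_hat:
  assumes h: "0 < h" and a: "0 \<le> a" and \<eta>: "0 \<le> \<eta>"
  shows "0 \<le> Re (pext (comb_hat a h N) y \<eta>)"
    and "l \<in> {1..N} \<Longrightarrow> 2 * pi * a * h / (h + \<eta>) \<le> Re (pext (comb_hat a h N) (real l / real N) \<eta>)"
proof -
  let ?r = "\<lambda>y l. (h + \<eta>) / ((h + \<eta>)\<^sup>2 + (y - real l / real N)\<^sup>2)"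
  have eq: "Re (pext (comb_hat a h N) y \<eta>) = 2 * pi * a * h * (\<Sum>l\<in>{1..N}. ?r y l)" for y
  proof -
    have int: "integrable lborel (\<lambda>\<xi>. cis (y * \<xi>) * of_real (damp \<eta> \<xi>) * bump_hat c h \<xi>)" for c
    proof (rule Bochner_Integration.integrable_bound[OF bump_hat_integrable(1)[OF h, of c]])
      have "damp \<eta> \<xi> \<le> 1" for \<xi> using \<eta> by simp
      then show "AE \<xi> in lborel. norm (cis (y * \<xi>) * of_real (damp \<eta> \<xi>) * bump_hat c h \<xi>) \<le> norm (bump_hat c h \<xi>)"
        by (intro AE_I2) (simp add: norm_mult mult_left_le_one_le)
    qed measurable
    have "pext (comb_hat a h N) y \<eta> = (LINT \<xi>|lborel. of_real (a * h) *
       (\<Sum>l\<in>{1..N}. cis (y * \<xi>) * of_real (damp \<eta> \<xi>) * bump_hat (real l / real N) h \<xi>))"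
      unfolding pext_def
      by (intro Bochner_Integration.integral_cong refl) (simp add: comb_hat_def sum_distrib_left mult_ac)
    also have "\<dots> = of_real (a * h) * (\<Sum>l\<in>{1..N}. pext (bump_hat (real l / real N) h) y \<eta>)"
      unfolding integral_mult_right_zero pext_def
      by (subst Bochner_Integration.integral_sum) (auto intro!: int)
    also have "\<dots> = of_real (a * h) * (\<Sum>l\<in>{1..N}. of_real (2 * pi) * bump (real l / real N) (h + \<eta>) y)"
      by (simp only: pext_bump_hat[OF h \<eta>])
    also have "\<dots> = of_real (2 * pi * a * h) * (\<Sum>l\<in>{1..N}. bump (real l / real N) (h + \<eta>) y)"
      by (simp add: sum_distrib_left[symmetric])
    finally show ?thesis by (simp only: Re_of_real_times Re_sum Re_bump)
  qed
  have r0: "0 \<le> ?r y l" for y l using h \<eta> by simp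
  show "0 \<le> Re (pext (comb_hat a h N) y \<eta>)"
    unfolding eq using h a by (intro mult_nonneg_nonneg sum_nonneg r0) auto
  assume l: "l \<in> {1..N}"
  have "1 / (h + \<eta>) = ?r (real l / real N) l" using h \<eta> by (simp add: power2_eq_square)
  also have "\<dots> \<le> (\<Sum>l'\<in>{1..N}. ?r (real l / real N) l')"
    by (rule member_le_sum[OF l r0]) simp
  finally have "2 * pi * a * h * (1 / (h + \<eta>)) \<le> 2 * pi * a * h * (\<Sum>l'\<in>{1..N}. ?r (real l / real N) l')"
    using h a by (intro mult_left_mono) auto
  then show "2 * pi * a * h / (h + \<eta>) \<le> Re (pext (comb_hat a h N) (real l / real N) \<eta>)"
    unfolding eq by simp
qed

text \<open>At a fixed time the curve is a translation. The Hoelder constant 3 consists of 1 for the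
  power, which is subadditive, and 2 for the linear term, whose purpose is to cancel the drift of
  the positive frequencies.\<close>

lemma admissible_tangential:
  assumes \<alpha>: "0 < \<alpha>" "\<alpha> \<le> 1"
  shows "admissible_curve \<alpha> (\<lambda>x t. x + (\<bar>t\<bar> powr \<alpha> - t))"
proof -
  have hoelder: "\<bar>x + (\<bar>t\<bar> powr \<alpha> - t) - (x + (\<bar>t'\<bar> powr \<alpha> - t'))\<bar> \<le> 3 * \<bar>t - t'\<bar> powr \<alpha>"
    if t: "t \<in> {-1..1}" "t' \<in> {-1..1}" for x t t' :: real
  proof -
  have sub: "u powr \<alpha> \<le> v powr \<alpha> + \<bar>u - v\<bar> powr \<alpha>" if uv: "0 \<le> u" "0 \<le> v" for u v :: real
  proof (cases "u \<le> v")
    case True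
    then have "u powr \<alpha> \<le> v powr \<alpha>" using uv \<alpha> by (intro powr_mono2) auto
    then show ?thesis by (simp add: add_increasing2)
  next
    case False
    define w where "w = u - v"
    have w: "0 < w" "u = v + w" "0 < u" using False uv by (auto simp: w_def)
    \<comment> \<open>Numbers in the unit interval do not exceed their \<alpha>-th power, and the
      two fractions add up to 1.\<close>
    have "v / u \<le> (v / u) powr \<alpha>" "w / u \<le> (w / u) powr \<alpha>"
      using powr_mono'[of \<alpha> 1 "v / u"] powr_mono'[of \<alpha> 1 "w / u"] uv w \<alpha> by (auto simp: divide_le_eq)
    moreover have "v / u + w / u = 1" using w by (simp add: add_divide_distrib[symmetric])
    ultimately have "1 \<le> (v / u) powr \<alpha> + (w / u) powr \<alpha>" by linarith
    also have "\<dots> = (v powr \<alpha> + w powr \<alpha>) / u powr \<alpha>" using uv w by (simp add: powr_divide add_divide_distrib)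
    finally have "u powr \<alpha> \<le> v powr \<alpha> + w powr \<alpha>" using w by (simp add: field_simps)
    moreover have "\<bar>u - v\<bar> = w" using w(1) by (simp add: w_def)
    ultimately show ?thesis by simp
  qed
  have "\<bar>\<bar>t\<bar> - \<bar>t'\<bar>\<bar> powr \<alpha> \<le> \<bar>t - t'\<bar> powr \<alpha>" using \<alpha> by (intro powr_mono2) auto
  then have 1: "\<bar>\<bar>t\<bar> powr \<alpha> - \<bar>t'\<bar> powr \<alpha>\<bar> \<le> \<bar>t - t'\<bar> powr \<alpha>"
    using sub[of "\<bar>t\<bar>" "\<bar>t'\<bar>"] sub[of "\<bar>t'\<bar>" "\<bar>t\<bar>"] by (simp add: abs_minus_commute abs_le_iff)
  have 2: "\<bar>t - t'\<bar> \<le> 2 * \<bar>t - t'\<bar> powr \<alpha>"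
  proof -
    \<comment> \<open>Two times can be 2 apart, so the distance is halved to reach the unit
      interval, where the power dominates.\<close>
    let ?d = "\<bar>t - t'\<bar> / 2"
    have d: "0 \<le> ?d" "?d \<le> 1" using t by auto
    have "?d \<le> ?d powr \<alpha>" using powr_mono'[of \<alpha> 1 ?d] d \<alpha> by simp
    also have "\<dots> \<le> \<bar>t - t'\<bar> powr \<alpha>" using \<alpha> by (intro powr_mono2) auto
    finally show ?thesis by simp
  qed
  show ?thesis using 1 2 by linarith
  qed
  have "continuous_on (UNIV \<times> {-1..1}) (\<lambda>(x, t). x + (\<bar>t\<bar> powr \<alpha> - t))"
    unfolding case_prod_beta using \<alpha> by (intro continuous_intros continuous_on_powr') auto
  moreover have "\<exists>C1 C2 C3. C1 > 0 \<and> C2 > 0 \<and> C3 > 0 \<and>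
        (\<forall>t\<in>{-1..1}. \<forall>x x'. C1 * \<bar>x - x'\<bar> \<le> \<bar>x + (\<bar>t\<bar> powr \<alpha> - t) - (x' + (\<bar>t\<bar> powr \<alpha> - t))\<bar> \<and>
                                 \<bar>x + (\<bar>t\<bar> powr \<alpha> - t) - (x' + (\<bar>t\<bar> powr \<alpha> - t))\<bar> \<le> C2 * \<bar>x - x'\<bar>) \<and>
        (\<forall>x. \<forall>t\<in>{-1..1}. \<forall>t'\<in>{-1..1}.
            \<bar>x + (\<bar>t\<bar> powr \<alpha> - t) - (x + (\<bar>t'\<bar> powr \<alpha> - t'))\<bar> \<le> C3 * \<bar>t - t'\<bar> powr \<alpha>)"
    by (rule exI[of _ 1], rule exI[of _ 1], rule exI[of _ 3]) (use hoelder in \<open>simp del: atLeastAtMost_iff\<close>)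
  ultimately show ?thesis unfolding admissible_curve_def by simp
qed

text \<open>Each comb has its teeth at distance \<open>1 / N\<close>, and the curve started at any point of the unit interval
  runs, within that distance, into a point above a tooth at height at most its width. Since
  the bumps have positive real part there is no cancellation between them.\<close>

lemma divergence_below_threshold:
  fixes \<gamma> \<alpha> s :: real
  assumes \<gamma>: "0 < \<gamma>" and \<alpha>: "0 < \<alpha>" "\<alpha> \<le> 1" and s: "0 \<le> s" "s < 1/2 * max (1 - \<alpha> / \<gamma>) 0"
  shows "\<exists>f. in_sobolev s f \<and> \<not> converges_ae 1 \<gamma> (\<lambda>x t. x + (\<bar>t\<bar> powr \<alpha> - t)) f"
proof -
  define \<sigma> where "\<sigma> = \<gamma> / \<alpha>"
  \<comment> \<open>A maximum equal to 0 would contradict \<open>0 \<le> s\<close>; so \<alpha> <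
    \<gamma>, and the approach is genuinely tangential.\<close>
  have s2: "2 * s < 1 - \<alpha> / \<gamma>" using s by (auto simp: max_def split: if_splits)
  have \<sigma>: "1 < \<sigma>" and \<sigma>0: "0 < \<sigma>"
  proof -
    have "\<alpha> / \<gamma> < 1" using s2 s(1) by linarith
    then show "1 < \<sigma>" using \<gamma> \<alpha> by (simp add: \<sigma>_def)
    then show "0 < \<sigma>" by simp
  qed
  \<comment> \<open>With \<open>2 ^ k\<close> teeth of width
    \<open>2 powr (- (\<sigma> * k))\<close>, a comb of amplitude 1 has squared Sobolev norm of
    order at most \<open>2 powr (- (\<kappa> * k))\<close>.\<close>
  define \<kappa> where "\<kappa> = \<sigma> * (1 - 2 * s) - 1"
  have \<kappa>: "0 < \<kappa>"
  proof -
    have "\<sigma> * (\<alpha> / \<gamma>) < \<sigma> * (1 - 2 * s)" using s2 \<sigma>0 by (intro mult_strict_left_mono) auto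
    moreover have "\<sigma> * (\<alpha> / \<gamma>) = 1" using \<gamma> \<alpha> by (simp add: \<sigma>_def)
    ultimately show ?thesis unfolding \<kappa>_def by linarith
  qed
  have s1: "s \<le> 1" using s2 \<gamma> \<alpha> by (smt (verit) divide_pos_pos)
  define h where "h = (\<lambda>k::nat. 2 powr (- (\<sigma> * real k)))"
  \<comment> \<open>Half of the gain \<kappa> is spent on amplitudes tending to infinity; the other
    half is \<open>q ^ (4 * k)\<close>, the form in which the summation lemma expects the
    decay.\<close>
  define a where "a = (\<lambda>k::nat. 2 powr (\<kappa> * real k / 4))"
  define q where "q = 2 powr (- (\<kappa> / 8))"
  have h: "0 < h k" "h k \<le> 1" "h k * real (2 ^ k) \<le> 1" for k
  proof -
    show "0 < h k" by (simp add: h_def)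
    have "h k * real (2 ^ k) = 2 powr (- (\<sigma> * real k) + real k)"
      unfolding h_def powr_add by (simp add: powr_realpow)
    also have "\<dots> \<le> 2 powr 0"
      using \<sigma> by (intro powr_mono) (auto simp: mult_le_cancel_right1)
    finally show "h k * real (2 ^ k) \<le> 1" by simp
    have "2 powr (- (\<sigma> * real k)) \<le> 2 powr (0::real)"
      using \<sigma>0 by (intro powr_mono) auto
    then show "h k \<le> 1" by (simp add: h_def)
  qed
  have q: "0 < q" "q < 1"
  proof -
    have "2 powr (- (\<kappa> / 8)) < 2 powr (0::real)" using \<kappa> by (intro powr_less_mono) auto
    then show "q < 1" "0 < q" by (simp_all add: q_def)
  qed
  have size: "(a k)\<^sup>2 * h k powr (1 - 2 * s) * real (2 ^ k) = q ^ (4 * k)" for k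
  proof -
    have "(a k)\<^sup>2 = 2 powr (\<kappa> * real k / 2)"
      by (simp add: a_def power2_eq_square powr_add[symmetric])
    moreover have "h k powr (1 - 2 * s) = 2 powr (- (\<sigma> * real k) * (1 - 2 * s))"
      by (simp add: h_def powr_powr)
    moreover have "real (2 ^ k) = 2 powr real k" by (simp add: powr_realpow)
    ultimately have "(a k)\<^sup>2 * h k powr (1 - 2 * s) * real (2 ^ k) =
       2 powr (\<kappa> * real k / 2 + - (\<sigma> * real k) * (1 - 2 * s) + real k)"
      by (simp only: powr_add)
    also have "\<kappa> * real k / 2 + - (\<sigma> * real k) * (1 - 2 * s) + real k = - (\<kappa> * real k / 2)"
      by (simp add: \<kappa>_def field_simps)
    also have "2 powr (- (\<kappa> * real k / 2)) = q ^ (4 * k)"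
      by (simp add: q_def powr_power field_simps)
    finally show ?thesis .
  qed
  define Fk where "Fk = (\<lambda>k. comb_hat (a k) (h k) (2 ^ k))"
  define fk where "fk = (\<lambda>k. comb (a k) (h k) (2 ^ k))"
  define C where "C = 48 * pi\<^sup>2"
  have fk: "square_integrable (fk k)" "square_integrable (Fk k)" "is_fourier_L2 (fk k) (Fk k)"
    "norm2 (fk k) \<le> norm2 (Fk k)" for k
    unfolding Fk_def fk_def by (intro comb_fourier h)+
  have [measurable]: "Fk k \<in> borel_measurable lborel" "fk k \<in> borel_measurable lborel" for k
    using fk by measurable
  \<comment> \<open>The weighted transforms are a third series of the same kind. Its sum is the
    weighted transform of the limit, from which membership in the Sobolev space is read off.\<close>
  define A where "A = (\<lambda>k \<xi>. of_real ((1 + \<xi>\<^sup>2) powr (s / 2)) * Fk k \<xi>)"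
  have A: "square_integrable (A k)" "norm2 (A k) \<le> C * q ^ (4 * k)" for k
    using comb_hat_weighted[where a="a k" and N="2 ^ k", OF h[of k] s(1) s1] unfolding A_def Fk_def C_def size by auto
  have w1: "1 \<le> (1 + \<xi>\<^sup>2) powr (s / 2)" for \<xi> :: real
    using s by (intro ge_one_powr_ge_zero) auto
  have nF: "norm2 (Fk k) \<le> C * q ^ (4 * k)" for k
  proof -
    have "norm2 (Fk k) \<le> norm2 (A k)"
    proof (rule norm2_mono[OF A(1)])
      fix \<xi>
      show "cmod (Fk k \<xi>) \<le> cmod (A k \<xi>)"
        using mult_right_mono[OF w1[of \<xi>], of "cmod (Fk k \<xi>)"] by (simp add: A_def norm_mult)
    qed
    with A(2)[of k] show ?thesis by linarith
  qed
  have nf: "norm2 (fk k) \<le> C * q ^ (4 * k)" for k using fk(4)[of k] nF[of k] by linarith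
  define F where "F = (\<lambda>\<xi>. \<Sum>k. Fk k \<xi>)"
  define f where "f = (\<lambda>x. \<Sum>k. fk k x)"
  note SF = square_integrable_suminf[OF fk(2) q nF, folded F_def]
  note Sf = square_integrable_suminf[OF fk(1) q nf, folded f_def]
  note SA = square_integrable_suminf[OF A(1) q A(2)]
  have sF: "square_integrable F" and sf: "square_integrable f" using SF(2) Sf(2) by (simp_all add: F_def f_def)
  have limF: "(\<lambda>n. norm2 (\<lambda>\<xi>. F \<xi> - (\<Sum>k<n. Fk k \<xi>))) \<longlonglongrightarrow> 0"
    and limf: "(\<lambda>n. norm2 (\<lambda>x. f x - (\<Sum>k<n. fk k x))) \<longlonglongrightarrow> 0"
    using SF(3) Sf(3) by (simp_all add: F_def f_def)
  have fF: "is_fourier_L2 f F"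
  proof (rule is_fourier_L2_limit[OF sf sF])
    fix e :: real assume e: "e > 0"
    have "\<forall>\<^sub>F n in sequentially. norm2 (\<lambda>x. f x - (\<Sum>k<n. fk k x)) < e \<and> norm2 (\<lambda>\<xi>. F \<xi> - (\<Sum>k<n. Fk k \<xi>)) < e"
      using order_tendstoD(2)[OF limf e] order_tendstoD(2)[OF limF e] by eventually_elim simp
    then obtain n where "norm2 (\<lambda>x. f x - (\<Sum>k<n. fk k x)) < e" "norm2 (\<lambda>\<xi>. F \<xi> - (\<Sum>k<n. Fk k \<xi>)) < e"
      by (auto simp: eventually_sequentially)
    moreover have "square_integrable (\<lambda>x. \<Sum>k<n. fk k x)" "is_fourier_L2 (\<lambda>x. \<Sum>k<n. fk k x) (\<lambda>\<xi>. \<Sum>k<n. Fk k \<xi>)"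
      by (intro square_integrable_sum is_fourier_L2_sum conjI fk)+
    ultimately show "\<exists>g G. square_integrable g \<and> is_fourier_L2 g G \<and> norm2 (\<lambda>x. f x - g x) < e \<and> norm2 (\<lambda>\<xi>. F \<xi> - G \<xi>) < e"
      by blast
  qed
  have [measurable]: "F \<in> borel_measurable lborel" "f \<in> borel_measurable lborel" using sF sf by measurable
  have "integrable lborel (wsq s F)"
  proof (rule integrable_cong_AE_imp)
    show "integrable lborel (\<lambda>\<xi>. (cmod (\<Sum>k. A k \<xi>))\<^sup>2)" using SA(2) by (simp add: square_integrable_def)
    show "AE \<xi> in lborel. (cmod (\<Sum>k. A k \<xi>))\<^sup>2 = wsq s F \<xi>"
      using SF(1)
    proof eventually_elim
      case (elim \<xi>)
      have "(\<Sum>k. A k \<xi>) = of_real ((1 + \<xi>\<^sup>2) powr (s / 2)) * F \<xi>"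
        unfolding A_def F_def by (rule suminf_mult[OF elim])
      then show ?case
        by (simp add: norm_mult power_mult_distrib power2_eq_square[of "_ powr _"] powr_add[symmetric])
    qed
  qed measurable
  then have sob: "in_sobolev s f" using sf fF by (auto simp: in_sobolev_def)
  \<comment> \<open>\<open>fourier_hat\<close> is a choice, known only up to null sets; this is
    enough because it enters \<open>P_op\<close> under the integral.\<close>
  have hat: "AE \<xi> in lborel. fourier_hat f \<xi> = F \<xi>"
    by (rule is_fourier_L2_unique[OF sf in_sobolev_fourier_hat(1)[OF sob] fF])
  have "is_fourier_L2 f (fourier_hat f)" by (rule in_sobolev_fourier_hat(1)[OF sob])
  then have [measurable]: "fourier_hat f \<in> borel_measurable lborel"
    by (auto simp: is_fourier_L2_def square_integrable_def)
  have F0: "F \<xi> = 0" if "\<xi> \<le> 0" for \<xi>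
    using that by (simp add: F_def Fk_def comb_hat_def bump_hat_def)
  have P: "P_op 1 \<gamma> f y t = of_real (1 / (2 * pi)) * pext F (y + t) (t powr \<gamma>)" for y t
  proof -
    have "(LINT \<xi>|lborel. cis (y * \<xi> + t * \<bar>\<xi>\<bar>) * of_real (damp (t powr \<gamma>) \<xi>) * fourier_hat f \<xi>) =
       pext F (y + t) (t powr \<gamma>)"
      unfolding pext_def
    proof (rule integral_cong_AE)
      show "AE \<xi> in lborel. cis (y * \<xi> + t * \<bar>\<xi>\<bar>) * of_real (damp (t powr \<gamma>) \<xi>) * fourier_hat f \<xi> =
         cis ((y + t) * \<xi>) * of_real (damp (t powr \<gamma>) \<xi>) * F \<xi>"
        using hat
      proof eventually_elim
        case (elim \<xi>)
        show ?case
        proof (cases "\<xi> \<le> 0")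
          case True
          then show ?thesis using F0 elim by simp
        next
          case False
          then have "y * \<xi> + t * \<bar>\<xi>\<bar> = (y + t) * \<xi>" by (simp add: distrib_right)
          then show ?thesis using elim by simp
        qed
      qed
    qed measurable
    then show ?thesis by (simp only: P_op_eq)
  qed
  \<comment> \<open>At a fixed positive height the partial sums converge, and all combs have
    nonnegative real part there, so the limit inherits the lower bound from tooth \<open>l\<close>
    of comb \<open>k\<close>.\<close>
  have lower: "2 * pi * a k * h k / (h k + \<eta>) \<le> Re (pext F (real l / 2 ^ k) \<eta>)" if \<eta>: "0 < \<eta>" and l: "l \<in> {1..2 ^ k}" for k l \<eta>
  proof -
    let ?y = "real l / 2 ^ k"
    let ?S = "\<lambda>n \<xi>. \<Sum>k<n. Fk k \<xi>"
    have sS: "square_integrable (?S n)" for n by (intro square_integrable_sum fk)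
    have "(\<lambda>n. pext (?S n) ?y \<eta>) \<longlonglongrightarrow> pext F ?y \<eta>"
      by (intro tendsto_pext_L2 sF sS \<eta> limF)
    then have limRe: "(\<lambda>n. Re (pext (?S n) ?y \<eta>)) \<longlonglongrightarrow> Re (pext F ?y \<eta>)" by (rule tendsto_Re)
    have sum: "pext (?S n) y \<eta> = (\<Sum>k<n. pext (Fk k) y \<eta>)" for n y
      unfolding pext_def
      by (subst Bochner_Integration.integral_sum[symmetric])
         (auto intro!: exp_integrable_pext square_integrable_exp_integrable fk \<eta> simp: sum_distrib_left)
    have a0: "0 \<le> a k" for k by (simp add: a_def)
    have pos: "0 \<le> Re (pext (Fk j) ?y \<eta>)" for j
      unfolding Fk_def using \<eta> by (intro Re_pext_comb_hat(1) h a0) auto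
    have tooth: "2 * pi * a k * h k / (h k + \<eta>) \<le> Re (pext (Fk k) ?y \<eta>)"
      using Re_pext_comb_hat(2)[OF h(1) a0, of \<eta> l "2 ^ k"] \<eta> l by (simp add: Fk_def)
    have "\<forall>\<^sub>F n in sequentially. 2 * pi * a k * h k / (h k + \<eta>) \<le> Re (pext (?S n) ?y \<eta>)"
      using eventually_gt_at_top[of k]
    proof eventually_elim
      case (elim n)
      have "Re (pext (Fk k) ?y \<eta>) \<le> (\<Sum>j<n. Re (pext (Fk j) ?y \<eta>))"
        using elim by (intro member_le_sum pos) auto
      then show ?case using tooth by (simp add: sum Re_sum)
    qed
    then show ?thesis by (intro tendsto_lowerbound[OF limRe]) auto
  qed
  \<comment> \<open>Whatever the value \<open>f x\<close> is, the evolution is unbounded along times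
    tending to 0, and this at every point of the open unit interval.\<close>
  have div: "\<not> ((\<lambda>t. P_op 1 \<gamma> f (x + (\<bar>t\<bar> powr \<alpha> - t)) t) \<longlongrightarrow> f x) (at_right 0)" if x: "0 < x" "x < 1" for x
  proof
    assume conv: "((\<lambda>t. P_op 1 \<gamma> f (x + (\<bar>t\<bar> powr \<alpha> - t)) t) \<longlongrightarrow> f x) (at_right 0)"
    have "\<forall>\<^sub>F t in at_right 0. dist (P_op 1 \<gamma> f (x + (\<bar>t\<bar> powr \<alpha> - t)) t) (f x) < 1"
      using conv by (rule tendstoD) simp
    then obtain d where d: "0 < d" "\<And>t. 0 < t \<Longrightarrow> t < d \<Longrightarrow> dist (P_op 1 \<gamma> f (x + (\<bar>t\<bar> powr \<alpha> - t)) t) (f x) < 1"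
      unfolding eventually_at_right_field by auto
    have bound: "\<exists>t. 0 < t \<and> t \<le> (1 / 2 ^ k) powr (1 / \<alpha>) \<and> a k / 2 \<le> Re (P_op 1 \<gamma> f (x + (\<bar>t\<bar> powr \<alpha> - t)) t)" for k
    proof -
      \<comment> \<open>Tooth \<open>l\<close> is the first one strictly to the right of
        \<open>x\<close>, also when \<open>x\<close> is a lattice point, which makes
        \<open>\<tau>\<close> positive. As \<open>x < 1\<close>, it is one of the
        \<open>2 ^ k\<close> teeth.\<close>
      define m where "m = nat \<lfloor>x * 2 ^ k\<rfloor>"
      define l where "l = m + 1"
      have m: "real m \<le> x * 2 ^ k" "x * 2 ^ k < real m + 1"
        using x by (auto simp: m_def)
      have "x * 2 ^ k < 1 * 2 ^ k" using x by (intro mult_strict_right_mono) auto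
      from order.strict_trans1[OF m(1) this] have "real m < real (2 ^ k)"
        by (simp only: mult_1 of_nat_power of_nat_numeral)
      then have "m < 2 ^ k" by (simp only: of_nat_less_iff)
      then have l: "l \<in> {1..2 ^ k}" by (simp add: l_def)
      define \<tau> where "\<tau> = real l / 2 ^ k - x"
      have \<tau>: "0 < \<tau>" "\<tau> \<le> 1 / 2 ^ k" using m by (auto simp: \<tau>_def l_def field_simps)
      \<comment> \<open>The time at which the shift \<open>t powr \<alpha>\<close> has carried
        \<open>x\<close> to that tooth. The height is then \<open>\<tau> powr \<sigma>\<close>, at
        most \<open>h k\<close>: this dictates the choice of the widths.\<close>
      define t where "t = \<tau> powr (1 / \<alpha>)"
      have t: "0 < t" "t \<le> (1 / 2 ^ k) powr (1 / \<alpha>)" using \<tau> \<alpha> by (auto simp: t_def intro: powr_mono2)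
      have ta: "\<bar>t\<bar> powr \<alpha> = \<tau>" using t \<tau> \<alpha> by (simp add: t_def powr_powr)
      have y: "x + (\<bar>t\<bar> powr \<alpha> - t) + t = real l / 2 ^ k" unfolding ta by (simp add: \<tau>_def)
      have "t powr \<gamma> = \<tau> powr \<sigma>" by (simp add: t_def powr_powr \<sigma>_def)
      also have "\<dots> \<le> (1 / 2 ^ k) powr \<sigma>" using \<tau> \<sigma>0 by (intro powr_mono2) auto
      also have "1 / 2 ^ k = 2 powr (- real k)" by (simp add: powr_minus powr_realpow divide_inverse)
      also have "(2 powr (- real k)) powr \<sigma> = h k" by (simp add: h_def powr_powr mult.commute)
      finally have \<eta>: "t powr \<gamma> \<le> h k" .
      have \<eta>0: "0 < t powr \<gamma>" using t by simp
      \<comment> \<open>At a height up to its width a tooth keeps at least half of its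
        amplitude.\<close>
      have "a k / 2 = a k * h k / (2 * h k)" using h(1)[of k] by simp
      also have "\<dots> \<le> a k * h k / (h k + t powr \<gamma>)"
        using \<eta> \<eta>0 h(1)[of k] by (intro divide_left_mono mult_pos_pos add_pos_pos) (auto simp: a_def)
      also have "\<dots> = 1 / (2 * pi) * (2 * pi * a k * h k / (h k + t powr \<gamma>))" by simp
      also have "\<dots> \<le> 1 / (2 * pi) * Re (pext F (real l / 2 ^ k) (t powr \<gamma>))"
        by (intro mult_left_mono lower \<eta>0 l) auto
      also have "\<dots> = Re (P_op 1 \<gamma> f (x + (\<bar>t\<bar> powr \<alpha> - t)) t)"
        unfolding P y by (simp only: Re_of_real_times)
      finally show ?thesis using t by blast
    qed
    have t0: "(\<lambda>k. (1 / 2 ^ k) powr (1 / \<alpha>)) \<longlonglongrightarrow> 0"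
    proof -
      have "(\<lambda>k. (1 / 2) ^ k :: real) \<longlonglongrightarrow> 0" by (rule LIMSEQ_power_zero) simp
      then have "(\<lambda>k. 1 / 2 ^ k :: real) \<longlonglongrightarrow> 0" by (simp add: power_one_over)
      then have "(\<lambda>k. (1 / 2 ^ k) powr (1 / \<alpha>)) \<longlonglongrightarrow> 0 powr (1 / \<alpha>)"
        using \<alpha> by (intro tendsto_powr') auto
      then show ?thesis by simp
    qed
    have at: "filterlim a at_top sequentially"
      unfolding a_def using \<kappa> by real_asymp
    have "\<forall>\<^sub>F k in sequentially. (1 / 2 ^ k) powr (1 / \<alpha>) < d \<and> 2 * (cmod (f x) + 1) < a k"
      using order_tendstoD(2)[OF t0 d(1)] at[unfolded filterlim_at_top_dense, rule_format, of "2 * (cmod (f x) + 1)"]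
      by eventually_elim simp
    then obtain k where k: "(1 / 2 ^ k) powr (1 / \<alpha>) < d" "2 * (cmod (f x) + 1) < a k"
      by (auto simp: eventually_sequentially)
    obtain t where t: "0 < t" "t \<le> (1 / 2 ^ k) powr (1 / \<alpha>)" "a k / 2 \<le> Re (P_op 1 \<gamma> f (x + (\<bar>t\<bar> powr \<alpha> - t)) t)"
      using bound[of k] by blast
    define p where "p = P_op 1 \<gamma> f (x + (\<bar>t\<bar> powr \<alpha> - t)) t"
    have "cmod (p - f x) < 1" using d(2)[of t] t k by (simp add: dist_norm p_def)
    moreover have "Re p \<le> cmod (p - f x) + cmod (f x)"
      using complex_Re_le_cmod[of p] norm_triangle_ineq[of "p - f x" "f x"] by simp
    ultimately show False using t(3)[folded p_def] k(2) by argo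
  qed
  have "\<not> converges_ae 1 \<gamma> (\<lambda>x t. x + (\<bar>t\<bar> powr \<alpha> - t)) f"
  proof
    assume "converges_ae 1 \<gamma> (\<lambda>x t. x + (\<bar>t\<bar> powr \<alpha> - t)) f"
    then have "AE x in lborel. x \<notin> {0<..<1::real}"
      unfolding converges_ae_def by eventually_elim (use div in auto)
    then have "emeasure lborel {0<..<1::real} = 0"
      by (subst (asm) AE_iff_null_sets[symmetric]) auto
    then show False by simp
  qed
  with sob show ?thesis by blast
qed

text \<open>\<open>in_sobolev\<close> includes square integrability and so describes the Sobolev
  space for nonnegative exponents, the range in which the converse is stated. The curve of the
  converse is chosen before \<open>s\<close>; only the function depends on \<open>s\<close>.\<close>

theorem theorem4p3:
  fixes \<gamma> \<alpha> :: real
  assumes "\<gamma> > 0" and "0 < \<alpha>" and "\<alpha> \<le> 1"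
  shows "(\<forall>\<Gamma>. admissible_curve \<alpha> \<Gamma> \<longrightarrow>
            (\<forall>s. s > (1/2) * max (1 - \<alpha> / \<gamma>) 0 \<longrightarrow>
               (\<forall>f. in_sobolev s f \<longrightarrow> converges_ae 1 \<gamma> \<Gamma> f)))
       \<and> (\<exists>\<Gamma>. admissible_curve \<alpha> \<Gamma> \<and>
            (\<forall>s. 0 \<le> s \<and> s < (1/2) * max (1 - \<alpha> / \<gamma>) 0 \<longrightarrow>
               (\<exists>f. in_sobolev s f \<and> \<not> converges_ae 1 \<gamma> \<Gamma> f)))"
  using convergence_above_threshold[OF assms] admissible_tangential[OF assms(2,3)] divergence_below_threshold[OF assms]
  by blast

end
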